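(* Let $f,g_1,\dots,g_m\in\mathbb{R}[x]$ and set $g:=(g_1,\dots,g_m)$. Assume that $f$ is non-negative on $S(g)$ and that $f(C(g))$ is finite (possibly empty). Then there exists $q\in P(g)[x,\bar\lambda]$ such that $f-q$ vanishes on $V(h_{\mathrm{FJ}})$. Moreover, if $S(g)$ satisfies the Archimedean condition, one can take $q\in Q(g)[x,\bar\lambda]$.
   Context: Let $n,m\ge 1$, $x=(x_1,\dots,x_n)$ and $\bar\lambda:=(\lambda_0,\lambda_1,\dots,\lambda_m)$ be vectors of variables; polynomials in $x$ are also regarded as polynomials in $(x,\bar\lambda)$. For $p\in\mathbb{R}[x]$, $\nabla p$ is the (column) gradient with respect to $x$. For $g=(g_1,\dots,g_m)$: $S(g):=\{x\in\mathbb{R}^n : g_j(x)\ge 0,\ j=1,\dots,m\}$. For $x\in\mathbb{R}^n$, $\varphi^g(x)$ is the real $(n+m)\times m$ matrix whose $j$-th column is $\nabla g_j(x)$ followed by $g_j(x)e_j$, with $e_j$ the $j$-th standard basis vector of $\mathbb{R}^m$ (the Jacobian $[\nabla g_1(x)\ \cdots\ \nabla g_m(x)]$ stacked on top of $\mathrm{diag}(g_1(x),\dots,g_m(x))$). The set of critical points is $C(g):=\{x\in\mathbb{R}^n : \mathrm{rank}(\varphi^g(x))<m\}$. For a vector of variables $z$ ($z=x$ or $z=(x,\bar\lambda)$), $\Sigma^2[z]$ is the cone of sums of squares of polynomials in $\mathbb{R}[z]$, $Q(g)[z]:=\Sigma^2[z]+\sum_{j=1}^m g_j\Sigma^2[z]$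 is the quadratic module and $P(g)[z]:=\sum_{\alpha\in\{0,1\}^m}g^\alpha\Sigma^2[z]$, with $g^\alpha:=g_1^{\alpha_1}\cdots g_m^{\alpha_m}$, is the preordering. $S(g)$ satisfies the Archimedean condition if there is $R>0$ with $R-x_1^2-\dots-x_n^2\in Q(g)[x]$. For a tuple $h$ of polynomials, $V(h)$ is the set of its common real zeros. The tuple $h_{\mathrm{FJ}}$ of $n+m+1$ polynomials in $\mathbb{R}[x,\bar\lambda]$ is $$h_{\mathrm{FJ}}:=\Big(\lambda_0\nabla f-\sum_{j=1}^m\lambda_j\nabla g_j,\ \lambda_1g_1,\dots,\lambda_mg_m,\ 1-\sum_{j=0}^m\lambda_j^2\Big),$$ so $V(h_{\mathrm{FJ}})\subset\mathbb{R}^{n+m+1}$. *)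

theory Defs
  imports "HOL-Analysis.Analysis" "HOL-Library.Poly_Mapping"
begin

text \<open>
  Real polynomials in variables indexed by a finite type \<open>'v\<close>, as the monoid
  algebra over the exponent vectors; ring operations are those of
  \<^theory>\<open>HOL-Library.Poly_Mapping\<close>.
\<close>

type_synonym 'v rpoly = "('v \<Rightarrow>\<^sub>0 nat) \<Rightarrow>\<^sub>0 real"

definition const_poly :: "real \<Rightarrow> 'v rpoly" where
  "const_poly c = Poly_Mapping.single 0 c"

definition var_poly :: "'v \<Rightarrow> 'v rpoly" where
  "var_poly i = Poly_Mapping.single (Poly_Mapping.single i 1) 1"

definition eval_poly :: "'v::finite rpoly \<Rightarrow> real ^ 'v \<Rightarrow> real" where
  "eval_poly p x =
     (\<Sum>t\<in>Poly_Mapping.keys p. Poly_Mapping.lookup p t *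
        (\<Prod>i\<in>UNIV. (x $ i) ^ Poly_Mapping.lookup t i))"

text \<open>
  Formal partial derivative. If variable \<open>i\<close> does not occur in a monomial, the
  truncated exponent is harmless because the coefficient is zero.
\<close>

definition partial_deriv :: "'v \<Rightarrow> 'v rpoly \<Rightarrow> 'v rpoly" where
  "partial_deriv i p =
     (\<Sum>t\<in>Poly_Mapping.keys p.
        Poly_Mapping.single (t - Poly_Mapping.single i 1)
          (of_nat (Poly_Mapping.lookup t i) * Poly_Mapping.lookup p t))"

text \<open>
  The variables \<open>(x, \<lambda>\<^sub>0, \<dots>, \<lambda>\<^sub>m)\<close> are indexed by \<open>'n + 'm option\<close>: \<open>Inl i\<close> stands for
  \<open>x\<^sub>i\<close>, \<open>Inr None\<close> for \<open>\<lambda>\<^sub>0\<close> and \<open>Inr (Some j)\<close> for \<open>\<lambda>\<^sub>j\<close>. The function \<open>lift_poly\<close> is the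
  inclusion of the polynomials in \<open>x\<close> into those in \<open>(x, \<lambda>)\<close>.
\<close>

definition lift_exp :: "('n \<Rightarrow>\<^sub>0 nat) \<Rightarrow> ('n + 'm option) \<Rightarrow>\<^sub>0 nat" where
  "lift_exp t =
     (\<Sum>i\<in>Poly_Mapping.keys t. Poly_Mapping.single (Inl i) (Poly_Mapping.lookup t i))"

definition lift_poly :: "'n rpoly \<Rightarrow> ('n + 'm option) rpoly" where
  "lift_poly p =
     (\<Sum>t\<in>Poly_Mapping.keys p. Poly_Mapping.single (lift_exp t) (Poly_Mapping.lookup p t))"

definition lam :: "'m option \<Rightarrow> ('n + 'm option) rpoly" where
  "lam k = var_poly (Inr k)"

definition sos :: "'v rpoly set" where
  "sos = {s. \<exists>ps :: 'v rpoly list. s = (\<Sum>p\<leftarrow>ps. p ^ 2)}"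

definition quadratic_module :: "('m::finite \<Rightarrow> 'v rpoly) \<Rightarrow> 'v rpoly set" where
  "quadratic_module g =
     {s0 + (\<Sum>j\<in>UNIV. g j * s j) | s0 s. s0 \<in> sos \<and> (\<forall>j. s j \<in> sos)}"

text \<open>An exponent \<open>\<alpha> \<in> {0,1}\<^sup>m\<close> is encoded by the set \<open>A\<close> of the indices where it is 1.\<close>

definition preordering_cone :: "('m::finite \<Rightarrow> 'v rpoly) \<Rightarrow> 'v rpoly set" where
  "preordering_cone g =
     {(\<Sum>A\<in>UNIV. (\<Prod>j\<in>A. g j) * s A) | s :: 'm set \<Rightarrow> 'v rpoly. \<forall>A. s A \<in> sos}"

definition archimedean_cond :: "('m::finite \<Rightarrow> 'n::finite rpoly) \<Rightarrow> bool" where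
  "archimedean_cond g \<longleftrightarrow>
     (\<exists>R>0. const_poly R - (\<Sum>i\<in>UNIV. var_poly i ^ 2) \<in> quadratic_module g)"

definition feasible_set :: "('m::finite \<Rightarrow> 'n::finite rpoly) \<Rightarrow> (real ^ 'n) set" where
  "feasible_set g = {x. \<forall>j. eval_poly (g j) x \<ge> 0}"

text \<open>Rows are indexed by \<open>'n + 'm\<close> (the Jacobian on top of the diagonal block), columns by \<open>'m\<close>.\<close>

definition phi_matrix ::
    "('m::finite \<Rightarrow> 'n::finite rpoly) \<Rightarrow> real ^ 'n \<Rightarrow> real ^ 'm ^ ('n + 'm)" where
  "phi_matrix g x =
     (\<chi> r j. case r of
        Inl i \<Rightarrow> eval_poly (partial_deriv i (g j)) x
      | Inr k \<Rightarrow> (if k = j then eval_poly (g j) x else 0))"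

definition critical_set :: "('m::finite \<Rightarrow> 'n::finite rpoly) \<Rightarrow> (real ^ 'n) set" where
  "critical_set g = {x. rank (phi_matrix g x) < CARD('m)}"

definition real_zeros :: "('k \<Rightarrow> 'v::finite rpoly) \<Rightarrow> (real ^ 'v) set" where
  "real_zeros h = {z. \<forall>k. eval_poly (h k) z = 0}"

fun h_FJ :: "'n rpoly \<Rightarrow> ('m::finite \<Rightarrow> 'n rpoly) \<Rightarrow> 'n + 'm + unit \<Rightarrow> ('n + 'm option) rpoly"
where
  "h_FJ f g (Inl i) =
     lam None * lift_poly (partial_deriv i f)
     - (\<Sum>j\<in>UNIV. lam (Some j) * lift_poly (partial_deriv i (g j)))"
| "h_FJ f g (Inr (Inl j)) = lam (Some j) * lift_poly (g j)"
| "h_FJ f g (Inr (Inr u)) = 1 - (\<Sum>k\<in>UNIV. lam k ^ 2)"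

end

theory Submission
  imports Defs "HOL-Computational_Algebra.Computational_Algebra" "HOL-Algebra.Algebraic_Closure_Type"
begin

text \<open>
  The polynomial \<open>f\<close> takes only finitely many values on \<open>V(h\<^sub>F\<^sub>J)\<close>. Where \<open>\<lambda>\<^sub>0 = 0\<close> the point \<open>x\<close> is
  critical. Otherwise suppose that \<open>f\<close> were transcendental over the reals at a prime cone of the
  coordinate ring on which \<open>\<lambda>\<^sub>0\<close> does not vanish. In the residue field some derivation \<open>D\<close> over the
  reals has \<open>D f \<noteq> 0\<close>. Whenever \<open>\<lambda>\<^sub>j \<noteq> 0\<close> we have \<open>g\<^sub>j = 0\<close>, hence \<open>D g\<^sub>j = 0\<close>, and the first block of
  \<open>h\<^sub>F\<^sub>J\<close> gives \<open>\<lambda>\<^sub>0 D f = \<Sum>\<^sub>j \<lambda>\<^sub>j D g\<^sub>j = 0\<close>, a contradiction.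

  For a single value \<open>t\<close> of \<open>f\<close> a certificate is the constant \<open>t\<close> if \<open>t \<ge> 0\<close>. If \<open>t < 0\<close>, no point of
  \<open>V(h\<^sub>F\<^sub>J)\<close> with this value lies over \<open>S(g)\<close>, so \<open>- 1\<close> agrees with an element \<open>p\<close> of the cone on the
  level set, and \<open>t = ((t + 1) / 2)\<^sup>2 - ((t - 1) / 2)\<^sup>2\<close> yields a certificate. For the preordering this
  is a Positivstellensatz: otherwise some prime cone contains the preordering, and its sign conditions
  are met in the real closure of the ordered residue field, hence, by elimination of quantifiers, at a
  real point. For an Archimedean quadratic module a maximal module not containing \<open>- 1\<close> gives the real
  point directly. The constraint \<open>\<Sum>\<^sub>j \<lambda>\<^sub>j\<^sup>2 = 1\<close> carries the Archimedean property from \<open>x\<close> to \<open>(x, \<lambda>)\<close>.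
\<close>

text \<open>Derivations live on residue fields of cones, while finiteness concerns real points. The
  bridge is an avoidance argument: a prime cone can be kept away from all
  \<open>- (p(f) \<lambda>\<^sub>0^k)^2\<close> with \<open>p\<close> nonzero, unless one such
  \<open>p(f) \<lambda>\<^sub>0^k\<close> vanishes at every real zero, and then \<open>f\<close>
  takes only roots of \<open>p\<close> as values where \<open>\<lambda>\<^sub>0\<close> is nonzero.
  A residue field carries an order but no useful completeness, so Rolle's theorem and its
  consequences are rebuilt from the intermediate value property of polynomials. Elimination is not
  carried out on formulas: signs in the real closure and in the reals are compared by a
  back-and-forth over finite tables of matching roots, one variable at a time. The conditions in the
  remaining variables arise only during the process; a filter generated by all sign conditions of
  the cone accommodates them. Certificates matter only as functions on a level set, so a cone is
  first enlarged by the full vanishing ideal of that set. This avoids the question whether the ideal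
  generated by the Fritz John polynomials is real.\<close>

hide_const (open) Polynomials.degree Poly_Mapping.degree Polynomials.lead_coeff UnivPoly.up_ring.coeff UnivPoly.up_ring.monom Coset.order Module.module.smult
  Polynomials.ring.coeff Polynomials.ring.monom Polynomials.INTEG.R.coeff Polynomials.INTEG.R.monom Polynomials.INTEG.P.coeff Polynomials.INTEG.P.monom

no_notation fps_nth (infixl \<open>$\<close> 75)

section \<open>Real closed fields\<close>

text \<open>The polynomial is spelled out as a sum because the type of polynomials over
  the class parameter is not available inside a class specification.\<close>

class real_closed_field = linordered_field +
  assumes ivt: "x < y \<Longrightarrow> (\<Sum>k\<le>n. f k * x ^ k) < 0 \<Longrightarrow> 0 < (\<Sum>k\<le>n. f k * y ^ k)
     \<Longrightarrow> \<exists>z. x < z \<and> z < y \<and> (\<Sum>k\<le>n. f k * z ^ k) = 0"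

instance real :: real_closed_field
proof
  fix x y :: real and f :: "nat \<Rightarrow> real" and n
  assume a: "x < y" "(\<Sum>k\<le>n. f k * x ^ k) < 0" "0 < (\<Sum>k\<le>n. f k * y ^ k)"
  have "\<exists>z\<ge>x. z \<le> y \<and> (\<Sum>k\<le>n. f k * z ^ k) = 0"
    using a by (intro IVT') (auto intro!: continuous_intros)
  then show "\<exists>z. x < z \<and> z < y \<and> (\<Sum>k\<le>n. f k * z ^ k) = 0"
    using a by (metis less_eq_real_def less_irrefl)
qed

lemma poly_ivt_less:
  fixes p :: "'a::real_closed_field poly"
  assumes "a < b" "poly p a < 0" "0 < poly p b"
  shows "\<exists>c. a < c \<and> c < b \<and> poly p c = 0"
  using ivt[of a b "coeff p" "degree p"] assms by (simp add: poly_altdef)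

lemma poly_ivt:
  fixes p :: "'a::real_closed_field poly"
  assumes "a < b" "poly p a * poly p b < 0"
  shows "\<exists>c. a < c \<and> c < b \<and> poly p c = 0"
proof (cases "poly p a < 0")
  case True
  then show ?thesis using assms poly_ivt_less[of a b p] by (simp add: mult_less_0_iff)
next
  case False
  then show ?thesis using assms poly_ivt_less[of a b "-p"] by (simp add: mult_less_0_iff)
qed

lemma poly_rolle:
  fixes p :: "'a::real_closed_field poly"
  assumes "a < b" "poly p a = 0" "poly p b = 0"
  shows "\<exists>c. a < c \<and> c < b \<and> poly (pderiv p) c = 0"
proof (cases "p = 0")
  case True
  then show ?thesis using dense[OF assms(1)] by auto
next
  case False
  define B where "B = {x. poly p x = 0 \<and> a < x}"
  have fB: "finite B" unfolding B_def using poly_roots_finite[OF False] by (auto intro: rev_finite_subset)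
  have "b \<in> B" using assms by (simp add: B_def)
  define d where "d = Min B"
  have dB: "d \<in> B" using fB \<open>b \<in> B\<close> unfolding d_def by (intro Min_in) auto
  have dmin: "x \<in> B \<Longrightarrow> d \<le> x" for x unfolding d_def using fB by simp
  have d: "a < d" "poly p d = 0" "d \<le> b" using dB dmin[OF \<open>b \<in> B\<close>] by (auto simp: B_def)
  obtain q1 where q1: "p = [:-a,1:] ^ order a p * q1" and q1': "\<not> [:-a,1:] dvd q1"
    using order_decomp[OF False, of a] by (elim exE conjE)
  have q1a: "poly q1 a \<noteq> 0" using q1' by (simp add: poly_eq_0_iff_dvd)
  have q10: "q1 \<noteq> 0" using q1a by auto
  obtain i where i: "order a p = Suc i" using assms(2) False by (metis not0_implies_Suc order_root)
  have p1: "p = [:-a,1:] ^ Suc i * q1" using q1 unfolding i .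
  have q1d: "poly q1 d = 0" using d(1,2) unfolding p1 by simp
  obtain q where q: "q1 = [:-d,1:] ^ order d q1 * q" and q': "\<not> [:-d,1:] dvd q"
    using order_decomp[OF q10, of d] by (elim exE conjE)
  have qd: "poly q d \<noteq> 0" using q' by (simp add: poly_eq_0_iff_dvd)
  obtain j where j: "order d q1 = Suc j" using q1d q10 by (metis not0_implies_Suc order_root)
  have q2: "q1 = [:-d,1:] ^ Suc j * q" using q unfolding j .
  have qa: "poly q a \<noteq> 0" using q1a unfolding q2 by simp
  have p: "p = [:-a,1:] ^ Suc i * ([:-d,1:] ^ Suc j * q)" using p1 q2 by simp
  define r where "r = smult (of_nat (Suc i)) ([:-d,1:] * q) + smult (of_nat (Suc j)) ([:-a,1:] * q) + [:-a,1:] * [:-d,1:] * pderiv q"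
  have pd: "pderiv p = [:-a,1:] ^ i * [:-d,1:] ^ j * r"
    unfolding p r_def pderiv_mult pderiv_power_Suc
    by (simp add: pderiv_pCons algebra_simps smult_add_right flip: one_pCons del: mult_pCons_left mult_pCons_right)
  have noroot: "poly q x \<noteq> 0" if "a < x" "x < d" for x
  proof
    assume "poly q x = 0"
    then have "poly p x = 0" unfolding p by simp
    then have "x \<in> B" using that by (simp add: B_def)
    then show False using dmin that by force
  qed
  have s: "poly q a * poly q d > 0"
    using poly_ivt[OF d(1), of q] noroot qa qd by (metis linorder_neqE_linordered_idom mult_eq_0_iff)
  have "poly r a * poly r d = - (of_nat (Suc i) * of_nat (Suc j) * (d - a)^2 * (poly q a * poly q d))"
    unfolding r_def by (simp add: algebra_simps power2_eq_square)
  also have "\<dots> < 0" using s d(1) by (simp add: mult_pos_pos del: of_nat_Suc)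
  finally obtain c where "a < c" "c < d" "poly r c = 0" using poly_ivt[OF d(1)] by blast
  then show ?thesis using pd d(3) by (intro exI[of _ c]) auto
qed

lemma poly_mean_value:
  fixes p :: "'a::real_closed_field poly"
  assumes "a < b"
  shows "\<exists>c. a < c \<and> c < b \<and> poly p b - poly p a = (b - a) * poly (pderiv p) c"
proof -
  define q where "q = smult (b - a) (p - [:poly p a:]) - smult (poly p b - poly p a) [:-a,1:]"
  have "poly q a = 0" "poly q b = 0" by (auto simp: q_def algebra_simps)
  then obtain c where "a < c" "c < b" "poly (pderiv q) c = 0" using poly_rolle[OF assms] by blast
  then show ?thesis by (intro exI[of _ c]) (auto simp: q_def pderiv_diff pderiv_smult pderiv_pCons)
qed

lemma poly_strict_mono_on_interval:
  fixes p :: "'a::real_closed_field poly"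
  assumes "a < b" "\<And>x. a < x \<Longrightarrow> x < b \<Longrightarrow> poly (pderiv p) x > 0"
  shows "poly p a < poly p b"
  using poly_mean_value[OF assms(1), of p] assms by (metis diff_gt_0_iff_gt mult_pos_pos)

text \<open>Replaces a limit at infinity. A positive lower bound \<open>l\<close> for the tail,
  multiplied by a large \<open>x\<close>, outweighs the constant coefficient; the threshold
  \<open>1 + \<bar>a\<bar> / l\<close> leaves \<open>l\<close> after \<open>\<bar>a\<bar>\<close> is
  absorbed.\<close>

lemma poly_eventually_pos:
  fixes p :: "'a::linordered_field poly"
  assumes "lead_coeff p > 0"
  shows "\<exists>N. \<forall>x\<ge>N. poly p x \<ge> lead_coeff p"
  using assms
proof (induction p)
  case 0
  then show ?case by simp
next
  case (pCons a p)
  show ?case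
  proof (cases "p = 0")
    case True
    then show ?thesis by simp
  next
    case False
    define l where "l = lead_coeff p"
    have l: "l > 0" using pCons.prems False by (simp add: l_def)
    then obtain N where N: "\<forall>x\<ge>N. poly p x \<ge> l" using pCons.IH l_def by auto
    show ?thesis
    proof (intro exI[of _ "max N (1 + \<bar>a\<bar> / l)"] allI impI)
      fix x assume x: "max N (1 + \<bar>a\<bar> / l) \<le> x"
      have "0 \<le> \<bar>a\<bar> / l" using l by simp
      then have x0: "0 \<le> x" using x by (simp add: max_def split: if_splits)
      have "(1 + \<bar>a\<bar> / l) * l \<le> x * l" using x l by (intro mult_right_mono) auto
      also have "\<dots> \<le> x * poly p x" using N x x0 by (intro mult_left_mono) auto
      finally have "l + \<bar>a\<bar> \<le> x * poly p x" using l by (simp add: algebra_simps)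
      then show "lead_coeff (pCons a p) \<le> poly (pCons a p) x"
        using False by (simp add: l_def abs_if split: if_splits)
    qed
  qed
qed

text \<open>Serves the unbounded cells, which have no marked endpoint at which a sign could be read
  off. A derivative that is positive on a ray forces a positive leading coefficient of
  \<open>p\<close>.\<close>

lemma poly_pos_of_pderiv_pos_right:
  fixes p :: "'a::linordered_field poly"
  assumes "\<And>y. x \<le> y \<Longrightarrow> poly (pderiv p) y > 0"
  shows "\<exists>y>x. poly p y > 0"
proof -
  have d: "pderiv p \<noteq> 0" using assms[of x] by auto
  then have deg: "degree p > 0" by (metis gr0I pderiv_eq_0_iff)
  have lc: "lead_coeff (pderiv p) = of_nat (degree p) * lead_coeff p"
    using deg by (simp add: degree_pderiv coeff_pderiv)
  have "lead_coeff p > 0"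
  proof (rule ccontr)
    assume "\<not> lead_coeff p > 0"
    then have "lead_coeff p < 0" using deg
      by (metis degree_0 leading_coeff_0_iff less_irrefl linorder_neqE_linordered_idom)
    then have "lead_coeff (- pderiv p) > 0" using lc deg by (simp add: mult_pos_neg)
    from poly_eventually_pos[OF this] obtain N where "\<forall>y\<ge>N. poly (- pderiv p) y \<ge> lead_coeff (- pderiv p)" by blast
    then have "poly (- pderiv p) (max N x) > 0" using \<open>lead_coeff (- pderiv p) > 0\<close>
      by (metis less_le_trans max.cobounded1)
    then show False using assms[of "max N x"] by simp
  qed
  moreover from poly_eventually_pos[OF this] obtain N where "\<forall>y\<ge>N. poly p y \<ge> lead_coeff p" by blast
  ultimately have "poly p (max N (x+1)) > 0" by (metis less_le_trans max.cobounded1)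
  moreover have "max N (x+1) > x" by (simp add: less_max_iff_disj)
  ultimately show ?thesis by blast
qed

lemma poly_neg_of_pderiv_pos_left:
  fixes p :: "'a::linordered_field poly"
  assumes "\<And>y. y \<le> x \<Longrightarrow> poly (pderiv p) y > 0"
  shows "\<exists>y<x. poly p y < 0"
proof -
  define q where "q = - pcompose p [:0,-1:]"
  have "poly (pderiv q) y > 0" if "- x \<le> y" for y
    using assms[of "-y"] that by (simp add: q_def pderiv_minus pderiv_pcompose poly_pcompose pderiv_pCons)
  from poly_pos_of_pderiv_pos_right[OF this] obtain y where "y > -x" "poly q y > 0" by blast
  then show ?thesis by (intro exI[of _ "-y"]) (auto simp: q_def poly_pcompose)
qed

section \<open>Sign diagrams\<close>

text \<open>Integer values make signs in two different fields comparable.\<close>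

definition sg :: "'a::linordered_idom \<Rightarrow> int" where
  "sg x = (if 0 < x then 1 else if x < 0 then -1 else 0)"

lemma sg_simps [simp]:
  "sg 0 = 0" "sg x = 0 \<longleftrightarrow> x = 0" "0 = sg x \<longleftrightarrow> x = 0" "sg x = 1 \<longleftrightarrow> 0 < x" "sg x = -1 \<longleftrightarrow> x < 0"
  "sg (- x) = - sg x" "sg 1 = 1"
  by (auto simp: sg_def)

lemma sg_mult: "sg (x * y) = sg x * sg y"
  by (auto simp: sg_def zero_less_mult_iff mult_less_0_iff)

lemma sg_diff_swap: "sg (x - y) = - sg (y - x)"
  by (auto simp: sg_def)

lemma sg_eqD:
  assumes "sg x = sg y"
  shows "0 < x \<longleftrightarrow> 0 < y" "x < 0 \<longleftrightarrow> y < 0" "x = 0 \<longleftrightarrow> y = 0"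
  using assms by (auto simp: sg_def split: if_splits)

text \<open>
  A finite set of pairs encodes a finite partial isomorphism between two ordered
  fields. Two points are similar if they lie in corresponding cells of the two
  decompositions of the line.
\<close>

definition sim :: "('a::linordered_idom \<times> 'b::linordered_idom) set \<Rightarrow> 'a \<Rightarrow> 'b \<Rightarrow> bool" where
  "sim M x y \<longleftrightarrow> (\<forall>a b. (a, b) \<in> M \<longrightarrow> sg (x - a) = sg (y - b))"

definition partial_iso :: "('a::linordered_idom \<times> 'b::linordered_idom) set \<Rightarrow> bool" where
  "partial_iso M \<longleftrightarrow> finite M \<and> (\<forall>a b. (a, b) \<in> M \<longrightarrow> sim M a b)"

text \<open>For a partial isomorphism every cell has a nonempty counterpart, so agreement at all
  similar pairs also makes the signs constant on each cell.\<close>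

definition sign_diagram ::
    "('a::linordered_idom \<times> 'b::linordered_idom) set \<Rightarrow> ('a poly \<times> 'b poly) set \<Rightarrow> bool" where
  "sign_diagram M \<P> \<longleftrightarrow>
     (\<forall>x y p q. sim M x y \<longrightarrow> (p, q) \<in> \<P> \<longrightarrow> sg (poly p x) = sg (poly q y))"

lemma sim_converse [simp]: "sim (M\<inverse>) y x \<longleftrightarrow> sim M x y"
  unfolding sim_def by (metis converse_iff)

lemma partial_iso_converse [simp]: "partial_iso (M\<inverse>) \<longleftrightarrow> partial_iso M"
  unfolding partial_iso_def by (auto simp del: sim_converse simp: sim_converse[symmetric, of M])

lemma sign_diagram_converse [simp]: "sign_diagram (M\<inverse>) (\<P>\<inverse>) \<longleftrightarrow> sign_diagram M \<P>"
  unfolding sign_diagram_def by (metis converse_iff sim_converse)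

lemma simD: "sim M x y \<Longrightarrow> (a, b) \<in> M \<Longrightarrow> sg (x - a) = sg (y - b)"
  unfolding sim_def by auto

lemma sim_less: "sim M x y \<Longrightarrow> (a, b) \<in> M \<Longrightarrow> a < x \<longleftrightarrow> b < y"
  using sg_eqD(1)[of "x - a" "y - b"] simD[of M x y a b] by simp

lemma sim_greater: "sim M x y \<Longrightarrow> (a, b) \<in> M \<Longrightarrow> x < a \<longleftrightarrow> y < b"
  using sg_eqD(2)[of "x - a" "y - b"] simD[of M x y a b] by simp

lemma sim_eq: "sim M x y \<Longrightarrow> (a, b) \<in> M \<Longrightarrow> x = a \<longleftrightarrow> y = b"
  using sg_eqD(3)[of "x - a" "y - b"] simD[of M x y a b] by simp

lemma simI:
  assumes "\<And>a b. (a, b) \<in> M \<Longrightarrow> (a < x \<longleftrightarrow> b < y) \<and> (x < a \<longleftrightarrow> y < b)"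
  shows "sim M x y"
  unfolding sim_def
proof (intro allI impI)
  fix a b assume "(a, b) \<in> M"
  from assms[OF this] show "sg (x - a) = sg (y - b)" by (auto simp: sg_def)
qed

lemma partial_iso_sim: "partial_iso M \<Longrightarrow> (a, b) \<in> M \<Longrightarrow> sim M a b"
  unfolding partial_iso_def by auto

lemma partial_iso_less:
  "partial_iso M \<Longrightarrow> (a, b) \<in> M \<Longrightarrow> (c, d) \<in> M \<Longrightarrow> a < c \<longleftrightarrow> b < d"
  using partial_iso_sim sim_less by blast

lemma sign_diagramD:
  "sign_diagram M \<P> \<Longrightarrow> sim M x y \<Longrightarrow> (p, q) \<in> \<P> \<Longrightarrow> sg (poly p x) = sg (poly q y)"
  unfolding sign_diagram_def by blast

lemma finite_separate:
  fixes A B :: "'a::linordered_field set"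
  assumes "finite A" "finite B" "\<And>a b. a \<in> A \<Longrightarrow> b \<in> B \<Longrightarrow> a < b"
  shows "\<exists>y. (\<forall>a\<in>A. a < y) \<and> (\<forall>b\<in>B. y < b)"
proof (cases "A = {} \<or> B = {}")
  case True
  have "\<exists>y. \<forall>a\<in>A. a < y"
  proof (cases "A = {}")
    case False
    have "a < Max A + 1" if "a \<in> A" for a
      using le_less_trans[OF Max_ge[OF assms(1) that] less_add_one] .
    then show ?thesis by blast
  qed simp
  moreover have "\<exists>y. \<forall>b\<in>B. y < b"
  proof (cases "B = {}")
    case False
    have "Min B - 1 < b" if "b \<in> B" for b
      using less_le_trans[OF _ Min_le[OF assms(2) that], of "Min B - 1"] by simp
    then show ?thesis by blast
  qed simp
  ultimately show ?thesis using True by auto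
next
  case False
  then have "Max A < Min B" using assms by (simp add: Max_in Min_in)
  then obtain y where y: "Max A < y" "y < Min B" using dense by blast
  have "a < y" if "a \<in> A" for a using le_less_trans[OF Max_ge[OF assms(1) that] y(1)] .
  moreover have "y < b" if "b \<in> B" for b using less_le_trans[OF y(2) Min_le[OF assms(2) that]] .
  ultimately show ?thesis by blast
qed

text \<open>The order part of the back-and-forth: an ordered field is dense and has no endpoints, so
  the cell corresponding to that of \<open>x\<close> is nonempty.\<close>

lemma sim_exists:
  fixes M :: "('a::linordered_field \<times> 'b::linordered_field) set"
  assumes "partial_iso M"
  shows "\<exists>y. sim M x y"
proof (cases "x \<in> fst ` M")
  case True
  then obtain b where "(x, b) \<in> M" by auto
  then show ?thesis using partial_iso_sim[OF assms] by blast
next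
  case False
  have fin: "finite M" using assms by (simp add: partial_iso_def)
  define A where "A = {b. \<exists>a. (a, b) \<in> M \<and> a < x}"
  define B where "B = {b. \<exists>a. (a, b) \<in> M \<and> x < a}"
  have "A \<subseteq> snd ` M" "B \<subseteq> snd ` M" by (force simp: A_def B_def)+
  then have "finite A" "finite B" using fin finite_surj by blast+
  moreover have "a < b" if ab: "a \<in> A" "b \<in> B" for a b
  proof -
    obtain c d where cd: "(c, a) \<in> M" "c < x" "(d, b) \<in> M" "x < d" using ab unfolding A_def B_def by blast
    then have "c < d" by (blast intro: less_trans)
    then show ?thesis using partial_iso_less[OF assms cd(1,3)] by simp
  qed
  ultimately obtain y where y: "\<forall>a\<in>A. a < y" "\<forall>b\<in>B. y < b" using finite_separate by metis
  have "sim M x y"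
  proof (rule simI)
    fix a b assume ab: "(a, b) \<in> M"
    then have "a \<noteq> x" using False by force
    then show "(a < x \<longleftrightarrow> b < y) \<and> (x < a \<longleftrightarrow> y < b)"
    proof (cases "a < x")
      case True
      then have "b \<in> A" using ab by (auto simp: A_def)
      then have "b < y" using y by blast
      then show ?thesis using True by (simp add: less_not_sym)
    next
      case False
      then have "x < a" using \<open>a \<noteq> x\<close> by simp
      then have "b \<in> B" using ab by (auto simp: B_def)
      then have "y < b" using y by blast
      then show ?thesis using \<open>x < a\<close> by (simp add: less_not_sym)
    qed
  qed
  then show ?thesis ..
qed

lemma cell_infinite:
  fixes A :: "'a::linordered_field set"
  assumes "finite A" "x \<notin> A"
  shows "infinite {y. \<forall>a\<in>A. (a < x \<longleftrightarrow> a < y) \<and> (x < a \<longleftrightarrow> y < a)}"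
proof -
  have "\<exists>u. (\<forall>a\<in>{x}. a < u) \<and> (\<forall>b\<in>{a\<in>A. x < a}. u < b)"
    by (rule finite_separate) (use assms(1) in auto)
  then obtain u where u: "\<forall>a\<in>{a\<in>A. x < a}. u < a" "x < u" by blast
  have "{x<..<u} \<subseteq> {y. \<forall>a\<in>A. (a < x \<longleftrightarrow> a < y) \<and> (x < a \<longleftrightarrow> y < a)}"
  proof safe
    fix y a assume y: "y \<in> {x<..<u}" and a: "a \<in> A"
    have ua: "x < a \<Longrightarrow> u < a" using u(1) a by blast
    have "a \<noteq> x" using a assms(2) by blast
    show "a < x \<Longrightarrow> a < y" using y by auto
    show "a < y \<Longrightarrow> a < x" using y ua \<open>a \<noteq> x\<close> by (cases "x < a") auto
    show "x < a \<Longrightarrow> y < a" using y ua by auto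
    show "y < a \<Longrightarrow> x < a" using y by auto
  qed
  moreover have "infinite {x<..<u}" using u(2) by (rule infinite_Ioo)
  ultimately show ?thesis using infinite_super by blast
qed

text \<open>Signs are constant on open cells, and an open cell is infinite, so a root off the marked
  points would give a nonzero polynomial infinitely many roots.\<close>

lemma root_in_diagram:
  fixes p :: "'a::linordered_field poly" and q :: "'b::linordered_field poly"
  assumes "partial_iso M" "sign_diagram M \<P>" "(p, q) \<in> \<P>" "p \<noteq> 0" "poly p x = 0"
  shows "x \<in> fst ` M"
proof (rule ccontr)
  assume x: "x \<notin> fst ` M"
  have fin: "finite (fst ` M)" using assms(1) by (simp add: partial_iso_def)
  obtain y where y: "sim M x y" using sim_exists[OF assms(1)] by blast
  have "poly p z = 0" if z: "\<forall>a\<in>fst ` M. (a < x \<longleftrightarrow> a < z) \<and> (x < a \<longleftrightarrow> z < a)" for z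
  proof -
    have "sim M z y"
    proof (rule simI)
      fix a b assume ab: "(a, b) \<in> M"
      then have "a \<in> fst ` M" by force
      then show "(a < z \<longleftrightarrow> b < y) \<and> (z < a \<longleftrightarrow> y < b)"
        using z sim_less[OF y ab] sim_greater[OF y ab] by blast
    qed
    then have "sg (poly p z) = sg (poly p x)"
      using sign_diagramD[OF assms(2) _ assms(3)] y by metis
    then show ?thesis using assms(5) by simp
  qed
  then have "{z. \<forall>a\<in>fst ` M. (a < x \<longleftrightarrow> a < z) \<and> (x < a \<longleftrightarrow> z < a)} \<subseteq> {z. poly p z = 0}" by auto
  then show False using cell_infinite[OF fin x] poly_roots_finite[OF assms(4)] finite_subset by blast
qed

lemma root_in_diagram':
  fixes p :: "'a::linordered_field poly" and q :: "'b::linordered_field poly"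
  assumes "partial_iso M" "sign_diagram M \<P>" "(p, q) \<in> \<P>" "q \<noteq> 0" "poly q y = 0"
  shows "y \<in> snd ` M"
proof -
  have "y \<in> fst ` (M\<inverse>)"
    by (rule root_in_diagram[where \<P> = "\<P>\<inverse>"]) (use assms in auto)
  then show ?thesis by force
qed

lemma poly_sg_const:
  fixes p :: "'a::real_closed_field poly"
  assumes "\<And>c. min x y \<le> c \<Longrightarrow> c \<le> max x y \<Longrightarrow> poly p c \<noteq> 0"
  shows "sg (poly p x) = sg (poly p y)"
proof (rule ccontr)
  assume ne: "sg (poly p x) \<noteq> sg (poly p y)"
  have xy: "poly p x \<noteq> 0" "poly p y \<noteq> 0" using assms by auto
  have "x \<noteq> y" using ne by auto
  moreover have "poly p (min x y) * poly p (max x y) < 0"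
    using ne xy unfolding sg_def min_def max_def by (auto simp: mult_less_0_iff split: if_splits)
  ultimately obtain c where "min x y < c" "c < max x y" "poly p c = 0"
    using poly_ivt[of "min x y" "max x y" p] by (auto simp: min_def max_def split: if_splits)
  then show False using assms[of c] by auto
qed

text \<open>Keeps only the marked points that are roots of some nonzero member of
  \<open>\<Q>\<close>, so that the sign of a further polynomial there can be found by division.
  Cells merge, but no removed point is such a root, so by the intermediate value property no sign
  changes across it.\<close>

lemma sign_diagram_prune:
  fixes \<Q> :: "('a::real_closed_field poly \<times> 'b::real_closed_field poly) set"
  assumes M: "partial_iso M" "sign_diagram M \<Q>"
    and nz: "\<And>p q. (p, q) \<in> \<Q> \<Longrightarrow> p = 0 \<longleftrightarrow> q = 0"
  defines "N \<equiv> {(a, b) \<in> M. \<exists>(p, q)\<in>\<Q>. p \<noteq> 0 \<and> poly p a = 0}"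
  shows "partial_iso N" "sign_diagram N \<Q>"
proof -
  have NM: "N \<subseteq> M" by (auto simp: N_def)
  have simN: "sim M x y \<Longrightarrow> sim N x y" for x y using NM by (auto simp: sim_def)
  show "partial_iso N" using M(1) NM simN unfolding partial_iso_def
    by (meson finite_subset subsetD)
  have rootR: "\<exists>a. (a, y) \<in> N" if pq: "(p, q) \<in> \<Q>" "q \<noteq> 0" "poly q y = 0" for p q y
  proof -
    obtain a where a: "(a, y) \<in> M" using root_in_diagram'[OF M pq] by auto
    have "sg (poly p a) = sg (poly q y)"
      using sign_diagramD[OF M(2) partial_iso_sim[OF M(1) a] pq(1)] .
    then have "poly p a = 0" using pq by simp
    then show ?thesis using a pq nz[OF pq(1)] unfolding N_def by blast
  qed
  show "sign_diagram N \<Q>" unfolding sign_diagram_def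
  proof (intro allI impI)
    fix x y p q assume s: "sim N x y" and pq: "(p, q) \<in> \<Q>"
    show "sg (poly p x) = sg (poly q y)"
    proof (cases "q = 0")
      case True
      then show ?thesis using nz[OF pq] by simp
    next
      case q: False
      show ?thesis
      proof (cases "x \<in> fst ` N")
        case True
        then obtain b where b: "(x, b) \<in> N" by auto
        then have "y = b" using sim_eq[OF s b] by simp
        then show ?thesis using b NM sign_diagramD[OF M(2) partial_iso_sim[OF M(1)] pq] by blast
      next
        case False
        obtain z where z: "sim M x z" using sim_exists[OF M(1)] by blast
        have "poly q c \<noteq> 0" if c: "min y z \<le> c" "c \<le> max y z" for c
        proof
          assume "poly q c = 0"
          then obtain a where a: "(a, c) \<in> N" using rootR[OF pq q] by blast
          have "a \<noteq> x" using False a by force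
          then show False
            using sim_less[OF s a] sim_less[OF simN[OF z] a] sim_greater[OF s a] sim_greater[OF simN[OF z] a] c
            by (auto simp: min_def max_def split: if_splits)
        qed
        then have "sg (poly q y) = sg (poly q z)" by (rule poly_sg_const)
        then show ?thesis using sign_diagramD[OF M(2) z pq] by simp
      qed
    qed
  qed
qed

section \<open>Transfer of a root from one field to the other inside a cell\<close>

lemma left_neighbour_cases:
  fixes M :: "('a::linordered_idom \<times> 'b::linordered_idom) set"
  assumes "partial_iso M"
  obtains "\<forall>a b. (a, b) \<in> M \<longrightarrow> \<not> a < x"
  | a b where "(a, b) \<in> M" "a < x" "\<forall>c d. (c, d) \<in> M \<longrightarrow> c < x \<longrightarrow> c \<le> a"
proof (cases "{a \<in> fst ` M. a < x} = {}")
  case True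
  then show ?thesis using that(1) by (metis (mono_tags, lifting) Collect_empty_eq fst_conv imageI)
next
  case False
  define a where "a = Max {a \<in> fst ` M. a < x}"
  have fin: "finite {a \<in> fst ` M. a < x}" using assms by (simp add: partial_iso_def)
  have "a \<in> {a \<in> fst ` M. a < x}" unfolding a_def by (rule Max_in[OF fin False])
  then obtain b where "(a, b) \<in> M" "a < x" by auto
  moreover have "c \<le> a" if cd: "(c, d) \<in> M" "c < x" for c d
    unfolding a_def by (rule Max_ge[OF fin]) (use cd in force)
  ultimately show ?thesis using that(2) by blast
qed

lemma sim_left_cell:
  assumes M: "partial_iso M" and s: "sim M x y" and x: "x \<notin> fst ` M"
    and ab: "(a, b) \<in> M" "a < x" "\<forall>c d. (c, d) \<in> M \<longrightarrow> c < x \<longrightarrow> c \<le> a"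
  shows "a < z \<Longrightarrow> z \<le> x \<Longrightarrow> sim M z y" "b < w \<Longrightarrow> w \<le> y \<Longrightarrow> sim M x w"
proof -
  have *: "(c \<le> a \<and> d \<le> b \<and> c < x \<and> d < y) \<or> (x < c \<and> y < d)" if cd: "(c, d) \<in> M" for c d
  proof (cases "c < x")
    case True
    then have "c \<le> a" using ab(3) cd by blast
    then have "\<not> b < d" using partial_iso_less[OF M ab(1) cd] by simp
    then show ?thesis using \<open>c \<le> a\<close> True sim_less[OF s cd] by simp
  next
    case False
    have "c \<noteq> x" using x cd by force
    then show ?thesis using False sim_greater[OF s cd] by simp
  qed
  show "a < z \<Longrightarrow> z \<le> x \<Longrightarrow> sim M z y"
    by (rule simI) (use * in \<open>metis le_less_trans less_le_trans less_not_sym\<close>)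
  show "b < w \<Longrightarrow> w \<le> y \<Longrightarrow> sim M x w"
    by (rule simI) (use * in \<open>metis le_less_trans less_le_trans less_not_sym\<close>)
qed

lemma sim_left_unbounded:
  assumes s: "sim M x y" and x: "x \<notin> fst ` M" and "\<forall>a b. (a, b) \<in> M \<longrightarrow> \<not> a < x"
  shows "z \<le> x \<Longrightarrow> sim M z y" "w \<le> y \<Longrightarrow> sim M x w"
proof -
  have *: "x < c \<and> y < d" if cd: "(c, d) \<in> M" for c d
  proof -
    have "c \<noteq> x" using x cd by force
    then have "x < c" using assms(3) cd by auto
    then show ?thesis using sim_greater[OF s cd] by simp
  qed
  show "z \<le> x \<Longrightarrow> sim M z y"
    by (rule simI) (use * in \<open>metis le_less_trans less_not_sym\<close>)
  show "w \<le> y \<Longrightarrow> sim M x w"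
    by (rule simI) (use * in \<open>metis le_less_trans less_not_sym\<close>)
qed

lemma sign_diagram_pos_iff:
  assumes "sign_diagram M {(p, q)}" "sim M x y" "sim M z y"
  shows "poly p x > 0 \<longleftrightarrow> poly p z > 0"
  using assms sg_eqD(1) sign_diagramD by (metis singletonI)

text \<open>One half of a sign change of \<open>q\<close> in the cell matching that of
  \<open>x\<close>. A marked left end transfers the negative sign through \<open>agree\<close>; if
  there is none, a positive derivative on the whole ray makes \<open>q\<close> negative far to the
  left. The points between \<open>l\<close> and \<open>y\<close> stay in the cell, so a root found
  there lies in the right cell.\<close>

lemma left_neg_transfer:
  fixes p :: "'a::real_closed_field poly" and q :: "'b::real_closed_field poly"
  assumes M: "partial_iso M" and d: "sign_diagram M {(pderiv p, pderiv q)}"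
    and agree: "\<And>a b. (a, b) \<in> M \<Longrightarrow> sg (poly p a) = sg (poly q b)"
    and x: "x \<notin> fst ` M" "poly (pderiv p) x > 0" and s: "sim M x y"
    and neg: "\<And>a b. (a, b) \<in> M \<Longrightarrow> a < x \<Longrightarrow> (\<And>z. a < z \<Longrightarrow> z \<le> x \<Longrightarrow> sim M z y) \<Longrightarrow> poly p a < 0"
  shows "\<exists>l<y. poly q l < 0 \<and> (\<forall>w. l < w \<and> w \<le> y \<longrightarrow> sim M x w)"
proof (cases rule: left_neighbour_cases[OF M, of x])
  case 1
  note cell = sim_left_unbounded[OF s x(1) 1]
  have "poly (pderiv q) w > 0" if "w \<le> y" for w
    using sg_eqD(1)[OF sign_diagramD[OF d cell(2)[OF that] singletonI]] x(2) by simp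
  then have "\<exists>l<y. poly q l < 0" by (rule poly_neg_of_pderiv_pos_left)
  then show ?thesis using cell(2) by blast
next
  case (2 a b)
  note cell = sim_left_cell[OF M s x(1) 2]
  have "poly p a < 0" using neg[OF 2(1,2)] cell(1) by blast
  then have "poly q b < 0" using sg_eqD(2)[OF agree[OF 2(1)]] by simp
  moreover have "b < y" using sim_less[OF s 2(1)] 2(2) by simp
  ultimately show ?thesis using cell(2) by blast
qed

text \<open>The reflection \<open>x \<mapsto> - x\<close> exchanges the two ends of a cell.\<close>

lemma right_pos_transfer:
  fixes p :: "'a::real_closed_field poly" and q :: "'b::real_closed_field poly"
  assumes M: "partial_iso M" and d: "sign_diagram M {(pderiv p, pderiv q)}"
    and agree: "\<And>a b. (a, b) \<in> M \<Longrightarrow> sg (poly p a) = sg (poly q b)"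
    and x: "x \<notin> fst ` M" "poly (pderiv p) x > 0" and s: "sim M x y"
    and pos: "\<And>a b. (a, b) \<in> M \<Longrightarrow> x < a \<Longrightarrow> (\<And>z. x \<le> z \<Longrightarrow> z < a \<Longrightarrow> sim M z y) \<Longrightarrow> poly p a > 0"
  shows "\<exists>u>y. poly q u > 0 \<and> (\<forall>w. y \<le> w \<and> w < u \<longrightarrow> sim M x w)"
proof -
  define N where "N = {(a, b). (- a, - b) \<in> M}"
  define p' where "p' = - pcompose p [:0, -1:]"
  define q' where "q' = - pcompose q [:0, -1:]"
  have simN: "sim N u v \<longleftrightarrow> sim M (- u) (- v)" for u v
  proof
    assume a: "sim N u v"
    show "sim M (- u) (- v)" unfolding sim_def
    proof (intro allI impI)
      fix a b assume "(a, b) \<in> M"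
      then have "(- a, - b) \<in> N" by (simp add: N_def)
      from simD[OF a this] show "sg (- u - a) = sg (- v - b)"
        by (auto simp: sg_def split: if_splits)
    qed
  next
    assume a: "sim M (- u) (- v)"
    show "sim N u v" unfolding sim_def
    proof (intro allI impI)
      fix a b assume "(a, b) \<in> N"
      then have "(- a, - b) \<in> M" by (simp add: N_def)
      from simD[OF a this] show "sg (u - a) = sg (v - b)"
        using sg_simps(6)[of "u - a"] sg_simps(6)[of "v - b"] by simp
    qed
  qed
  have "N = (\<lambda>(a, b). (- a, - b)) ` M"
  proof (rule Set.set_eqI, safe)
    fix a b assume "(a, b) \<in> N"
    then show "(a, b) \<in> (\<lambda>(a, b). (- a, - b)) ` M" by (intro image_eqI[of _ _ "(- a, - b)"]) (auto simp: N_def)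
  qed (auto simp: N_def)
  then have N: "partial_iso N" using M simN unfolding partial_iso_def by (auto simp: N_def)
  have p': "poly p' z = - poly p (- z)" "poly (pderiv p') z = poly (pderiv p) (- z)" for z
    by (auto simp: p'_def poly_pcompose pderiv_minus pderiv_pcompose pderiv_pCons)
  have q': "poly q' z = - poly q (- z)" "poly (pderiv q') z = poly (pderiv q) (- z)" for z
    by (auto simp: q'_def poly_pcompose pderiv_minus pderiv_pcompose pderiv_pCons)
  have "\<exists>l < - y. poly q' l < 0 \<and> (\<forall>w. l < w \<and> w \<le> - y \<longrightarrow> sim N (- x) w)"
  proof (rule left_neg_transfer[OF N, of p' q'])
    show "sign_diagram N {(pderiv p', pderiv q')}"
      unfolding sign_diagram_def simN using sign_diagramD[OF d] by (auto simp: p' q')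
    show "sg (poly p' a) = sg (poly q' b)" if "(a, b) \<in> N" for a b
      using agree[of "- a" "- b"] that by (simp add: p' q' N_def)
    show "- x \<notin> fst ` N" using x(1) by (force simp: N_def)
    show "poly (pderiv p') (- x) > 0" using x(2) by (simp add: p')
    show "sim N (- x) (- y)" using s by (simp add: simN)
    show "poly p' a < 0" if a: "(a, b) \<in> N" "a < - x" "\<And>z. a < z \<Longrightarrow> z \<le> - x \<Longrightarrow> sim N z (- y)" for a b
    proof -
      have "poly p (- a) > 0"
      proof (rule pos)
        show "(- a, - b) \<in> M" "x < - a" using a(1,2) by (auto simp: N_def less_minus_iff)
        show "sim M z y" if "x \<le> z" "z < - a" for z
          using a(3)[of "- z"] that by (simp add: simN less_minus_iff)
      qed
      then show ?thesis by (simp add: p')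
    qed
  qed
  then obtain l where l: "l < - y" "poly q' l < 0" "\<And>w. l < w \<and> w \<le> - y \<Longrightarrow> sim N (- x) w" by blast
  have "sim M x w" if "y \<le> w" "w < - l" for w
    using l(3)[of "- w"] that by (simp add: simN less_minus_iff)
  then show ?thesis using l(1,2) by (intro exI[of _ "- l"]) (auto simp: q' less_minus_iff)
qed

text \<open>In its cell \<open>p\<close> increases through the root \<open>x\<close>, so it is
  negative to the left and positive to the right. Both signs pass to the ends of the matching cell,
  where \<open>q\<close> then changes sign.\<close>

lemma root_transfer_pos:
  fixes p :: "'a::real_closed_field poly" and q :: "'b::real_closed_field poly"
  assumes M: "partial_iso M" and d: "sign_diagram M {(pderiv p, pderiv q)}"
    and agree: "\<And>a b. (a, b) \<in> M \<Longrightarrow> sg (poly p a) = sg (poly q b)"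
    and x: "x \<notin> fst ` M" "poly (pderiv p) x > 0" "poly p x = 0"
  shows "\<exists>y. sim M x y \<and> poly q y = 0"
proof -
  obtain y where s: "sim M x y" using sim_exists[OF M] by blast
  have dp: "sim M z y \<Longrightarrow> poly (pderiv p) z > 0" for z
    using sign_diagram_pos_iff[OF d s] x(2) by blast
  have "\<exists>l<y. poly q l < 0 \<and> (\<forall>w. l < w \<and> w \<le> y \<longrightarrow> sim M x w)"
  proof (rule left_neg_transfer[OF M d agree x(1,2) s])
    fix a b assume "a < x" "\<And>z. a < z \<Longrightarrow> z \<le> x \<Longrightarrow> sim M z y"
    then show "poly p a < 0"
      using poly_strict_mono_on_interval[of a x p] dp x(3) by auto
  qed
  then obtain l where l: "l < y" "poly q l < 0" "\<And>w. l < w \<Longrightarrow> w \<le> y \<Longrightarrow> sim M x w" by blast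
  have "\<exists>u>y. poly q u > 0 \<and> (\<forall>w. y \<le> w \<and> w < u \<longrightarrow> sim M x w)"
  proof (rule right_pos_transfer[OF M d agree x(1,2) s])
    fix a b assume "x < a" "\<And>z. x \<le> z \<Longrightarrow> z < a \<Longrightarrow> sim M z y"
    then show "poly p a > 0"
      using poly_strict_mono_on_interval[of x a p] dp x(3) by auto
  qed
  then obtain u where u: "y < u" "poly q u > 0" "\<And>w. y \<le> w \<Longrightarrow> w < u \<Longrightarrow> sim M x w" by blast
  have "l < u" using l(1) u(1) by simp
  then obtain c where c: "l < c" "c < u" "poly q c = 0" using poly_ivt_less l(2) u(2) by blast
  then have "sim M x c" using l(3) u(3) by (cases "c \<le> y") auto
  then show ?thesis using c by blast
qed

lemma root_transfer:
  fixes p :: "'a::real_closed_field poly" and q :: "'b::real_closed_field poly"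
  assumes M: "partial_iso M" and d: "sign_diagram M {(pderiv p, pderiv q)}"
    and agree: "\<And>a b. (a, b) \<in> M \<Longrightarrow> sg (poly p a) = sg (poly q b)"
    and x: "x \<notin> fst ` M" "poly (pderiv p) x \<noteq> 0" "poly p x = 0"
  shows "\<exists>y. sim M x y \<and> poly q y = 0"
proof (cases "poly (pderiv p) x > 0")
  case True
  then show ?thesis using root_transfer_pos[OF M d agree x(1)] x(3) by blast
next
  case False
  have "\<exists>y. sim M x y \<and> poly (- q) y = 0"
  proof (rule root_transfer_pos[OF M, of "- p" "- q"])
    show "sign_diagram M {(pderiv (- p), pderiv (- q))}"
      using sign_diagramD[OF d] unfolding sign_diagram_def by (simp add: pderiv_minus)
  qed (use False x agree in \<open>auto simp: pderiv_minus\<close>)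
  then show ?thesis by simp
qed

section \<open>Extending a diagram by the roots of one more polynomial\<close>

lemma roots_in_cell_unique:
  fixes p :: "'a::real_closed_field poly" and M :: "('a \<times> 'b::linordered_field) set"
  assumes roots: "\<And>x. poly (pderiv p) x = 0 \<Longrightarrow> x \<in> fst ` M"
    and x: "x \<notin> fst ` M" "z \<notin> fst ` M" "sim M x y" "sim M z y" "poly p x = 0" "poly p z = 0"
  shows "x = z"
proof -
  have False if s: "u < v" "u \<notin> fst ` M" "sim M u y" "sim M v y" "poly p u = 0" "poly p v = 0" for u v
  proof -
    obtain c where c: "u < c" "c < v" "poly (pderiv p) c = 0" using poly_rolle[OF s(1,5,6)] by blast
    then obtain b where b: "(c, b) \<in> M" using roots by force
    show False using sim_less[OF s(3) b] sim_less[OF s(4) b] c by auto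
  qed
  then show ?thesis using x by (metis linorder_neqE_linordered_idom)
qed

lemma sign_diagram_of_roots:
  fixes p :: "'a::real_closed_field poly" and q :: "'b::real_closed_field poly"
  assumes M: "partial_iso M" and d: "sign_diagram M {(pderiv p, pderiv q)}"
    and agree: "\<And>a b. (a, b) \<in> M \<Longrightarrow> sg (poly p a) = sg (poly q b)"
    and roots: "\<And>x. poly p x = 0 \<Longrightarrow> x \<in> fst ` M" "\<And>y. poly q y = 0 \<Longrightarrow> y \<in> snd ` M"
    and droots: "\<And>x. poly (pderiv p) x = 0 \<Longrightarrow> x \<in> fst ` M"
  shows "sign_diagram M {(p, q)}"
proof -
  text \<open>It suffices to refute opposite signs in a cell where both polynomials increase;
    the other cases follow by exchanging the fields or negating the polynomials.\<close>
  have main: False if M: "partial_iso M" and d: "sign_diagram M {(pderiv p, pderiv q)}"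
    and agree: "\<And>a b. (a, b) \<in> M \<Longrightarrow> sg (poly p a) = sg (poly q b)"
    and roots: "\<And>x. poly p x = 0 \<Longrightarrow> x \<in> fst ` M"
    and s: "sim M x y" "x \<notin> fst ` M" "poly (pderiv p) x > 0" "poly p x > 0" "poly q y < 0"
    for M and p :: "'c::real_closed_field poly" and q :: "'d::real_closed_field poly" and x y
  proof (cases rule: left_neighbour_cases[OF M, of x])
    case 1
    note cell = sim_left_unbounded[OF s(1,2) 1]
    have "poly (pderiv p) z > 0" if "z \<le> x" for z
      using sign_diagram_pos_iff[OF d s(1) cell(1)[OF that]] s(3) by blast
    then obtain l where "l < x" "poly p l < 0" using poly_neg_of_pderiv_pos_left by blast
    then obtain c where "c < x" "poly p c = 0" using poly_ivt_less s(4) by blast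
    then show False using roots[of c] 1 by force
  next
    case (2 a b)
    note cell = sim_left_cell[OF M s(1,2) 2]
    have "\<not> poly p a < 0"
    proof
      assume "poly p a < 0"
      then obtain c where c: "a < c" "c < x" "poly p c = 0" using poly_ivt_less[OF 2(2)] s(4) by blast
      then show False using roots[of c] 2(3) by force
    qed
    then have "\<not> poly q b < 0" using sg_eqD(2)[OF agree[OF 2(1)]] by simp
    moreover have "poly q b < poly q y"
    proof (rule poly_strict_mono_on_interval)
      show "b < y" using sim_less[OF s(1) 2(1)] 2(2) by simp
      show "poly (pderiv q) w > 0" if "b < w" "w < y" for w
        using sg_eqD(1)[OF sign_diagramD[OF d cell(2)[of w] singletonI]] that s(3) by simp
    qed
    ultimately show False using s(5) by simp
  qed
  have main2: False if s: "sim M x y" "x \<notin> fst ` M" "poly p x > 0" "poly q y < 0"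
      and M: "partial_iso M" and d: "sign_diagram M {(pderiv p, pderiv q)}"
    and agree: "\<And>a b. (a, b) \<in> M \<Longrightarrow> sg (poly p a) = sg (poly q b)"
    and roots: "\<And>x. poly p x = 0 \<Longrightarrow> x \<in> fst ` M" "\<And>y. poly q y = 0 \<Longrightarrow> y \<in> snd ` M"
    and nz: "poly (pderiv p) x \<noteq> 0"
    for M and p :: "'c::real_closed_field poly" and q :: "'d::real_closed_field poly" and x y
  proof (cases "poly (pderiv p) x > 0")
    case True
    then show False using main[OF M d agree roots(1) s(1,2) _ s(3,4)] by blast
  next
    case False
    have dq: "poly (pderiv q) y < 0"
      using sg_eqD(2)[OF sign_diagramD[OF d s(1) singletonI]] False nz by simp
    show False
    proof (rule main[of "M\<inverse>" "- q" "- p" y x])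
      show "sign_diagram (M\<inverse>) {(pderiv (- q), pderiv (- p))}"
        using sign_diagramD[OF d] unfolding sign_diagram_def by (simp add: pderiv_minus)
      show "y \<notin> fst ` (M\<inverse>)"
      proof
        assume "y \<in> fst ` (M\<inverse>)"
        then obtain a where a: "(a, y) \<in> M" by auto
        then have "x = a" using sim_eq[OF s(1) a] by simp
        then show False using s(2) a by force
      qed
      show "z \<in> fst ` (M\<inverse>)" if "poly (- q) z = 0" for z using roots(2)[of z] that by force
    qed (use M s dq agree in \<open>auto simp: pderiv_minus\<close>)
  qed
  show ?thesis unfolding sign_diagram_def
  proof (intro allI impI)
    fix x y p' q' assume s: "sim M x y" and "(p', q') \<in> {(p, q)}"
    then have [simp]: "p' = p" "q' = q" by auto
    show "sg (poly p' x) = sg (poly q' y)"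
    proof (cases "x \<in> fst ` M")
      case True
      then obtain b where b: "(x, b) \<in> M" by auto
      then have "y = b" using sim_eq[OF s b] by simp
      then show ?thesis using agree b by simp
    next
      case False
      have px: "poly p x \<noteq> 0" using roots False by blast
      have "y \<notin> snd ` M"
      proof
        assume "y \<in> snd ` M"
        then obtain a where a: "(a, y) \<in> M" by auto
        then have "x = a" using sim_eq[OF s a] by simp
        then show False using False a by force
      qed
      then have qy: "poly q y \<noteq> 0" using roots by blast
      have nz: "poly (pderiv p) x \<noteq> 0" using droots False by blast
      have "\<not> (poly p x > 0 \<and> poly q y < 0)"
        using main2[OF s False _ _ M d agree roots nz] by blast
      moreover have "\<not> (poly p x < 0 \<and> poly q y > 0)"
      proof
        assume a: "poly p x < 0 \<and> poly q y > 0"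
        show False
        proof (rule main2[OF s False _ _ M, of "- p" "- q"])
          show "sign_diagram M {(pderiv (- p), pderiv (- q))}"
            using sign_diagramD[OF d] unfolding sign_diagram_def by (simp add: pderiv_minus)
        qed (use a agree roots nz in \<open>auto simp: pderiv_minus\<close>)
      qed
      ultimately show ?thesis using px qy by (auto simp: sg_def)
    qed
  qed
qed

text \<open>\<open>pderiv p\<close> vanishes only at marked points, so by Rolle an open cell
  contains at most one root of \<open>p\<close>, and likewise for \<open>q\<close>. By
  \<open>root_transfer\<close> a cell contains a root of \<open>p\<close> exactly if the matching
  cell contains one of \<open>q\<close>. Hence the new pairs \<open>R\<close> match the remaining
  roots one to one and in order.\<close>

lemma sign_diagram_extend:
  fixes p :: "'a::real_closed_field poly" and q :: "'b::real_closed_field poly"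
  assumes M: "partial_iso M" and d: "sign_diagram M \<Q>" "(pderiv p, pderiv q) \<in> \<Q>"
    and nz: "pderiv p \<noteq> 0" "pderiv q \<noteq> 0"
    and agree: "\<And>a b. (a, b) \<in> M \<Longrightarrow> sg (poly p a) = sg (poly q b)"
  shows "\<exists>N. partial_iso N \<and> sign_diagram N (insert (p, q) \<Q>)"
proof -
  define R where "R = {(x, y). x \<notin> fst ` M \<and> poly p x = 0 \<and> poly q y = 0 \<and> sim M x y}"
  define N where "N = M \<union> R"
  have dd: "sign_diagram M {(pderiv p, pderiv q)}" using d unfolding sign_diagram_def by blast
  have droots: "x \<in> fst ` M" if "poly (pderiv p) x = 0" for x
    using root_in_diagram[OF M dd singletonI nz(1)] that .
  have droots': "y \<in> snd ` M" if "poly (pderiv q) y = 0" for y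
    using root_in_diagram'[OF M dd singletonI nz(2)] that .
  have converse_notin: "x \<notin> fst ` M" if "sim M x y" "y \<notin> snd ` M" for x y
  proof
    assume "x \<in> fst ` M"
    then obtain b where b: "(x, b) \<in> M" by auto
    then have "y = b" using sim_eq[OF that(1) b] by simp
    then show False using b that(2) by force
  qed
  have notin_converse: "y \<notin> snd ` M" if "sim M x y" "x \<notin> fst ` M" for x y
  proof
    assume "y \<in> snd ` M"
    then obtain a where a: "(a, y) \<in> M" by auto
    then have "x = a" using sim_eq[OF that(1) a] by simp
    then show False using a that(2) by force
  qed
  have p0: "p \<noteq> 0" "q \<noteq> 0" using nz by auto
  have uniq: "x = z" if "(x, y) \<in> R" "sim M z y" "z \<notin> fst ` M" "poly p z = 0" for x y z
    using roots_in_cell_unique[where M = M and p = p and x = x and z = z and y = y, OF droots] that unfolding R_def by blast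
  have uniq': "y = w" if y: "(x, y) \<in> R" "sim M x w" "w \<notin> snd ` M" "poly q w = 0" for x y w
  proof (rule roots_in_cell_unique[where M = "M\<inverse>" and y = x and p = q])
    show "y \<in> fst ` (M\<inverse>)" if "poly (pderiv q) y = 0" for y
      using droots'[OF that] by force
    have "fst ` (M\<inverse>) = snd ` M" by force
    moreover have "y \<notin> snd ` M" using notin_converse y(1) unfolding R_def by blast
    ultimately show "y \<notin> fst ` (M\<inverse>)" "w \<notin> fst ` (M\<inverse>)" using y(3) by simp_all
  qed (use y in \<open>auto simp: R_def\<close>)
  have simRM: "sg (a - c) = sg (b - d)" if ab: "(a, b) \<in> R" and cd: "(c, d) \<in> M" for a b c d
    using simD[of M a b c d] ab cd unfolding R_def by blast
  have simRR: "sg (a - c) = sg (b - d)" if ab: "(a, b) \<in> R" and cd: "(c, d) \<in> R" for a b c d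
  proof -
    have less: "b < d" if ab: "(a, b) \<in> R" and cd: "(c, d) \<in> R" and ac: "a < c" for a b c d
    proof -
      \<comment> \<open>Uniqueness keeps \<open>c\<close> out of the cell of \<open>a\<close>, so a
        marked point \<open>e\<close> lies between the two roots, and its partner separates
        \<open>b\<close> from \<open>d\<close>.\<close>
      have "\<not> sim M c b"
      proof
        assume "sim M c b"
        then have "a = c" using uniq[OF ab] cd unfolding R_def by blast
        then show False using ac by simp
      qed
      then obtain e f where ef: "(e, f) \<in> M" "sg (c - e) \<noteq> sg (b - f)" unfolding sim_def by blast
      have s: "sim M a b" "sim M c d" using ab cd unfolding R_def by blast+
      have "e \<in> fst ` M" using ef(1) by force
      then have ne: "a \<noteq> e" "c \<noteq> e" using ab cd unfolding R_def by blast+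
      have "sg (c - e) \<noteq> sg (a - e)" using ef simD[OF s(1) ef(1)] by simp
      then have "a < e" "e < c" using ne ac by (auto simp: sg_def split: if_splits)
      then show ?thesis using sim_greater[OF s(1) ef(1)] sim_less[OF s(2) ef(1)] by simp
    qed
    consider "a < c" | "c < a" | "a = c" by (metis linorder_neqE_linordered_idom)
    then show ?thesis
    proof cases
      case 3
      have "sim M a d" "d \<notin> snd ` M" "poly q d = 0"
        using cd 3 notin_converse unfolding R_def by blast+
      then have "b = d" by (rule uniq'[OF ab])
      then show ?thesis using 3 by simp
    qed (use less[OF ab cd] less[OF cd ab] in \<open>auto simp: sg_def\<close>)
  qed
  have "finite R"
  proof (rule finite_subset)
    show "R \<subseteq> {x. poly p x = 0} \<times> {y. poly q y = 0}" unfolding R_def by blast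
    show "finite ({x. poly p x = 0} \<times> {y. poly q y = 0})"
      by (intro finite_cartesian_product poly_roots_finite p0)
  qed
  moreover have "sim N a b" if ab: "(a, b) \<in> N" for a b
    unfolding sim_def
  proof (intro allI impI)
    fix c d assume cd: "(c, d) \<in> N"
    consider "(a, b) \<in> M" "(c, d) \<in> M" | "(a, b) \<in> R" "(c, d) \<in> M" | "(a, b) \<in> M" "(c, d) \<in> R"
      | "(a, b) \<in> R" "(c, d) \<in> R" using ab cd unfolding N_def by blast
    then show "sg (a - c) = sg (b - d)"
    proof cases
      case 1
      show ?thesis by (rule simD[OF partial_iso_sim[OF M 1(1)] 1(2)])
    next
      case 2
      then show ?thesis by (rule simRM)
    next
      case 3
      then have "sg (c - a) = sg (d - b)" using simRM by simp
      then show ?thesis using sg_diff_swap[of a c] sg_diff_swap[of b d] by simp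
    next
      case 4
      then show ?thesis by (rule simRR)
    qed
  qed
  ultimately have N: "partial_iso N" using M unfolding partial_iso_def N_def by blast
  have simN: "sim N x y \<Longrightarrow> sim M x y" for x y unfolding N_def sim_def by blast
  have dN: "sign_diagram N \<Q>" using d(1) simN unfolding sign_diagram_def by blast
  have "sign_diagram N {(p, q)}"
  proof (rule sign_diagram_of_roots[OF N])
    show "sign_diagram N {(pderiv p, pderiv q)}" using dN d(2) unfolding sign_diagram_def by blast
    show "sg (poly p a) = sg (poly q b)" if "(a, b) \<in> N" for a b
    proof (cases "(a, b) \<in> M")
      case False
      then have "poly p a = 0" "poly q b = 0" using that unfolding N_def R_def by blast+
      then show ?thesis by simp
    qed (rule agree)
    show "x \<in> fst ` N" if "poly (pderiv p) x = 0" for x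
      using droots[OF that] unfolding N_def by blast
    show "x \<in> fst ` N" if x: "poly p x = 0" for x
    proof (cases "x \<in> fst ` M")
      case False
      then have "poly (pderiv p) x \<noteq> 0" using droots by blast
      then obtain y where "sim M x y" "poly q y = 0" using root_transfer[OF M dd agree False] x by blast
      then have "(x, y) \<in> R" using False x unfolding R_def by blast
      then show ?thesis unfolding N_def by force
    qed (auto simp: N_def)
    show "y \<in> snd ` N" if y: "poly q y = 0" for y
    proof (cases "y \<in> snd ` M")
      case False
      then have nzy: "poly (pderiv q) y \<noteq> 0" using droots' by blast
      have "\<exists>x. sim (M\<inverse>) y x \<and> poly p x = 0"
      proof (rule root_transfer[of "M\<inverse>" q p])
        show "sign_diagram (M\<inverse>) {(pderiv q, pderiv p)}"
          using sign_diagramD[OF dd _ singletonI] unfolding sign_diagram_def by auto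
        show "y \<notin> fst ` (M\<inverse>)" using False by force
      qed (use M agree nzy y in auto)
      then obtain x where "sim M x y" "poly p x = 0" by auto
      then have "(x, y) \<in> R" using converse_notin[of x y] False y unfolding R_def by blast
      then show ?thesis unfolding N_def by force
    qed (auto simp: N_def)
  qed
  then have "sign_diagram N (insert (p, q) \<Q>)" using dN unfolding sign_diagram_def by blast
  then show ?thesis using N by blast
qed

section \<open>Elimination of one variable\<close>

definition unital_hom :: "('a::comm_ring_1 \<Rightarrow> 'b::comm_ring_1) \<Rightarrow> bool" where
  "unital_hom h \<longleftrightarrow> h 1 = 1 \<and> (\<forall>a b. h (a + b) = h a + h b) \<and> (\<forall>a b. h (a * b) = h a * h b)"

lemma unital_hom_simps:
  assumes "unital_hom h"
  shows "h 1 = 1" "h (a + b) = h a + h b" "h (a * b) = h a * h b" "h 0 = 0"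
    "h (- a) = - h a" "h (a - b) = h a - h b" "h (a ^ n) = h a ^ n" "h (of_nat n) = of_nat n"
    "h (sum g A) = (\<Sum>x\<in>A. h (g x))" "h (prod g A) = (\<Prod>x\<in>A. h (g x))"
    "h (sum_list xs) = (\<Sum>x\<leftarrow>xs. h x)"
proof -
  show 1: "h 1 = 1" and add: "h (a + b) = h a + h b" and mult: "h (a * b) = h a * h b" for a b
    using assms by (auto simp: unital_hom_def)
  show zero: "h 0 = 0" using add[of 0 0] by simp
  show minus: "h (- a) = - h a" for a using add[of a "- a"] zero by (simp add: eq_neg_iff_add_eq_0 add.commute)
  show "h (a - b) = h a - h b" using add[of a "- b"] minus by simp
  show "h (a ^ n) = h a ^ n" by (induction n) (auto simp: 1 mult)
  show "h (of_nat n) = of_nat n" by (induction n) (auto simp: 1 add zero)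
  show "h (sum g A) = (\<Sum>x\<in>A. h (g x))" by (induction A rule: infinite_finite_induct) (auto simp: add zero)
  show "h (prod g A) = (\<Prod>x\<in>A. h (g x))" by (induction A rule: infinite_finite_induct) (auto simp: mult 1)
  show "h (sum_list xs) = (\<Sum>x\<leftarrow>xs. h x)" by (induction xs) (auto simp: add zero)
qed

text \<open>The library derivative \<^const>\<open>pderiv\<close> is only available over rings without zero divisors.\<close>

definition formal_deriv :: "'a::comm_ring_1 poly \<Rightarrow> 'a poly" where
  "formal_deriv p = (\<Sum>i<degree p. monom (of_nat (Suc i) * coeff p (Suc i)) i)"

lemma coeff_formal_deriv: "coeff (formal_deriv p) n = of_nat (Suc n) * coeff p (Suc n)"
  by (auto simp: formal_deriv_def coeff_sum coeff_eq_0 simp del: of_nat_Suc)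

lemma degree_formal_deriv:
  assumes "0 < degree p"
  shows "degree (formal_deriv p) < degree p"
proof -
  have "degree (formal_deriv p) \<le> degree p - 1"
    by (rule degree_le) (auto simp: coeff_formal_deriv coeff_eq_0)
  then show ?thesis using assms by simp
qed

lemma map_poly_formal_deriv:
  fixes h :: "'a::comm_ring_1 \<Rightarrow> 'b::idom"
  assumes "unital_hom h"
  shows "map_poly h (formal_deriv p) = pderiv (map_poly h p)"
  by (rule poly_eqI)
     (simp add: coeff_map_poly coeff_formal_deriv coeff_pderiv unital_hom_simps[OF assms])

lemma map_poly_hom:
  assumes h: "unital_hom h"
  shows "map_poly h (p + q) = map_poly h p + map_poly h q"
    "map_poly h (p - q) = map_poly h p - map_poly h q"
    "map_poly h (smult c p) = smult (h c) (map_poly h p)"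
    "map_poly h (p * q) = map_poly h p * map_poly h q"
    "map_poly h (monom c n) = monom (h c) n"
  by (rule poly_eqI, simp add: coeff_map_poly coeff_mult unital_hom_simps[OF h] coeff_monom)+

text \<open>Elimination runs through the subrings of polynomials in some of the variables of one
  fixed ring, so coefficient rings are sets inside one type.\<close>

definition subring_set :: "'a::comm_ring_1 set \<Rightarrow> bool" where
  "subring_set E \<longleftrightarrow> 0 \<in> E \<and> 1 \<in> E \<and> (\<forall>a\<in>E. \<forall>b\<in>E. a + b \<in> E \<and> a - b \<in> E \<and> a * b \<in> E)"

lemma subring_set_closed:
  assumes "subring_set E"
  shows "0 \<in> E" "1 \<in> E" "a \<in> E \<Longrightarrow> b \<in> E \<Longrightarrow> a + b \<in> E" "a \<in> E \<Longrightarrow> b \<in> E \<Longrightarrow> a - b \<in> E"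
    "a \<in> E \<Longrightarrow> b \<in> E \<Longrightarrow> a * b \<in> E" "a \<in> E \<Longrightarrow> a ^ n \<in> E" "of_nat n \<in> E"
    "(\<And>x. x \<in> A \<Longrightarrow> g x \<in> E) \<Longrightarrow> sum g A \<in> E"
proof -
  show *: "0 \<in> E" "1 \<in> E" "a \<in> E \<Longrightarrow> b \<in> E \<Longrightarrow> a + b \<in> E" "a \<in> E \<Longrightarrow> b \<in> E \<Longrightarrow> a - b \<in> E"
    "a \<in> E \<Longrightarrow> b \<in> E \<Longrightarrow> a * b \<in> E" for a b using assms by (auto simp: subring_set_def)
  show "a \<in> E \<Longrightarrow> a ^ n \<in> E" by (induction n) (auto simp: *)
  show "of_nat n \<in> E" by (induction n) (auto simp: *)
  show "(\<And>x. x \<in> A \<Longrightarrow> g x \<in> E) \<Longrightarrow> sum g A \<in> E"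
    by (induction A rule: infinite_finite_induct) (auto simp: *)
qed

definition polys_over :: "'a::comm_ring_1 set \<Rightarrow> 'a poly set" where
  "polys_over E = {p. \<forall>n. coeff p n \<in> E}"

lemma polys_over_closed:
  assumes E: "subring_set E"
  shows "p \<in> polys_over E \<Longrightarrow> q \<in> polys_over E \<Longrightarrow> p + q \<in> polys_over E"
    "p \<in> polys_over E \<Longrightarrow> q \<in> polys_over E \<Longrightarrow> p - q \<in> polys_over E"
    "p \<in> polys_over E \<Longrightarrow> q \<in> polys_over E \<Longrightarrow> p * q \<in> polys_over E"
    "c \<in> E \<Longrightarrow> p \<in> polys_over E \<Longrightarrow> smult c p \<in> polys_over E"
    "c \<in> E \<Longrightarrow> monom c n \<in> polys_over E"
    "p \<in> polys_over E \<Longrightarrow> formal_deriv p \<in> polys_over E"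
    "0 \<in> polys_over E"
    "c \<in> E \<Longrightarrow> [:c:] \<in> polys_over E"
    "c \<in> E \<Longrightarrow> p \<in> polys_over E \<Longrightarrow> pCons c p \<in> polys_over E"
  using subring_set_closed[OF E]
  by (auto simp: polys_over_def coeff_mult coeff_monom coeff_formal_deriv coeff_pCons simp del: of_nat_Suc
      intro!: subring_set_closed(8)[OF E] split: nat.splits)

lemma lead_coeff_in: "p \<in> polys_over E \<Longrightarrow> lead_coeff p \<in> E"
  by (simp add: polys_over_def)

lemma degree_cancel_lead:
  fixes p q :: "'a::comm_ring_1 poly"
  assumes "degree p \<le> n" "degree q \<le> n" "coeff p n = coeff q n" "0 < n"
  shows "degree (p - q) < n"
proof -
  have "degree (p - q) \<le> n" using assms(1,2) by (rule degree_diff_le)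
  moreover have "degree (p - q) \<noteq> n"
  proof
    assume d: "degree (p - q) = n"
    then have "lead_coeff (p - q) = 0" using assms(3) by simp
    then have "p - q = 0" by (simp only: leading_coeff_0_iff)
    then show False using d assms(4) by simp
  qed
  ultimately show ?thesis by simp
qed

text \<open>Multiplying by an even power of the leading coefficient preserves signs.\<close>

lemma even_pseudo_remainder:
  fixes p q :: "'a::comm_ring_1 poly"
  assumes E: "subring_set E" and q: "q \<in> polys_over E" "0 < degree q" and "p \<in> polys_over E"
  shows "\<exists>r\<in>polys_over E. \<exists>a\<in>polys_over E. \<exists>k. degree r < degree q \<and> smult (lead_coeff q ^ (2 * k)) p = a * q + r"
  using assms(4)
proof (induction "degree p" arbitrary: p rule: less_induct)
  case less
  show ?case
  proof (cases "degree p < degree q")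
    case True
    then show ?thesis using less.prems polys_over_closed(7)[OF E]
      by (intro bexI[of _ p] bexI[of _ 0] exI[of _ 0]) auto
  next
    case False
    define c where "c = lead_coeff q"
    define m where "m = monom (lead_coeff p) (degree p - degree q)"
    define p1 where "p1 = smult c p - m * q"
    have m: "m \<in> polys_over E" unfolding m_def
      by (intro polys_over_closed(5)[OF E] lead_coeff_in less.prems)
    have c: "c \<in> E" unfolding c_def using q(1) by (rule lead_coeff_in)
    have p1: "p1 \<in> polys_over E" unfolding p1_def
      by (intro polys_over_closed(2-4)[OF E] c less.prems m q(1))
    have "degree p1 < degree p" unfolding p1_def
    proof (rule degree_cancel_lead)
      have "degree (m * q) \<le> degree m + degree q" by (rule degree_mult_le)
      also have "\<dots> \<le> degree p" using False degree_monom_le[of "lead_coeff p" "degree p - degree q"] by (simp add: m_def)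
      finally show "degree (m * q) \<le> degree p" .
      have "coeff (m * q) (degree p) = coeff (m * q) ((degree p - degree q) + degree q)" using False by simp
      also have "\<dots> = lead_coeff p * lead_coeff q" unfolding m_def
        by (simp add: coeff_monom_mult)
      finally show "coeff (smult c p) (degree p) = coeff (m * q) (degree p)" by (simp add: c_def mult.commute)
    qed (use False q(2) in \<open>auto intro: order_trans[OF degree_smult_le]\<close>)
    from less.hyps[OF this p1] obtain r a k where r: "r \<in> polys_over E" "degree r < degree q"
      "smult (c ^ (2 * k)) p1 = a * q + r" and a: "a \<in> polys_over E" unfolding c_def by blast
    have "smult (c ^ (2 * Suc k)) p = smult c (smult (c ^ (2 * k)) (p1 + m * q))"
      by (simp add: p1_def mult_ac)
    also have "\<dots> = smult c (smult (c ^ (2 * k)) p1) + smult (c * c ^ (2 * k)) m * q"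
      by (simp add: smult_add_right)
    also have "\<dots> = (smult c a + smult (c * c ^ (2 * k)) m) * q + smult c r"
      unfolding r(3) by (simp add: smult_add_right algebra_simps)
    finally have "smult (c ^ (2 * Suc k)) p = (smult c a + smult (c * c ^ (2 * k)) m) * q + smult c r" .
    moreover have "smult c r \<in> polys_over E" by (intro polys_over_closed(4)[OF E] c r)
    moreover have "smult c a + smult (c * c ^ (2 * k)) m \<in> polys_over E"
      by (intro polys_over_closed(1,4)[OF E] subring_set_closed(5,6)[OF E] c a m)
    moreover have "degree (smult c r) < degree q" using r(2) degree_smult_le le_less_trans by blast
    ultimately show ?thesis unfolding c_def by blast
  qed
qed

text \<open>\<open>\<phi>\<close> is the specialization whose signs are to be reproduced, and the
  \<open>\<psi> w\<close> are the candidates. The coefficients whose signs matter are known only in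
  the course of the elimination; each condition holds eventually along \<open>G\<close>, hence so do
  any finitely many at once.\<close>

locale sign_family =
  fixes \<phi> :: "'e::comm_ring_1 \<Rightarrow> 'k::real_closed_field"
    and \<psi> :: "'w \<Rightarrow> 'e \<Rightarrow> 'r::real_closed_field"
    and G :: "'w filter" and E :: "'e set"
  assumes hom: "unital_hom \<phi>" "\<And>w. unital_hom (\<psi> w)"
    and subring: "subring_set E"
    and signs: "\<And>c. c \<in> E \<Longrightarrow> \<forall>\<^sub>F w in G. sg (\<psi> w c) = sg (\<phi> c)"
begin

definition specialize :: "'w \<Rightarrow> 'e poly \<Rightarrow> 'k poly \<times> 'r poly" where
  "specialize w P = (map_poly \<phi> P, map_poly (\<psi> w) P)"

definition has_diagram :: "'w \<Rightarrow> 'e poly set \<Rightarrow> bool" where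
  "has_diagram w Ps \<longleftrightarrow> (\<exists>M. partial_iso M \<and> sign_diagram M (specialize w ` Ps))"

text \<open>The degree of a normal polynomial survives \<open>\<phi>\<close> and, because signs
  agree, eventually also \<open>\<psi> w\<close>.\<close>

definition normal :: "'e poly \<Rightarrow> bool" where
  "normal P \<longleftrightarrow> P = 0 \<or> \<phi> (lead_coeff P) \<noteq> 0"

text \<open>A leading coefficient killed by \<open>\<phi>\<close> has sign zero, so it is eventually
  killed by \<open>\<psi> w\<close> as well; dropping that term changes neither
  specialization.\<close>

lemma exists_normal:
  assumes "P \<in> polys_over E"
  shows "\<exists>Q. Q \<in> polys_over E \<and> degree Q \<le> degree P \<and> normal Q \<and> (\<forall>\<^sub>F w in G. specialize w Q = specialize w P)"
  using assms
proof (induction "degree P" arbitrary: P rule: less_induct)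
  case less
  show ?case
  proof (cases "normal P")
    case True
    then show ?thesis using less.prems by (intro exI[of _ P]) auto
  next
    case False
    define Q where "Q = P - monom (lead_coeff P) (degree P)"
    have lc: "\<phi> (lead_coeff P) = 0" "lead_coeff P \<in> E"
      using False less.prems lead_coeff_in by (auto simp: normal_def)
    have Q: "Q \<in> polys_over E" unfolding Q_def
      by (intro polys_over_closed[OF subring] less.prems lc)
    have "\<forall>\<^sub>F w in G. \<psi> w (lead_coeff P) = 0" using signs[OF lc(2)] lc(1) by simp
    then have spec: "\<forall>\<^sub>F w in G. specialize w Q = specialize w P"
      by eventually_elim (simp add: specialize_def Q_def map_poly_hom[OF hom(1)] map_poly_hom[OF hom(2)] lc)
    show ?thesis
    proof (cases "degree P = 0")
      case True
      then have "Q = 0" unfolding Q_def by (metis degree_eq_zeroE diff_self lead_coeff_pCons(2) monom_0 degree_pCons_0)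
      then show ?thesis using spec Q by (intro exI[of _ Q]) (auto simp: normal_def)
    next
      case False
      then have "degree Q < degree P" unfolding Q_def
        by (intro degree_cancel_lead) (auto simp: degree_monom_le)
      from less.hyps[OF this Q] obtain Q' where "Q' \<in> polys_over E" "degree Q' \<le> degree Q" "normal Q'"
        "\<forall>\<^sub>F w in G. specialize w Q' = specialize w Q" by blast
      moreover from this(4) spec have "\<forall>\<^sub>F w in G. specialize w Q' = specialize w P"
        by eventually_elim simp
      ultimately show ?thesis using \<open>degree Q < degree P\<close> by (intro exI[of _ Q']) auto
    qed
  qed
qed

lemma normal_nonzero:
  assumes "P \<in> polys_over E" "normal P" "P \<noteq> 0"
  shows "map_poly \<phi> P \<noteq> 0" "\<forall>\<^sub>F w in G. map_poly (\<psi> w) P \<noteq> 0"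
proof -
  have lc: "\<phi> (lead_coeff P) \<noteq> 0" using assms by (simp add: normal_def)
  have nz: "map_poly h P \<noteq> 0" if "unital_hom h" "h (lead_coeff P) \<noteq> 0" for h :: "'e \<Rightarrow> 'z::comm_ring_1"
    using that coeff_map_poly[of h P "degree P"] unital_hom_simps(4)[OF that(1)] by auto
  show "map_poly \<phi> P \<noteq> 0" using nz[OF hom(1) lc] .
  have "\<forall>\<^sub>F w in G. \<psi> w (lead_coeff P) \<noteq> 0"
    using signs[OF lead_coeff_in[OF assms(1)]] by eventually_elim (metis lc sg_eqD(3))
  then show "\<forall>\<^sub>F w in G. map_poly (\<psi> w) P \<noteq> 0" by eventually_elim (rule nz[OF hom(2)])
qed

end

lemma poly_pseudo_remainder_root:
  fixes h :: "'a::comm_ring_1 \<Rightarrow> 'b::linordered_idom"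
  assumes h: "unital_hom h" and eq: "smult (c ^ (2 * k)) p = a * q + r"
    and "h c \<noteq> 0" "poly (map_poly h q) x = 0"
  shows "sg (poly (map_poly h r) x) = sg (poly (map_poly h p) x)"
proof -
  have "map_poly h r = map_poly h (smult (c ^ (2 * k)) p - a * q)" using eq by simp
  then have "poly (map_poly h r) x = h c ^ (2 * k) * poly (map_poly h p) x"
    using assms(4) by (simp add: map_poly_hom[OF h] unital_hom_simps[OF h])
  moreover have "sg (h c ^ (2 * k)) = 1" using assms(3) by (simp add: power_mult zero_less_power)
  ultimately show ?thesis by (simp only: sg_mult)
qed

context sign_family
begin

lemma normal_formal_deriv:
  assumes "normal P" "0 < degree P"
  shows "normal (formal_deriv P)" "formal_deriv P \<noteq> 0"
proof -
  have "P \<noteq> 0" using assms(2) by auto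
  define n where "n = degree P - 1"
  have n: "degree P = Suc n" using assms(2) by (simp add: n_def)
  have nz: "\<phi> (coeff (formal_deriv P) n) \<noteq> 0"
    using assms(1) \<open>P \<noteq> 0\<close> n
    by (simp add: coeff_formal_deriv normal_def unital_hom_simps[OF hom(1)] del: of_nat_Suc)
  then have "coeff (formal_deriv P) n \<noteq> 0" using unital_hom_simps(4)[OF hom(1)] by auto
  then have "n \<le> degree (formal_deriv P)" by (rule le_degree)
  then have "degree (formal_deriv P) = n" using degree_formal_deriv[OF assms(2)] n by simp
  then show "normal (formal_deriv P)" using nz by (simp add: normal_def)
  show "formal_deriv P \<noteq> 0" using \<open>coeff (formal_deriv P) n \<noteq> 0\<close> by auto
qed

text \<open>Trades \<open>P\<close> for its derivative and its remainders. After pruning, each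
  marked point is a root of some \<open>Q\<close> in \<open>Qs\<close>, and there \<open>P\<close>
  has the sign of its remainder modulo \<open>Q\<close>. With these signs and the diagram of the
  derivative known, \<open>sign_diagram_extend\<close> inserts the roots of
  \<open>P\<close>.\<close>

lemma has_diagram_step:
  assumes fin: "finite Ps" and over: "Ps \<subseteq> polys_over E" and norm: "\<forall>Q\<in>Ps. normal Q"
    and P: "P \<in> Ps" "0 < degree P"
  defines "Qs \<equiv> insert (formal_deriv P) (Ps - {P})"
  assumes rem: "\<And>Q. Q \<in> Qs \<Longrightarrow> 0 < degree Q \<Longrightarrow> \<exists>a k. smult (lead_coeff Q ^ (2 * k)) P = a * Q + rm Q"
    and ev: "\<forall>\<^sub>F w in G. has_diagram w (Qs \<union> rm ` {Q\<in>Qs. 0 < degree Q})"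
  shows "\<forall>\<^sub>F w in G. has_diagram w Ps"
proof -
  have finQ: "finite Qs" using fin by (simp add: Qs_def)
  have overQ: "Q \<in> polys_over E" if "Q \<in> Qs" for Q
    using that over P(1) polys_over_closed(6)[OF subring] unfolding Qs_def by blast
  have normQ: "normal Q" if "Q \<in> Qs" for Q
    using that norm normal_formal_deriv[OF _ P(2)] P(1) unfolding Qs_def by blast
  have "\<forall>\<^sub>F w in G. map_poly \<phi> Q = 0 \<longleftrightarrow> map_poly (\<psi> w) Q = 0" if Q: "Q \<in> Qs" for Q
  proof (cases "Q = 0")
    case False
    show ?thesis using normal_nonzero(2)[OF overQ[OF Q] normQ[OF Q] False]
      by eventually_elim (use normal_nonzero(1)[OF overQ[OF Q] normQ[OF Q] False] in simp)
  qed simp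
  then have ev1: "\<forall>\<^sub>F w in G. \<forall>Q\<in>Qs. map_poly \<phi> Q = 0 \<longleftrightarrow> map_poly (\<psi> w) Q = 0"
    using finQ by (simp add: eventually_ball_finite_distrib)
  have "\<forall>\<^sub>F w in G. sg (\<psi> w (lead_coeff Q)) = sg (\<phi> (lead_coeff Q))" if "Q \<in> Qs" for Q
    by (rule signs[OF lead_coeff_in[OF overQ[OF that]]])
  then have ev2: "\<forall>\<^sub>F w in G. \<forall>Q\<in>Qs. sg (\<psi> w (lead_coeff Q)) = sg (\<phi> (lead_coeff Q))"
    using finQ by (simp add: eventually_ball_finite_distrib)
  show ?thesis using ev ev1 ev2
  proof eventually_elim
    fix w
    assume "has_diagram w (Qs \<union> rm ` {Q\<in>Qs. 0 < degree Q})"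
      and zero: "\<forall>Q\<in>Qs. map_poly \<phi> Q = 0 \<longleftrightarrow> map_poly (\<psi> w) Q = 0"
      and lc: "\<forall>Q\<in>Qs. sg (\<psi> w (lead_coeff Q)) = sg (\<phi> (lead_coeff Q))"
    then obtain M where M: "partial_iso M" "sign_diagram M (specialize w ` (Qs \<union> rm ` {Q\<in>Qs. 0 < degree Q}))"
      unfolding has_diagram_def by blast
    define \<Q> where "\<Q> = specialize w ` Qs"
    define N where "N = {(a, b) \<in> M. \<exists>(p, q)\<in>\<Q>. p \<noteq> 0 \<and> poly p a = 0}"
    have MQ: "sign_diagram M \<Q>" using M(2) unfolding sign_diagram_def \<Q>_def by blast
    have zeroQ: "p = 0 \<longleftrightarrow> q = 0" if "(p, q) \<in> \<Q>" for p q
      using that zero unfolding \<Q>_def specialize_def by auto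
    have N: "partial_iso N" "sign_diagram N \<Q>"
      unfolding N_def by (rule sign_diagram_prune[OF M(1) MQ zeroQ]; assumption)+
    have agree: "sg (poly (map_poly \<phi> P) a) = sg (poly (map_poly (\<psi> w) P) b)" if ab: "(a, b) \<in> N" for a b
    proof -
      have abM: "(a, b) \<in> M" using ab unfolding N_def by blast
      obtain Q where Q: "Q \<in> Qs" "map_poly \<phi> Q \<noteq> 0" "poly (map_poly \<phi> Q) a = 0"
        using ab unfolding N_def \<Q>_def specialize_def by auto
      have "(map_poly \<phi> Q, map_poly (\<psi> w) Q) \<in> \<Q>" using Q(1) unfolding \<Q>_def specialize_def by blast
      from sign_diagramD[OF MQ partial_iso_sim[OF M(1) abM] this]
      have Qb: "poly (map_poly (\<psi> w) Q) b = 0" using Q(3) by simp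
      \<comment> \<open>Remainders are available only for positive degree; a constant with nonzero
        image has no root.\<close>
      have deg: "0 < degree Q"
      proof (rule ccontr)
        assume "\<not> 0 < degree Q"
        then obtain c where "Q = [:c:]" using degree_eq_zeroE by auto
        then show False using Q(2,3) unital_hom_simps(4)[OF hom(1)] by (simp add: map_poly_pCons)
      qed
      have "Q \<noteq> 0" using deg by auto
      then have lc1: "\<phi> (lead_coeff Q) \<noteq> 0" using normQ[OF Q(1)] by (simp add: normal_def)
      then have lc2: "\<psi> w (lead_coeff Q) \<noteq> 0" using lc Q(1) sg_eqD(3) by blast
      obtain c k where "smult (lead_coeff Q ^ (2 * k)) P = c * Q + rm Q" using rem[OF Q(1) deg] by blast
      note r = poly_pseudo_remainder_root[OF hom(1) this lc1 Q(3)] poly_pseudo_remainder_root[OF hom(2) this lc2 Qb]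
      have "(map_poly \<phi> (rm Q), map_poly (\<psi> w) (rm Q)) \<in> specialize w ` (Qs \<union> rm ` {Q\<in>Qs. 0 < degree Q})"
        using Q(1) deg unfolding specialize_def by blast
      from sign_diagramD[OF M(2) partial_iso_sim[OF M(1) abM] this] show ?thesis using r by simp
    qed
    have dP: "(pderiv (map_poly \<phi> P), pderiv (map_poly (\<psi> w) P)) \<in> \<Q>"
      unfolding \<Q>_def Qs_def specialize_def
      by (simp add: map_poly_formal_deriv[OF hom(1)] map_poly_formal_deriv[OF hom(2)])
    have "formal_deriv P \<in> Qs" by (simp add: Qs_def)
    then have nz: "pderiv (map_poly \<phi> P) \<noteq> 0"
      using normal_nonzero(1)[OF overQ normQ] normal_formal_deriv(2)[of P] norm P
      by (simp add: map_poly_formal_deriv[OF hom(1), symmetric])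
    then have nz': "pderiv (map_poly (\<psi> w) P) \<noteq> 0" using zeroQ[OF dP] by simp
    obtain N' where "partial_iso N'" "sign_diagram N' (insert (map_poly \<phi> P, map_poly (\<psi> w) P) \<Q>)"
      using sign_diagram_extend[OF N dP nz nz' agree] by blast
    moreover have "specialize w ` Ps \<subseteq> insert (map_poly \<phi> P, map_poly (\<psi> w) P) \<Q>"
      unfolding \<Q>_def Qs_def specialize_def by blast
    ultimately show "has_diagram w Ps" unfolding has_diagram_def sign_diagram_def by blast
  qed
qed

lemma has_diagram_constant:
  assumes "finite Ps" "Ps \<subseteq> polys_over E" "\<forall>P\<in>Ps. degree P = 0"
  shows "\<forall>\<^sub>F w in G. has_diagram w Ps"
proof -
  have "\<forall>\<^sub>F w in G. sg (\<psi> w (coeff P 0)) = sg (\<phi> (coeff P 0))" if "P \<in> Ps" for P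
    using that assms(2) by (intro signs) (auto simp: polys_over_def)
  then have "\<forall>\<^sub>F w in G. \<forall>P\<in>Ps. sg (\<psi> w (coeff P 0)) = sg (\<phi> (coeff P 0))"
    using assms(1) by (simp add: eventually_ball_finite_distrib)
  then show ?thesis
  proof eventually_elim
    case (elim w)
    have c: "poly (map_poly h P) x = h (coeff P 0)" if P: "P \<in> Ps" and h: "unital_hom h" for h :: "'e \<Rightarrow> 'z::comm_ring_1" and P x
    proof -
      have "degree P = 0" using assms(3) P by simp
      then obtain c where "P = [:c:]" by (rule degree_eq_zeroE)
      then show ?thesis using unital_hom_simps(4)[OF h] by (simp add: map_poly_pCons)
    qed
    have "sign_diagram {} (specialize w ` Ps)" unfolding sign_diagram_def specialize_def
      using elim c[OF _ hom(1)] c[OF _ hom(2)] by auto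
    moreover have "partial_iso ({} :: ('k \<times> 'r) set)" by (simp add: partial_iso_def)
    ultimately show ?case unfolding has_diagram_def by blast
  qed
qed

text \<open>Lexicographic induction on the top degree \<open>d\<close> and the number of polynomials
  attaining it. Normalization raises neither, and \<open>has_diagram_step\<close> replaces one
  polynomial of top degree by polynomials of smaller degree. \<open>k\<close> bounds the number
  instead of being equal to it, because normalization may lower it.\<close>

lemma eventually_has_diagram_aux:
  assumes "finite Ps" "Ps \<subseteq> polys_over E" "\<forall>P\<in>Ps. degree P \<le> d" "card {P\<in>Ps. degree P = d} \<le> k"
  shows "\<forall>\<^sub>F w in G. has_diagram w Ps"
  using assms
proof (induction d arbitrary: k Ps)
  case 0
  have "\<forall>P\<in>Ps. degree P = 0" using 0(3) by simp
  then show ?case by (rule has_diagram_constant[OF 0(1,2)])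
next
  case (Suc d)
  note IH = Suc.IH
  show ?case using Suc.prems
  proof (induction k arbitrary: Ps)
    case 0
    then have "{P\<in>Ps. degree P = Suc d} = {}" by simp
    then have "\<forall>P\<in>Ps. degree P \<le> d" using 0(1,3) by (auto simp: le_Suc_eq)
    then show ?case using IH[OF 0(1,2)] by blast
  next
    case (Suc k)
    have "\<exists>f. \<forall>P\<in>Ps. f P \<in> polys_over E \<and> degree (f P) \<le> degree P \<and> normal (f P)
        \<and> (\<forall>\<^sub>F w in G. specialize w (f P) = specialize w P)"
      using Suc.prems(2) by (intro bchoice ballI exists_normal) blast
    then obtain f where f: "\<And>P. P \<in> Ps \<Longrightarrow> f P \<in> polys_over E" "\<And>P. P \<in> Ps \<Longrightarrow> degree (f P) \<le> degree P"
      "\<And>P. P \<in> Ps \<Longrightarrow> normal (f P)" "\<And>P. P \<in> Ps \<Longrightarrow> \<forall>\<^sub>F w in G. specialize w (f P) = specialize w P" by blast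
    define Ps1 where "Ps1 = f ` Ps"
    have fin1: "finite Ps1" using Suc.prems(1) by (simp add: Ps1_def)
    have deg1: "\<forall>P\<in>Ps1. degree P \<le> Suc d" using f(2) Suc.prems(3) unfolding Ps1_def by fastforce
    have over1: "Ps1 \<subseteq> polys_over E" using f(1) by (auto simp: Ps1_def)
    have norm1: "\<forall>P\<in>Ps1. normal P" using f(3) by (auto simp: Ps1_def)
    have "degree P = Suc d" if "P \<in> Ps" "degree (f P) = Suc d" for P
      using f(2)[OF that(1)] Suc.prems(3) that by (auto intro: le_antisym)
    then have sub: "{P\<in>Ps1. degree P = Suc d} \<subseteq> f ` {P\<in>Ps. degree P = Suc d}"
      unfolding Ps1_def by blast
    have "card {P\<in>Ps1. degree P = Suc d} \<le> card (f ` {P\<in>Ps. degree P = Suc d})"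
      by (rule card_mono[OF _ sub]) (simp add: Suc.prems(1))
    also have "\<dots> \<le> card {P\<in>Ps. degree P = Suc d}" by (rule card_image_le) (simp add: Suc.prems(1))
    also have "\<dots> \<le> Suc k" by (rule Suc.prems(4))
    finally have card1: "card {P\<in>Ps1. degree P = Suc d} \<le> Suc k" .
    have main: "\<forall>\<^sub>F w in G. has_diagram w Ps1"
    proof (cases "\<exists>P\<in>Ps1. degree P = Suc d")
      case False
      then have "\<forall>P\<in>Ps1. degree P \<le> d" using deg1 le_SucE by blast
      then show ?thesis by (rule IH[OF fin1 over1 _ order_refl])
    next
      case True
      then obtain P where P: "P \<in> Ps1" "degree P = Suc d" by blast
      then have degP: "0 < degree P" by simp
      have overP: "P \<in> polys_over E" using P over1 by blast
      define Qs where "Qs = insert (formal_deriv P) (Ps1 - {P})"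
      have overQ: "Q \<in> polys_over E" if "Q \<in> Qs" for Q
        using that over1 overP polys_over_closed(6)[OF subring] unfolding Qs_def by blast
      have "\<forall>Q\<in>{Q\<in>Qs. 0 < degree Q}. \<exists>r. r \<in> polys_over E \<and> degree r < degree Q \<and>
          (\<exists>a k. smult (lead_coeff Q ^ (2 * k)) P = a * Q + r)"
        using even_pseudo_remainder[OF subring overQ _ overP] by (metis (no_types, lifting) mem_Collect_eq)
      from bchoice[OF this] obtain rm where rm: "\<And>Q. Q \<in> Qs \<Longrightarrow> 0 < degree Q \<Longrightarrow> rm Q \<in> polys_over E"
        "\<And>Q. Q \<in> Qs \<Longrightarrow> 0 < degree Q \<Longrightarrow> degree (rm Q) < degree Q"
        "\<And>Q. Q \<in> Qs \<Longrightarrow> 0 < degree Q \<Longrightarrow> \<exists>a k. smult (lead_coeff Q ^ (2 * k)) P = a * Q + rm Q" by blast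
      have degfd: "degree (formal_deriv P) < Suc d" using degree_formal_deriv[OF degP] P(2) by simp
      have degQ: "degree Q \<le> Suc d" if "Q \<in> Qs" for Q
        using that deg1 degfd unfolding Qs_def by auto
      have degR: "degree R < Suc d" if R: "R \<in> rm ` {Q\<in>Qs. 0 < degree Q}" for R
      proof -
        obtain Q where "Q \<in> Qs" "0 < degree Q" "R = rm Q" using R by blast
        then show ?thesis using rm(2)[of Q] degQ[of Q] by simp
      qed
      define F where "F = Qs \<union> rm ` {Q\<in>Qs. 0 < degree Q}"
      have ev: "\<forall>\<^sub>F w in G. has_diagram w F"
      proof (rule Suc.IH)
        show "finite F" using fin1 by (simp add: F_def Qs_def)
        show "F \<subseteq> polys_over E" using overQ rm(1) by (auto simp: F_def)
        show "\<forall>Q\<in>F. degree Q \<le> Suc d" unfolding F_def using degQ less_imp_le[OF degR] by blast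
        have "Q \<in> Ps1 - {P}" if "Q \<in> F" "degree Q = Suc d" for Q
          using that degR[of Q] degfd unfolding F_def Qs_def by auto
        then have "{Q\<in>F. degree Q = Suc d} \<subseteq> {Q\<in>Ps1. degree Q = Suc d} - {P}" by blast
        then have "card {Q\<in>F. degree Q = Suc d} \<le> card ({Q\<in>Ps1. degree Q = Suc d} - {P})"
          using fin1 by (intro card_mono) auto
        also have "\<dots> \<le> k" using card1 P fin1 by (simp add: card_Diff_singleton)
        finally show "card {Q\<in>F. degree Q = Suc d} \<le> k" .
      qed
      show ?thesis
        by (rule has_diagram_step[OF fin1 over1 norm1 P(1) degP rm(3)[unfolded Qs_def] ev[unfolded F_def Qs_def]])
    qed
    have "\<forall>\<^sub>F w in G. \<forall>P\<in>Ps. specialize w (f P) = specialize w P"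
      using f(4) Suc.prems(1) by (simp add: eventually_ball_finite_distrib)
    with main show ?case
    proof eventually_elim
      fix w assume 1: "has_diagram w Ps1" and 2: "\<forall>P\<in>Ps. specialize w (f P) = specialize w P"
      have "specialize w ` Ps1 = specialize w ` Ps"
        unfolding Ps1_def image_image by (rule image_cong[OF refl]) (rule bspec[OF 2])
      then show "has_diagram w Ps" using 1 unfolding has_diagram_def by metis
    qed
  qed
qed

text \<open>Elimination of a single variable: \<open>x\<close> is a new coordinate on the side of
  \<open>\<phi>\<close>, and \<open>y\<close> is the coordinate by which the point \<open>w\<close>
  is extended.\<close>

theorem eventually_sign_transfer:
  assumes "finite Ps" "Ps \<subseteq> polys_over E"
  shows "\<forall>\<^sub>F w in G. \<exists>y. \<forall>P\<in>Ps. sg (poly (map_poly (\<psi> w) P) y) = sg (poly (map_poly \<phi> P) x)"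
proof -
  have "\<forall>P\<in>Ps. degree P \<le> Max (insert 0 (degree ` Ps))" using assms(1) by simp
  from eventually_has_diagram_aux[OF assms this order_refl] show ?thesis
  proof eventually_elim
    case (elim w)
    then obtain M where M: "partial_iso M" "sign_diagram M (specialize w ` Ps)" unfolding has_diagram_def by blast
    obtain y where y: "sim M x y" using sim_exists[OF M(1)] by blast
    have "sg (poly (map_poly (\<psi> w) P) y) = sg (poly (map_poly \<phi> P) x)" if "P \<in> Ps" for P
    proof -
      have "(map_poly \<phi> P, map_poly (\<psi> w) P) \<in> specialize w ` Ps" using that unfolding specialize_def by blast
      from sign_diagramD[OF M(2) y this] show ?thesis by simp
    qed
    then show ?case by blast
  qed
qed

end

section \<open>The real closure of an ordered field\<close>

text \<open>A positive cone of the subfield \<open>P - P\<close>. Only squares of differences are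
  required, because the ambient field will be algebraically closed and there \<open>- 1\<close> is a
  square.\<close>

definition field_cone :: "'a::field set \<Rightarrow> bool" where
  "field_cone P \<longleftrightarrow> 1 \<in> P \<and> (\<forall>a\<in>P. \<forall>b\<in>P. a + b \<in> P \<and> a * b \<in> P \<and> (a - b) ^ 2 \<in> P)
     \<and> (\<forall>a\<in>P. inverse a \<in> P \<and> (- a \<in> P \<longrightarrow> a = 0))"

lemma field_coneD:
  assumes "field_cone P"
  shows "1 \<in> P" "0 \<in> P" "a \<in> P \<Longrightarrow> b \<in> P \<Longrightarrow> a + b \<in> P" "a \<in> P \<Longrightarrow> b \<in> P \<Longrightarrow> a * b \<in> P"
    "a \<in> P \<Longrightarrow> b \<in> P \<Longrightarrow> (a - b) ^ 2 \<in> P" "a \<in> P \<Longrightarrow> inverse a \<in> P"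
    "a \<in> P \<Longrightarrow> - a \<in> P \<Longrightarrow> a = 0"
proof -
  show *: "1 \<in> P" "a \<in> P \<Longrightarrow> b \<in> P \<Longrightarrow> a + b \<in> P" "a \<in> P \<Longrightarrow> b \<in> P \<Longrightarrow> a * b \<in> P"
    "a \<in> P \<Longrightarrow> b \<in> P \<Longrightarrow> (a - b) ^ 2 \<in> P" "a \<in> P \<Longrightarrow> inverse a \<in> P"
    "a \<in> P \<Longrightarrow> - a \<in> P \<Longrightarrow> a = 0" for a b using assms by (auto simp: field_cone_def)
  show "0 \<in> P" using *(4)[OF *(1,1)] by simp
qed

definition extends_order :: "'a::linordered_field alg_closure set \<Rightarrow> bool" where
  "extends_order P \<longleftrightarrow> field_cone P \<and> (\<forall>x\<ge>0. to_ac x \<in> P)"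

text \<open>Maximality is taken among cones and not among ordered subfields: enlarging a cone
  enlarges the field \<open>P - P\<close> and its ordering together, so one use of Zorn's lemma
  yields both.\<close>

definition closure_cone :: "'a::linordered_field alg_closure set" where
  "closure_cone = (SOME P. extends_order P \<and> (\<forall>Q. extends_order Q \<longrightarrow> P \<subseteq> Q \<longrightarrow> Q = P))"

lemma closure_cone:
  "extends_order (closure_cone :: 'a::linordered_field alg_closure set)"
  "extends_order Q \<Longrightarrow> (closure_cone :: 'a alg_closure set) \<subseteq> Q \<Longrightarrow> Q = closure_cone"
proof -
  define A where "A = {P :: 'a alg_closure set. extends_order P}"
  have "\<exists>M\<in>A. \<forall>N\<in>A. M \<subseteq> N \<longrightarrow> N = M"
  proof (rule subset_Zorn_nonempty)
    have "extends_order (to_ac ` {x::'a. 0 \<le> x})"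
      unfolding extends_order_def field_cone_def
    proof (intro conjI ballI impI allI)
      have I: "to_ac x \<in> to_ac ` {x::'a. 0 \<le> x}" if "0 \<le> x" for x using that by blast
      show "1 \<in> to_ac ` {x::'a. 0 \<le> x}" using I[of 1] by simp
      show "to_ac x \<in> to_ac ` {x::'a. 0 \<le> x}" if "0 \<le> x" for x using I that .
      fix a assume "a \<in> to_ac ` {x::'a. 0 \<le> x}"
      then obtain x :: 'a where x: "a = to_ac x" "0 \<le> x" by blast
      show "inverse a \<in> to_ac ` {x::'a. 0 \<le> x}" using I[of "inverse x"] x by simp
      show "a = 0" if na: "- a \<in> to_ac ` {x::'a. 0 \<le> x}"
      proof -
        obtain y :: 'a where y: "- a = to_ac y" "0 \<le> y" using na by blast
        then have "to_ac (- x) = to_ac y" using x by simp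
        then have "- x = y" by (simp only: to_ac_eq_iff)
        then show ?thesis using x y(2) by simp
      qed
      fix b assume "b \<in> to_ac ` {x::'a. 0 \<le> x}"
      then obtain y :: 'a where y: "b = to_ac y" "0 \<le> y" by blast
      show "a + b \<in> to_ac ` {x::'a. 0 \<le> x}" using I[of "x + y"] x y by simp
      show "a * b \<in> to_ac ` {x::'a. 0 \<le> x}" using I[of "x * y"] x y by simp
      show "(a - b)^2 \<in> to_ac ` {x::'a. 0 \<le> x}" using I[of "(x - y)^2"] x y by simp
    qed
    then show "A \<noteq> {}" by (auto simp: A_def)
  next
    fix C assume C: "C \<noteq> {}" "subset.chain A C"
    have ext: "extends_order P" if "P \<in> C" for P using C(2) that by (auto simp: subset.chain_def A_def)
    obtain P0 where P0: "P0 \<in> C" using C(1) by blast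
    have two: "\<exists>P\<in>C. a \<in> P \<and> b \<in> P" if "a \<in> \<Union>C" "b \<in> \<Union>C" for a b
    proof -
      obtain P1 P2 where P: "P1 \<in> C" "a \<in> P1" "P2 \<in> C" "b \<in> P2" using \<open>a \<in> \<Union>C\<close> \<open>b \<in> \<Union>C\<close> by blast
      have "P1 \<subseteq> P2 \<or> P2 \<subseteq> P1" using C(2) P(1,3) by (auto simp: subset.chain_def)
      then show ?thesis using P by blast
    qed
    have fc: "field_cone P" if "P \<in> C" for P using ext[OF that] by (simp add: extends_order_def)
    have "field_cone (\<Union>C)" unfolding field_cone_def
    proof (intro conjI ballI impI)
      show "1 \<in> \<Union>C" using field_coneD(1)[OF fc[OF P0]] P0 by blast
      fix a assume a: "a \<in> \<Union>C"
      show "inverse a \<in> \<Union>C" using a field_coneD(6)[OF fc] by blast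
      show "a = 0" if "- a \<in> \<Union>C" using two[OF a that] field_coneD(7)[OF fc] by blast
      fix b assume b: "b \<in> \<Union>C"
      show "a + b \<in> \<Union>C" "a * b \<in> \<Union>C" "(a - b)^2 \<in> \<Union>C"
        using two[OF a b] field_coneD(3-5)[OF fc] by blast+
    qed
    moreover have "\<forall>x\<ge>0. to_ac x \<in> \<Union>C" using ext[OF P0] P0 unfolding extends_order_def by blast
    ultimately show "\<Union>C \<in> A" by (simp add: A_def extends_order_def)
  qed
  then have "\<exists>P :: 'a alg_closure set. extends_order P \<and> (\<forall>Q. extends_order Q \<longrightarrow> P \<subseteq> Q \<longrightarrow> Q = P)"
    unfolding A_def by blast
  from someI_ex[OF this] show "extends_order (closure_cone :: 'a alg_closure set)"
    "extends_order Q \<Longrightarrow> (closure_cone :: 'a alg_closure set) \<subseteq> Q \<Longrightarrow> Q = closure_cone"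
    unfolding closure_cone_def[symmetric] by blast+
qed

lemmas closure_cone_field_cone = closure_cone(1)[unfolded extends_order_def, THEN conjunct1]
lemmas closure_cone_intros = field_coneD(1-6)[OF closure_cone_field_cone]
lemmas closure_cone_antisym = field_coneD(7)[OF closure_cone_field_cone]

text \<open>The differences form a field: \<open>inverse a = a * inverse (a ^ 2)\<close>, and the
  square already lies in the cone.\<close>

lemma field_cone_differences:
  fixes P :: "'a::field_char_0 set"
  assumes P: "field_cone P"
  defines "D \<equiv> {x - y | x y. x \<in> P \<and> y \<in> P}"
  shows "a \<in> D \<Longrightarrow> b \<in> D \<Longrightarrow> a + b \<in> D" "a \<in> D \<Longrightarrow> b \<in> D \<Longrightarrow> a - b \<in> D"
    "a \<in> D \<Longrightarrow> b \<in> D \<Longrightarrow> a * b \<in> D" "a \<in> D \<Longrightarrow> inverse a \<in> D" "a \<in> D \<Longrightarrow> - a \<in> D"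
    "a \<in> P \<Longrightarrow> a \<in> D" "a \<in> D \<Longrightarrow> a ^ 2 \<in> P"
proof -
  note [intro] = field_coneD[OF P]
  have I: "x - y \<in> D" if "x \<in> P" "y \<in> P" for x y using that by (auto simp: D_def)
  have E: "\<exists>x y. a = x - y \<and> x \<in> P \<and> y \<in> P" if "a \<in> D" for a using that by (auto simp: D_def)
  show mem: "a \<in> P \<Longrightarrow> a \<in> D" for a using I[of a 0] by auto
  show sq: "a \<in> D \<Longrightarrow> a ^ 2 \<in> P" for a using E[of a] by blast
  show "a + b \<in> D" if "a \<in> D" "b \<in> D"
  proof -
    from E[OF that(1)] E[OF that(2)] obtain x y u v where *: "a = x - y" "b = u - v" "x \<in> P" "y \<in> P" "u \<in> P" "v \<in> P" by blast
    have "a + b = (x + u) - (y + v)" using * by simp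
    moreover have "\<dots> \<in> D" by (rule I) (use * in auto)
    ultimately show ?thesis by metis
  qed
  show "- a \<in> D" if "a \<in> D" for a
  proof -
    from E[OF that] obtain x y where *: "a = x - y" "x \<in> P" "y \<in> P" by blast
    then have "- a = y - x" by simp
    moreover have "\<dots> \<in> D" by (rule I) (use * in auto)
    ultimately show ?thesis by metis
  qed
  show "a - b \<in> D" if "a \<in> D" "b \<in> D"
  proof -
    from E[OF that(1)] E[OF that(2)] obtain x y u v where *: "a = x - y" "b = u - v" "x \<in> P" "y \<in> P" "u \<in> P" "v \<in> P" by blast
    have "a - b = (x + v) - (y + u)" using * by simp
    moreover have "\<dots> \<in> D" by (rule I) (use * in auto)
    ultimately show ?thesis by metis
  qed
  show mul: "a * b \<in> D" if "a \<in> D" "b \<in> D" for a b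
  proof -
    from E[OF that(1)] E[OF that(2)] obtain x y u v where *: "a = x - y" "b = u - v" "x \<in> P" "y \<in> P" "u \<in> P" "v \<in> P" by blast
    have "a * b = (x * u + y * v) - (x * v + y * u)" unfolding *(1,2) by (simp add: algebra_simps)
    moreover have "\<dots> \<in> D" by (rule I) (use * in auto)
    ultimately show ?thesis by metis
  qed
  show "inverse a \<in> D" if "a \<in> D"
  proof -
    have "inverse a = a * inverse (a ^ 2)" by (simp add: power2_eq_square field_simps)
    then show ?thesis using mul[OF that mem] sq[OF that] by auto
  qed
qed

text \<open>A maximal cone orders the field that it generates: an element \<open>a\<close> could be added to the cone unless \<open>- a\<close>
  already belongs to it.\<close>

lemma closure_cone_total:
  fixes a :: "'a::linordered_field alg_closure"
  assumes a: "a \<in> {x - y | x y. x \<in> closure_cone \<and> y \<in> closure_cone}"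
  shows "a \<in> closure_cone \<or> - a \<in> closure_cone"
proof (rule ccontr)
  assume neg: "\<not> (a \<in> closure_cone \<or> - a \<in> closure_cone)"
  let ?P = "closure_cone :: 'a alg_closure set"
  note P = closure_cone_intros
  define D where "D = {x - y | x y. x \<in> ?P \<and> y \<in> ?P}"
  note D = field_cone_differences[OF closure_cone_field_cone[where 'a = 'a], folded D_def]
  have aD: "a \<in> D" using a by (simp add: D_def)
  define Q where "Q = {s + a * t | s t. s \<in> ?P \<and> t \<in> ?P}"
  have I: "s + a * t \<in> Q" if "s \<in> ?P" "t \<in> ?P" for s t using that by (auto simp: Q_def)
  have E: "\<exists>s t. u = s + a * t \<and> s \<in> ?P \<and> t \<in> ?P" if "u \<in> Q" for u using that by (auto simp: Q_def)
  have PQ: "?P \<subseteq> Q" using I[of _ 0] P by auto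
  have QD: "Q \<subseteq> D" using E D(1,3,6) aD by blast
  have mul: "u * v \<in> Q" if "u \<in> Q" "v \<in> Q" for u v
  proof -
    from E[OF that(1)] E[OF that(2)] obtain s t s' t' where *: "u = s + a * t" "v = s' + a * t'"
      "s \<in> ?P" "t \<in> ?P" "s' \<in> ?P" "t' \<in> ?P" by blast
    have "u * v = (s * s' + a ^ 2 * (t * t')) + a * (s * t' + t * s')"
      using * by (simp add: algebra_simps power2_eq_square)
    moreover have "\<dots> \<in> Q" by (rule I) (intro P(3,4) * D(7)[OF aD])+
    ultimately show ?thesis by metis
  qed
  have "field_cone Q" unfolding field_cone_def
  proof (intro conjI ballI impI)
    show "1 \<in> Q" using P(1) PQ by blast
    fix u assume u: "u \<in> Q"
    have "inverse (u ^ 2) \<in> Q" using P(6)[OF D(7)] QD u PQ by blast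
    then have "u * inverse (u ^ 2) \<in> Q" using mul u by blast
    moreover have "u * inverse (u ^ 2) = inverse u" by (simp add: power2_eq_square field_simps)
    ultimately show "inverse u \<in> Q" by simp
    show "u = 0" if nu: "- u \<in> Q"
    proof -
      obtain s t where st: "u = s + a * t" "s \<in> ?P" "t \<in> ?P" using E[OF u] by (elim exE conjE)
      obtain s' t' where st': "- u = s' + a * t'" "s' \<in> ?P" "t' \<in> ?P" using E[OF nu] by (elim exE conjE)
      note * = st(1) st'(1) st(2,3) st'(2,3)
      have "(s + a * t) + (s' + a * t') = 0" using *(1,2) by (metis add.right_inverse)
      then have sum: "(s + s') + a * (t + t') = 0" by (simp add: algebra_simps)
      show ?thesis
      proof (cases "t + t' = 0")
        case True
        then have "- t = t'" "- s = s'" using sum by (simp_all add: add_eq_0_iff)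
        then have "t = 0" "s = 0" using closure_cone_antisym[of t] closure_cone_antisym[of s] * by simp_all
        then show ?thesis using * by simp
      next
        case False
        have "- a = (- (a * (t + t'))) * inverse (t + t')" using False by simp
        also have "- (a * (t + t')) = s + s'" using sum by (simp add: add_eq_0_iff)
        also have "(s + s') * inverse (t + t') \<in> ?P" by (intro P *)
        finally have "- a \<in> ?P" .
        then show ?thesis using neg by blast
      qed
    qed
    fix v assume v: "v \<in> Q"
    show "u + v \<in> Q"
    proof -
      from E[OF u] E[OF v] obtain s t s' t' where *: "u = s + a * t" "v = s' + a * t'"
        "s \<in> ?P" "t \<in> ?P" "s' \<in> ?P" "t' \<in> ?P" by blast
      have "u + v = (s + s') + a * (t + t')" using * by (simp add: algebra_simps)
      moreover have "\<dots> \<in> Q" by (rule I) (intro P *)+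
      ultimately show ?thesis by metis
    qed
    show "u * v \<in> Q" using mul u v .
    show "(u - v)^2 \<in> Q" using D(7)[OF D(2)[of u v]] QD u v PQ by blast
  qed
  then have "extends_order Q" using PQ closure_cone(1) unfolding extends_order_def by blast
  then have "Q = ?P" using closure_cone(2) PQ by blast
  moreover have "a \<in> Q" using I[OF P(2,1)] by simp
  ultimately show False using neg by blast
qed

section \<open>The differences of a maximal cone as an ordered field\<close>

definition closure_field :: "'a::linordered_field alg_closure set" where
  "closure_field = {x - y | x y. x \<in> closure_cone \<and> y \<in> closure_cone}"

lemmas rc_closed = field_cone_differences[OF closure_cone_field_cone, folded closure_field_def]

lemmas rc_total = closure_cone_total[folded closure_field_def]

typedef (overloaded) 'a real_closure = "closure_field :: 'a::linordered_field alg_closure set"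
  morphisms rc_rep rc_abs
  using rc_closed(6)[OF closure_cone_intros(1)] by blast

setup_lifting type_definition_real_closure

instantiation real_closure :: (linordered_field) linordered_field
begin

lift_definition zero_real_closure :: "'a real_closure" is 0
  using rc_closed(6)[OF closure_cone_intros(2)] .
lift_definition one_real_closure :: "'a real_closure" is 1
  using rc_closed(6)[OF closure_cone_intros(1)] .
lift_definition plus_real_closure :: "'a real_closure \<Rightarrow> 'a real_closure \<Rightarrow> 'a real_closure" is "(+)"
  by (rule rc_closed(1))
lift_definition minus_real_closure :: "'a real_closure \<Rightarrow> 'a real_closure \<Rightarrow> 'a real_closure" is "(-)"
  by (rule rc_closed(2))
lift_definition times_real_closure :: "'a real_closure \<Rightarrow> 'a real_closure \<Rightarrow> 'a real_closure" is "(*)"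
  by (rule rc_closed(3))
lift_definition inverse_real_closure :: "'a real_closure \<Rightarrow> 'a real_closure" is inverse
  by (rule rc_closed(4))
lift_definition uminus_real_closure :: "'a real_closure \<Rightarrow> 'a real_closure" is uminus
  by (rule rc_closed(5))
lift_definition divide_real_closure :: "'a real_closure \<Rightarrow> 'a real_closure \<Rightarrow> 'a real_closure" is "(/)"
  unfolding divide_inverse by (intro rc_closed(3,4))
lift_definition less_eq_real_closure :: "'a real_closure \<Rightarrow> 'a real_closure \<Rightarrow> bool"
  is "\<lambda>x y. y - x \<in> closure_cone" .
definition less_real_closure :: "'a real_closure \<Rightarrow> 'a real_closure \<Rightarrow> bool"
  where "less_real_closure x y \<longleftrightarrow> x \<le> y \<and> x \<noteq> y"
definition abs_real_closure :: "'a real_closure \<Rightarrow> 'a real_closure"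
  where "abs_real_closure x = (if x < 0 then - x else x)"
definition sgn_real_closure :: "'a real_closure \<Rightarrow> 'a real_closure"
  where "sgn_real_closure x = (if x = 0 then 0 else if 0 < x then 1 else - 1)"

instance
proof
  fix a b c :: "'a real_closure"
  show "a * b * c = a * (b * c)" by transfer (rule mult.assoc)
  show "a * b = b * a" by transfer (rule mult.commute)
  show "1 * a = a" by transfer simp
  show "a + b + c = a + (b + c)" by transfer (rule add.assoc)
  show "a + b = b + a" by transfer (rule add.commute)
  show "0 + a = a" by transfer simp
  show "- a + a = 0" by transfer simp
  show "a - b = a + - b" by transfer simp
  show "(a + b) * c = a * c + b * c" by transfer (rule distrib_right)
  show "(0 :: 'a real_closure) \<noteq> 1" by transfer simp
  show "a \<noteq> 0 \<Longrightarrow> inverse a * a = 1" by transfer simp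
  show "a div b = a * inverse b" by transfer (rule divide_inverse)
  show "inverse (0 :: 'a real_closure) = 0" by transfer simp
  show "a + b - a = b" by transfer simp
  show "a - b - c = a - (b + c)" by transfer (rule diff_diff_eq)
  show "0 * a = 0" "a * 0 = 0" by (transfer, simp)+
  show refl: "a \<le> a" by transfer (simp add: closure_cone_intros(2))
  show antisym: "a = b" if "a \<le> b" "b \<le> a" for a b :: "'a real_closure"
    using that
  proof transfer
    fix a b :: "'a alg_closure"
    assume "b - a \<in> closure_cone" "a - b \<in> closure_cone"
    then have "b - a = 0" using closure_cone_antisym[of "b - a"] by simp
    then show "a = b" by simp
  qed
  show "a < b \<longleftrightarrow> a \<le> b \<and> \<not> b \<le> a"
    using antisym refl unfolding less_real_closure_def by blast
  show "a \<le> c" if "a \<le> b" "b \<le> c"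
    using that
  proof transfer
    fix a b c :: "'a alg_closure"
    assume "b - a \<in> closure_cone" "c - b \<in> closure_cone"
    from closure_cone_intros(3)[OF this] show "c - a \<in> closure_cone" by simp
  qed
  show "a \<le> b \<or> b \<le> a"
  proof transfer
    fix a b :: "'a alg_closure"
    assume "a \<in> closure_field"
      "b \<in> closure_field"
    then have "b - a \<in> closure_field" by (intro rc_closed(2))
    from rc_total[OF this] show "b - a \<in> closure_cone \<or> a - b \<in> closure_cone" by simp
  qed
  show "c + a \<le> c + b" if "a \<le> b" using that by transfer simp
  show "c * a < c * b" if "a < b" "0 < c"
  proof -
    have "c * a \<le> c * b" using that unfolding less_real_closure_def
    proof (transfer, elim conjE)
      fix a b c :: "'a alg_closure"
      assume "b - a \<in> closure_cone" "c - 0 \<in> closure_cone"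
      then have "c * (b - a) \<in> closure_cone" using closure_cone_intros(4) by simp
      then show "c * b - c * a \<in> closure_cone" by (simp add: right_diff_distrib)
    qed
    moreover have "c * a \<noteq> c * b" using that unfolding less_real_closure_def by transfer simp
    ultimately show ?thesis unfolding less_real_closure_def by blast
  qed
  show "\<bar>a\<bar> = (if a < 0 then - a else a)" by (rule abs_real_closure_def)
  show "sgn a = (if a = 0 then 0 else if 0 < a then 1 else - 1)" by (rule sgn_real_closure_def)
qed

end

lemma unital_hom_rc_rep: "unital_hom rc_rep"
  unfolding unital_hom_def
  by (simp add: one_real_closure.rep_eq plus_real_closure.rep_eq times_real_closure.rep_eq)

lemma rc_rep_eq_0_iff: "rc_rep x = 0 \<longleftrightarrow> x = 0"
  by transfer simp

lemma rc_rep_nonneg_iff: "rc_rep x \<in> closure_cone \<longleftrightarrow> 0 \<le> x"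
  by transfer simp

lemma closure_cone_rc_rep:
  assumes "a \<in> closure_cone"
  shows "\<exists>x\<ge>0. rc_rep x = a"
proof -
  have "rc_rep (rc_abs a) = a" using rc_closed(6)[OF assms] by (rule rc_abs_inverse)
  then show ?thesis using assms rc_rep_nonneg_iff by metis
qed

lemma closure_cone_to_ac: "0 \<le> x \<Longrightarrow> to_ac x \<in> closure_cone"
  using closure_cone(1) unfolding extends_order_def by blast

definition to_rc :: "'a::linordered_field \<Rightarrow> 'a real_closure" where
  "to_rc x = rc_abs (to_ac x)"

lemma rc_rep_to_rc: "rc_rep (to_rc x) = to_ac x"
proof -
  have "to_ac x \<in> closure_field"
  proof (cases "0 \<le> x")
    case True
    then show ?thesis by (intro rc_closed(6) closure_cone_to_ac)
  next
    case False
    then have "- to_ac (- x) \<in> closure_field"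
      by (intro rc_closed(5,6) closure_cone_to_ac) simp
    then show ?thesis by simp
  qed
  then show ?thesis unfolding to_rc_def by (rule rc_abs_inverse)
qed

lemma unital_hom_to_rc: "unital_hom to_rc"
  unfolding unital_hom_def
  by (auto simp: rc_rep_inject[symmetric] rc_rep_to_rc one_real_closure.rep_eq plus_real_closure.rep_eq
      times_real_closure.rep_eq)

lemma sg_to_rc: "sg (to_rc x) = sg x"
proof -
  have nonneg: "0 \<le> to_rc x" if "0 \<le> x" for x :: 'a
    using closure_cone_to_ac[OF that] by (simp flip: rc_rep_nonneg_iff add: rc_rep_to_rc)
  have zero: "to_rc x = 0 \<longleftrightarrow> x = 0" for x :: 'a
    unfolding rc_rep_eq_0_iff[symmetric] rc_rep_to_rc by simp
  have "to_rc (- x) = - to_rc x" by (rule unital_hom_simps(5)[OF unital_hom_to_rc])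
  then have neg: "to_rc x \<le> 0" if "x \<le> 0" using nonneg[of "- x"] that by simp
  show ?thesis
    using nonneg[of x] neg zero[of x] by (cases x "0 :: 'a" rule: linorder_cases) (auto simp: sg_def)
qed

subsection \<open>Polynomials over the real closure have the intermediate value property\<close>

text \<open>Nonnegative elements of the closure are not yet known to be squares. The weights ensure
  that the values at a root \<open>\<alpha>\<close> include all of
  \<open>closure_cone\<close>.\<close>

inductive_set weighted_squares :: "'a::linordered_field poly set" where
  zero: "0 \<in> weighted_squares"
| add: "s \<in> weighted_squares \<Longrightarrow> 0 \<le> c \<Longrightarrow> smult c (f ^ 2) + s \<in> weighted_squares"

lemma weighted_squares_sum:
  assumes "s \<in> weighted_squares" "t \<in> weighted_squares"
  shows "s + t \<in> weighted_squares"
  using assms(1)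
proof induction
  case (add s c f)
  from weighted_squares.add[OF add(3,2), of f] show ?case by (simp add: add.assoc)
qed (use assms(2) in simp)

lemma weighted_squares_square: "0 \<le> c \<Longrightarrow> smult c (f ^ 2) \<in> weighted_squares"
  using weighted_squares.add[OF weighted_squares.zero] by fastforce

lemma weighted_squares_mult:
  assumes "s \<in> weighted_squares" "t \<in> weighted_squares"
  shows "s * t \<in> weighted_squares"
  using assms(1)
proof induction
  case zero
  then show ?case by (simp add: weighted_squares.zero)
next
  case (add s c f)
  have "smult c (f ^ 2) * t \<in> weighted_squares" using assms(2)
  proof induction
    case zero
    then show ?case by (simp add: weighted_squares.zero)
  next
    case (add t d g)
    have "smult (c * d) ((f * g) ^ 2) + smult c (f ^ 2) * t \<in> weighted_squares"
      using add \<open>0 \<le> c\<close> by (intro weighted_squares.add) auto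
    moreover have "smult (c * d) ((f * g) ^ 2) + smult c (f ^ 2) * t = smult c (f ^ 2) * (smult d (g ^ 2) + t)"
      by (simp add: algebra_simps power_mult_distrib smult_add_right)
    ultimately show ?case by simp
  qed
  from weighted_squares_sum[OF this add(3)] show ?case by (simp add: algebra_simps)
qed

lemma weighted_squares_nonneg: "s \<in> weighted_squares \<Longrightarrow> 0 \<le> poly s x"
  by (induction rule: weighted_squares.induct) auto

lemma weighted_squares_mod:
  fixes p :: "'a::linordered_field poly"
  assumes "s \<in> weighted_squares" "0 < degree p"
  shows "\<exists>t\<in>weighted_squares. degree t \<le> 2 * (degree p - 1) \<and> p dvd s - t"
  using assms(1)
proof induction
  case zero
  then show ?case using weighted_squares.zero by (intro bexI[of _ 0]) auto
next
  case (add s c f)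
  then obtain t where t: "t \<in> weighted_squares" "degree t \<le> 2 * (degree p - 1)" "p dvd s - t" by blast
  have "p \<noteq> 0" using assms(2) by auto
  then have "degree (f mod p) \<le> degree p - 1" using degree_mod_less'[of p f] by (cases "f mod p = 0") auto
  then have "degree ((f mod p) ^ 2) \<le> 2 * (degree p - 1)"
    using degree_power_le[of "f mod p" 2] by simp
  then have "degree (smult c ((f mod p) ^ 2) + t) \<le> 2 * (degree p - 1)"
    using t(2) by (intro degree_add_le) (auto intro: order_trans[OF degree_smult_le])
  moreover have "p dvd smult c (f ^ 2) + s - (smult c ((f mod p) ^ 2) + t)"
  proof -
    have "p dvd f - f mod p" by (rule dvd_minus_mod)
    then have "p dvd smult c ((f - f mod p) * (f + f mod p))" by (intro dvd_smult dvd_mult2)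
    moreover have "smult c (f ^ 2) + s - (smult c ((f mod p) ^ 2) + t) = smult c ((f - f mod p) * (f + f mod p)) + (s - t)"
      by (simp add: algebra_simps power2_eq_square smult_diff_right smult_add_right)
    ultimately show ?thesis using t(3) by (simp only: dvd_add)
  qed
  ultimately show ?case using weighted_squares.add[OF t(1) add(2), of "f mod p"] by blast
qed

text \<open>If \<open>p\<close> had a sign change but no root in the closure, then adjoining a root \<open>\<alpha>\<close> would give an
  orderable field: otherwise \<open>p\<close> would divide one plus a sum of squares of degree at most
  \<open>2 (degree p - 1)\<close>, and the cofactor would be a polynomial of smaller degree with a sign change.\<close>

lemma real_closure_poly_ivt:
  fixes p :: "'a::linordered_field real_closure poly"
  assumes "a < b" "poly p a * poly p b < 0"
  shows "\<exists>c. a < c \<and> c < b \<and> poly p c = 0"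
  using assms(2)
proof (induction "degree p" arbitrary: p rule: less_induct)
  case less
  show ?case
  proof (rule ccontr)
    assume noroot: "\<not> (\<exists>c. a < c \<and> c < b \<and> poly p c = 0)"
    define R where "R = (map_poly rc_rep :: 'a real_closure poly \<Rightarrow> 'a alg_closure poly)"
    note hom = unital_hom_simps[OF unital_hom_rc_rep[where 'a = 'a]]
    have R: "R (f + g) = R f + R g" "R (f - g) = R f - R g" "R (f * g) = R f * R g"
      "R (smult c f) = smult (rc_rep c) (R f)" for f g c
      unfolding R_def by (simp_all add: map_poly_hom[OF unital_hom_rc_rep])
    have R2: "R (f ^ 2) = R f ^ 2" for f by (simp add: power2_eq_square R)
    have R0: "R 0 = 0" "R [:c:] = [:rc_rep c:]" "R 1 = 1" "R (pCons c f) = pCons (rc_rep c) (R f)" for c f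
      unfolding R_def by (simp_all add: map_poly_pCons hom one_pCons)
    have "degree p \<noteq> 0"
    proof
      assume "degree p = 0"
      then obtain c where "p = [:c:]" by (rule degree_eq_zeroE)
      then show False using less.prems by (simp add: mult_less_0_iff)
    qed
    then have degp: "0 < degree p" by simp
    have p0: "p \<noteq> 0" using degp by auto
    have "degree (R p) = degree p" unfolding R_def
      by (rule degree_map_poly) (simp add: rc_rep_eq_0_iff)
    then obtain \<alpha> where \<alpha>: "poly (R p) \<alpha> = 0" using alg_closed_imp_poly_has_root degp by metis
    \<comment> \<open>A nonzero annihilator \<open>m\<close> of \<open>\<alpha>\<close> of least
      degree divides \<open>p\<close>. If its degree is below that of \<open>p\<close>, one of the
      two factors changes sign between \<open>a\<close> and \<open>b\<close>, and by induction it
      has a root there.\<close>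
    have min: "f = 0" if f: "poly (R f) \<alpha> = 0" "degree f < degree p" for f
    proof (rule ccontr)
      assume "f \<noteq> 0"
      define good where "good g \<longleftrightarrow> poly (R g) \<alpha> = 0 \<and> g \<noteq> 0" for g
      have "good f" using f \<open>f \<noteq> 0\<close> by (simp add: good_def)
      define m where "m = arg_min degree good"
      have m: "good m" "\<And>g. good g \<Longrightarrow> degree m \<le> degree g"
        using arg_min_nat_lemma[of good f degree] \<open>good f\<close> unfolding m_def by blast+
      have degm: "degree m < degree p" using m(2)[OF \<open>good f\<close>] f(2) by simp
      have m0: "m \<noteq> 0" "poly (R m) \<alpha> = 0" using m(1) by (auto simp: good_def)
      have "degree m \<noteq> 0"
      proof
        assume "degree m = 0"
        then obtain c where "m = [:c:]" by (rule degree_eq_zeroE)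
        then show False using m0 by (simp add: R0 rc_rep_eq_0_iff)
      qed
      have "R (p mod m) = R p - R (p div m) * R m"
        by (simp only: R(2,3)[symmetric] minus_div_mult_eq_mod)
      then have "poly (R (p mod m)) \<alpha> = 0" using \<alpha> m0(2) by simp
      then have "p mod m = 0" using m(2)[of "p mod m"] degree_mod_less[OF m0(1), of p] unfolding good_def by force
      then have p: "p = (p div m) * m" by (metis add.right_neutral div_mult_mod_eq)
      have "degree p = degree (p div m) + degree m"
        using p p0 by (metis degree_mult_eq mult_eq_0_iff)
      then have "degree (p div m) < degree p" using \<open>degree m \<noteq> 0\<close> by simp
      have pv: "poly p x = poly (p div m) x * poly m x" for x using p by (metis poly_mult)
      have "poly (p div m) a * poly (p div m) b < 0 \<or> poly m a * poly m b < 0"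
        using less.prems unfolding pv by (auto simp: mult_less_0_iff zero_less_mult_iff)
      then obtain c where "a < c" "c < b" "poly (p div m) c = 0 \<or> poly m c = 0"
        using less.hyps[OF degm] less.hyps[OF \<open>degree (p div m) < degree p\<close>] by blast
      then show False using noroot pv by (metis mult_zero_left mult_zero_right)
    qed
    \<comment> \<open>Euclid's algorithm: at \<open>\<alpha>\<close> the remainder of
      \<open>p\<close> by \<open>f\<close> equals \<open>- (p div f) * f\<close>, so an inverse of
      the remainder gives one of \<open>f\<close>.\<close>
    have inv: "\<exists>k. poly (R k) \<alpha> * poly (R f) \<alpha> = 1" if "poly (R f) \<alpha> \<noteq> 0" "degree f < degree p" for f
      using that
    proof (induction "degree f" arbitrary: f rule: less_induct)
      case less
      have f0: "f \<noteq> 0" using less.prems R0 by auto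
      show ?case
      proof (cases "degree f = 0")
        case True
        then obtain c where c: "f = [:c:]" by (rule degree_eq_zeroE)
        then show ?thesis using less.prems(1)
          by (intro exI[of _ "[:inverse c:]"]) (simp add: R0 inverse_real_closure.rep_eq)
      next
        case False
        have eq: "R (p mod f) = R p - R (p div f) * R f"
          by (simp only: R(2,3)[symmetric] minus_div_mult_eq_mod)
        have pm: "p mod f = 0 \<or> degree (p mod f) < degree f" by (rule degree_mod_less[OF f0])
        have "poly (R (p mod f)) \<alpha> \<noteq> 0"
        proof
          assume z: "poly (R (p mod f)) \<alpha> = 0"
          have "degree (p mod f) < degree p" using pm less.prems(2) degp by auto
          then have "p mod f = 0" using min z by blast
          then have p: "p = (p div f) * f" by (metis add.right_neutral div_mult_mod_eq)
          have "poly (R (p div f)) \<alpha> = 0" using eq z \<alpha> less.prems(1) by simp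
          moreover have "degree p = degree (p div f) + degree f"
            using p p0 by (metis degree_mult_eq mult_eq_0_iff)
          ultimately have "p div f = 0" using min False by simp
          then show False using p p0 by simp
        qed
        moreover have "degree (p mod f) < degree f" using pm calculation R0 by auto
        ultimately obtain k where "poly (R k) \<alpha> * poly (R (p mod f)) \<alpha> = 1"
          using less.hyps less.prems(2) by (meson less_trans)
        then have "poly (R (- (k * (p div f)))) \<alpha> * poly (R f) \<alpha> = 1"
          using \<alpha> R(2)[of 0 "k * (p div f)"] by (simp add: eq R R0 algebra_simps)
        then show ?thesis by blast
      qed
    qed
    have inv': "\<exists>k. poly (R k) \<alpha> * poly (R f) \<alpha> = 1" if "poly (R f) \<alpha> \<noteq> 0" for f
    proof -
      have "R (f mod p) = R f - R (f div p) * R p"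
        by (simp only: R(2,3)[symmetric] minus_div_mult_eq_mod)
      then have "poly (R (f mod p)) \<alpha> = poly (R f) \<alpha>" using \<alpha> by simp
      moreover have "degree (f mod p) < degree p" using degree_mod_less[OF p0, of f] degp by auto
      ultimately show ?thesis using inv[of "f mod p"] that by metis
    qed
    define T where "T = {poly (R s) \<alpha> | s. s \<in> weighted_squares}"
    have not_minus1: "poly (R s) \<alpha> \<noteq> - 1" if s: "s \<in> weighted_squares" for s
    proof
      assume sm1: "poly (R s) \<alpha> = - 1"
      obtain t where t: "t \<in> weighted_squares" "degree t \<le> 2 * (degree p - 1)" "p dvd s - t"
        using weighted_squares_mod[OF s degp] by blast
      obtain u where u: "s - t = p * u" using t(3) by (rule dvdE)
      have "R s = R p * R u + R t" using u R by (metis diff_add_cancel)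
      then have rt: "poly (R (1 + t)) \<alpha> = 0" using sm1 \<alpha> by (simp add: R R0)
      have "R ((1 + t) mod p) = R (1 + t) - R ((1 + t) div p) * R p"
        by (simp only: R(2,3)[symmetric] minus_div_mult_eq_mod)
      then have "poly (R ((1 + t) mod p)) \<alpha> = 0" using rt \<alpha> by simp
      moreover have "degree ((1 + t) mod p) < degree p" using degree_mod_less[OF p0, of "1 + t"] degp by auto
      ultimately have "(1 + t) mod p = 0" by (rule min)
      then obtain h where h: "1 + t = p * h" by (metis mod_0_imp_dvd dvdE)
      have pos: "0 < poly p x * poly h x" for x
      proof -
        have "poly p x * poly h x = 1 + poly t x" using h by (metis poly_1 poly_add poly_mult)
        then show ?thesis using weighted_squares_nonneg[OF t(1), of x] by (simp add: add_pos_nonneg)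
      qed
      then have h0: "h \<noteq> 0" by (metis mult_zero_right poly_0 less_irrefl)
      have "degree p + degree h = degree (1 + t)" unfolding h using p0 h0 by (simp add: degree_mult_eq)
      also have "\<dots> \<le> 2 * (degree p - 1)" using t(2) by (intro degree_add_le) auto
      finally have "degree h < degree p" using degp by linarith
      moreover have "poly h a * poly h b < 0"
        using pos[of a] pos[of b] less.prems by (auto simp: zero_less_mult_iff mult_less_0_iff)
      ultimately obtain c where "poly h c = 0" using less.hyps by blast
      then show False using pos[of c] by simp
    qed
    have Tmul: "u * v \<in> T" if "u \<in> T" "v \<in> T" for u v
    proof -
      obtain s t where "u = poly (R s) \<alpha>" "v = poly (R t) \<alpha>" "s \<in> weighted_squares" "t \<in> weighted_squares"
        using \<open>u \<in> T\<close> \<open>v \<in> T\<close> unfolding T_def by blast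
      moreover from this have "u * v = poly (R (s * t)) \<alpha>" by (simp add: R)
      ultimately show ?thesis unfolding T_def using weighted_squares_mult by blast
    qed
    have Tadd: "u + v \<in> T" if "u \<in> T" "v \<in> T" for u v
    proof -
      obtain s t where "u = poly (R s) \<alpha>" "v = poly (R t) \<alpha>" "s \<in> weighted_squares" "t \<in> weighted_squares"
        using \<open>u \<in> T\<close> \<open>v \<in> T\<close> unfolding T_def by blast
      moreover from this have "u + v = poly (R (s + t)) \<alpha>" by (simp add: R)
      ultimately show ?thesis unfolding T_def using weighted_squares_sum by blast
    qed
    have Tsq: "poly (R f) \<alpha> ^ 2 \<in> T" for f
    proof -
      have "poly (R (smult 1 (f ^ 2))) \<alpha> = poly (R f) \<alpha> ^ 2" by (simp add: R2)
      then show ?thesis unfolding T_def using weighted_squares_square[of 1 f] by (metis (mono_tags, lifting) mem_Collect_eq zero_le_one)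
    qed
    have Tc: "closure_cone \<subseteq> T"
    proof
      fix z :: "'a alg_closure" assume "z \<in> closure_cone"
      then obtain c where c: "0 \<le> c" "rc_rep c = z" using closure_cone_rc_rep by blast
      have "poly (R (smult c (1 ^ 2))) \<alpha> = z" using c by (simp add: R R0)
      then show "z \<in> T" unfolding T_def using weighted_squares_square[OF c(1), of 1] by blast
    qed
    have Tval: "\<exists>s. u = poly (R s) \<alpha> \<and> s \<in> weighted_squares" if "u \<in> T" for u
      using that unfolding T_def by blast
    have "field_cone T" unfolding field_cone_def
    proof (intro conjI ballI impI)
      show "1 \<in> T" using Tsq[of 1] by (simp add: R0)
      fix u assume u: "u \<in> T"
      then obtain s where s: "u = poly (R s) \<alpha>" "s \<in> weighted_squares" using Tval by blast
      show "inverse u \<in> T"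
      proof (cases "u = 0")
        case True
        then show ?thesis using u by simp
      next
        case False
        then obtain k where "poly (R k) \<alpha> * u = 1" using inv' s(1) by blast
        then have "inverse u = poly (R k) \<alpha>" using False by (simp add: field_simps)
        moreover have "inverse u = u * inverse u ^ 2" using False by (simp add: power2_eq_square)
        ultimately show ?thesis using Tmul[OF u Tsq[of k]] by simp
      qed
      show "u = 0" if "- u \<in> T"
      proof (rule ccontr)
        assume "u \<noteq> 0"
        then obtain k where k: "poly (R k) \<alpha> * u = 1" using inv' s(1) by blast
        have "u * (- u) * poly (R k) \<alpha> ^ 2 \<in> T" using Tmul u that Tsq by blast
        also have "u * (- u) * poly (R k) \<alpha> ^ 2 = - ((poly (R k) \<alpha> * u) ^ 2)"
          by (simp add: power2_eq_square algebra_simps)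
        finally have "- 1 \<in> T" by (simp add: k)
        then show False using Tval not_minus1 by metis
      qed
      fix v assume v: "v \<in> T"
      then obtain t where t: "v = poly (R t) \<alpha>" "t \<in> weighted_squares" using Tval by blast
      show "u + v \<in> T" "u * v \<in> T" using Tadd Tmul u v by blast+
      show "(u - v) ^ 2 \<in> T" using Tsq[of "s - t"] s t by (simp add: R)
    qed
    then have "extends_order T" unfolding extends_order_def using Tc closure_cone_to_ac by blast
    then have T: "T = closure_cone" using closure_cone(2) Tc by blast
    have "\<alpha> = poly (R [:0, 1:]) \<alpha>" by (simp add: R0 hom)
    \<comment> \<open>With \<open>h\<close> one half,
      \<open>\<alpha> = (h + h \<alpha>)^2 - (h \<alpha> - h)^2\<close> is a difference of elements
      of \<open>T\<close>, so \<open>\<alpha>\<close> belongs to the closure.\<close>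
    define h where "h = (1 / 2 :: 'a real_closure)"
    have hh: "rc_rep h + rc_rep h = 1" using hom(2)[of h h] hom(1) by (simp add: h_def)
    have "poly (R [:h, h:]) \<alpha> ^ 2 - poly (R [:- h, h:]) \<alpha> ^ 2 = \<alpha> * (rc_rep h + rc_rep h) ^ 2"
      by (simp add: R0 hom power2_eq_square algebra_simps)
    then have "\<alpha> \<in> closure_field" unfolding closure_field_def using Tsq[of "[:h, h:]"] Tsq[of "[:- h, h:]"] T hh
      by (simp del: power2_diff) (metis)
    then obtain c where c: "rc_rep c = \<alpha>" using rc_abs_inverse by blast
    \<comment> \<open>Now a linear polynomial annihilates \<open>\<alpha>\<close>, so by
      \<open>min\<close> also \<open>p\<close> is linear, and its sign change puts the root
      \<open>c\<close> between \<open>a\<close> and \<open>b\<close>.\<close>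
    have "poly (R [:- c, 1:]) \<alpha> = 0" by (simp add: R0 hom c)
    then have "\<not> 1 < degree p" using min[of "[:- c, 1:]"] by auto
    then have "degree p = 1" using degp by simp
    then obtain k l where kl: "p = [:k, l:]" by (metis degree_eq_zeroE degree_pCons_eq_if One_nat_def nat.inject pCons_cases zero_neq_one)
    have "rc_rep (poly p c) = poly (R p) \<alpha>" by (simp add: kl R0 hom c)
    then have pc: "poly p c = 0" using \<alpha> rc_rep_eq_0_iff by metis
    then have "k = - (c * l)" by (simp add: kl add_eq_0_iff)
    then have px: "poly p x = l * (x - c)" for x by (simp add: kl algebra_simps)
    have "l ^ 2 * ((a - c) * (b - c)) < 0" using less.prems by (simp add: px power2_eq_square algebra_simps)
    then have "(a - c) * (b - c) < 0" by (metis mult_less_0_iff not_square_less_zero power2_eq_square)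
    then have "a < c" "c < b" using assms(1) by (auto simp: mult_less_0_iff)
    then show False using noroot pc by blast
  qed
qed

instance real_closure :: (linordered_field) real_closed_field
proof
  fix x y :: "'a real_closure" and f :: "nat \<Rightarrow> 'a real_closure" and n
  assume a: "x < y" "(\<Sum>k\<le>n. f k * x ^ k) < 0" "0 < (\<Sum>k\<le>n. f k * y ^ k)"
  define p where "p = (\<Sum>k\<le>n. monom (f k) k)"
  have p: "poly p z = (\<Sum>k\<le>n. f k * z ^ k)" for z by (simp add: p_def poly_sum poly_monom)
  show "\<exists>z. x < z \<and> z < y \<and> (\<Sum>k\<le>n. f k * z ^ k) = 0"
    using real_closure_poly_ivt[OF a(1), of p] a(2,3) by (simp add: p mult_less_0_iff)
qed

section \<open>Extension of derivations\<close>

text \<open>Values of \<open>D\<close> may lie outside \<open>L\<close>: the derivative of an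
  adjoined algebraic element is a quotient in the ambient field.\<close>

definition derivation_on :: "'a::comm_ring_1 set \<Rightarrow> ('a \<Rightarrow> 'a) \<Rightarrow> bool" where
  "derivation_on L D \<longleftrightarrow> subring_set L \<and>
     (\<forall>a\<in>L. \<forall>b\<in>L. D (a + b) = D a + D b \<and> D (a * b) = D a * b + a * D b)"

lemma derivation_onD:
  assumes "derivation_on L D"
  shows "subring_set L" "a \<in> L \<Longrightarrow> b \<in> L \<Longrightarrow> D (a + b) = D a + D b"
    "a \<in> L \<Longrightarrow> b \<in> L \<Longrightarrow> D (a * b) = D a * b + a * D b" "D 0 = 0" "D 1 = 0"
    "a \<in> L \<Longrightarrow> D (- a) = - D a"
    "(\<And>x. x \<in> A \<Longrightarrow> g x \<in> L) \<Longrightarrow> D (sum g A) = (\<Sum>x\<in>A. D (g x))"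
proof -
  show L: "subring_set L" and add: "\<And>a b. a \<in> L \<Longrightarrow> b \<in> L \<Longrightarrow> D (a + b) = D a + D b"
    and mult: "\<And>a b. a \<in> L \<Longrightarrow> b \<in> L \<Longrightarrow> D (a * b) = D a * b + a * D b"
    using assms by (auto simp: derivation_on_def)
  note cl = subring_set_closed[OF L]
  show zero: "D 0 = 0" using add[OF cl(1,1)] by simp
  show "D 1 = 0" using mult[OF cl(2,2)] by simp
  show "D (- a) = - D a" if "a \<in> L"
    using add[OF that, of "- a"] cl(4)[OF cl(1) that] zero by (simp add: eq_neg_iff_add_eq_0 add.commute)
  show "(\<And>x. x \<in> A \<Longrightarrow> g x \<in> L) \<Longrightarrow> D (sum g A) = (\<Sum>x\<in>A. D (g x))"
    by (induction A rule: infinite_finite_induct) (auto simp: zero add cl(8))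
qed

lemma map_poly_derivation:
  assumes D: "derivation_on L D" and p: "p \<in> polys_over L" and q: "q \<in> polys_over L"
  shows "map_poly D (p + q) = map_poly D p + map_poly D q"
    "map_poly D (p * q) = map_poly D p * q + p * map_poly D q"
proof -
  have c: "coeff p n \<in> L" "coeff q n \<in> L" for n using p q by (auto simp: polys_over_def)
  note d = derivation_onD[OF D]
  show "map_poly D (p + q) = map_poly D p + map_poly D q"
    by (rule poly_eqI) (simp add: coeff_map_poly d c)
  have "D (coeff p i * coeff q j) = D (coeff p i) * coeff q j + coeff p i * D (coeff q j)" for i j
    by (rule d(3)[OF c])
  then show "map_poly D (p * q) = map_poly D p * q + p * map_poly D q"
    by (intro poly_eqI) (simp add: coeff_map_poly coeff_mult d c subring_set_closed(5)[OF d(1)] sum.distrib)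
qed

text \<open>The derivation of \<open>L[a]\<close> sending \<open>a\<close> to \<open>u\<close>, evaluated on a polynomial expression in \<open>a\<close>.\<close>

definition deriv_at :: "('a::idom \<Rightarrow> 'a) \<Rightarrow> 'a \<Rightarrow> 'a \<Rightarrow> 'a poly \<Rightarrow> 'a" where
  "deriv_at D a u p = poly (map_poly D p) a + poly (pderiv p) a * u"

lemma deriv_at_simps:
  assumes D: "derivation_on L D" and p: "p \<in> polys_over L" and q: "q \<in> polys_over L"
  shows "deriv_at D a u (p + q) = deriv_at D a u p + deriv_at D a u q"
    "deriv_at D a u (p * q) = deriv_at D a u p * poly q a + poly p a * deriv_at D a u q"
  using map_poly_derivation[OF assms]
  by (simp_all add: deriv_at_def pderiv_add pderiv_mult algebra_simps)

lemma deriv_at_pCons: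
  assumes "derivation_on L D"
  shows "deriv_at D a u [:c:] = D c" "deriv_at D a u [:0, 1:] = u"
  using derivation_onD(4,5)[OF assms] by (simp_all add: deriv_at_def map_poly_pCons pderiv_pCons)

text \<open>The condition on \<open>u\<close> says that the formula for the new derivation does not
  depend on the polynomial that represents an element of \<open>L[a]\<close>.\<close>

lemma derivation_extend:
  fixes L :: "'a::idom set"
  assumes D: "derivation_on L D"
    and u: "\<And>p. p \<in> polys_over L \<Longrightarrow> poly p a = 0 \<Longrightarrow> deriv_at D a u p = 0"
  shows "\<exists>L' D'. derivation_on L' D' \<and> L \<subseteq> L' \<and> a \<in> L' \<and> (\<forall>x\<in>L. D' x = D x) \<and> D' a = u"
proof -
  have L: "subring_set L" by (rule derivation_onD(1)[OF D])
  note cl = polys_over_closed[OF L]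
  note rc = subring_set_closed[OF L]
  define L' where "L' = {poly p a | p. p \<in> polys_over L}"
  define D' where "D' x = deriv_at D a u (SOME p. p \<in> polys_over L \<and> poly p a = x)" for x
  have D': "D' (poly p a) = deriv_at D a u p" if p: "p \<in> polys_over L" for p
  proof -
    define q where "q = (SOME q. q \<in> polys_over L \<and> poly q a = poly p a)"
    have q: "q \<in> polys_over L" "poly q a = poly p a"
      using someI[of "\<lambda>q. q \<in> polys_over L \<and> poly q a = poly p a" p] p unfolding q_def by auto
    have m: "[:- 1:] * q \<in> polys_over L" by (rule cl(3)[OF cl(8) q(1)]) (use rc(4)[OF rc(1,2)] in simp)
    have "deriv_at D a u ([:- 1:] * q) = - deriv_at D a u q"
      using deriv_at_simps(2)[OF D cl(8) q(1), of "- 1" a u] rc(4)[OF rc(1,2)]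
        derivation_onD(5,6)[OF D] rc(2) deriv_at_pCons(1)[OF D]
      by (simp del: mult_pCons_left)
    moreover have "deriv_at D a u (p + [:- 1:] * q) = 0"
      using u[OF cl(1)[OF p m]] q(2) by simp
    ultimately show ?thesis using deriv_at_simps(1)[OF D p m, of a u] by (simp add: D'_def q_def)
  qed
  have sub: "L \<subseteq> L'"
  proof
    fix x assume "x \<in> L"
    then show "x \<in> L'" unfolding L'_def using cl(8) by (intro CollectI exI[of _ "[:x:]"]) simp
  qed
  have E: "\<exists>p. x = poly p a \<and> p \<in> polys_over L" if "x \<in> L'" for x using that by (auto simp: L'_def)
  have der: "derivation_on L' D'" unfolding derivation_on_def subring_set_def
  proof (intro conjI ballI)
    show "0 \<in> L'" "1 \<in> L'" using sub rc(1,2) by auto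
    fix x y assume "x \<in> L'" "y \<in> L'"
    then obtain p q where p: "x = poly p a" "p \<in> polys_over L" and q: "y = poly q a" "q \<in> polys_over L" using E by meson
    have I: "poly r a \<in> L'" if "r \<in> polys_over L" for r using that by (auto simp: L'_def)
    show "x + y \<in> L'" "x - y \<in> L'" "x * y \<in> L'"
      using I[OF cl(1)[OF p(2) q(2)]] I[OF cl(2)[OF p(2) q(2)]] I[OF cl(3)[OF p(2) q(2)]] p(1) q(1) by simp_all
    show "D' (x + y) = D' x + D' y"
      using D'[OF cl(1)[OF p(2) q(2)]] D'[OF p(2)] D'[OF q(2)] deriv_at_simps(1)[OF D p(2) q(2)] p(1) q(1) by simp
    show "D' (x * y) = D' x * y + x * D' y"
      using D'[OF cl(3)[OF p(2) q(2)]] D'[OF p(2)] D'[OF q(2)] deriv_at_simps(2)[OF D p(2) q(2)] p(1) q(1) by simp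
  qed
  have X: "[:0, 1:] \<in> polys_over L" using cl(9)[OF rc(1) cl(8)[OF rc(2)]] .
  have "a \<in> L'" using X unfolding L'_def by (intro CollectI exI[of _ "[:0, 1:]"]) simp
  moreover have "D' a = u" using D'[OF X] deriv_at_pCons(2)[OF D] by simp
  moreover have "\<forall>x\<in>L. D' x = D x" using D'[OF cl(8)] deriv_at_pCons(1)[OF D] by simp
  ultimately show ?thesis using der sub by blast
qed

text \<open>If no nonzero polynomial over \<open>L\<close> kills \<open>a\<close>, then
  \<open>u = 0\<close> serves. Otherwise an annihilator \<open>m\<close> of least degree forces the
  value of \<open>u\<close>, with denominator \<open>poly (pderiv m) a\<close>, nonzero by
  characteristic zero and minimality. Since \<open>L\<close> is only a ring, any other annihilator
  is a multiple of \<open>m\<close> after scaling by a power of the leading coefficient.\<close>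

lemma derivation_extend_exists:
  fixes L :: "'a::field_char_0 set"
  assumes D: "derivation_on L D"
  shows "\<exists>L' D'. derivation_on L' D' \<and> L \<subseteq> L' \<and> a \<in> L' \<and> (\<forall>x\<in>L. D' x = D x)"
proof -
  have L: "subring_set L" by (rule derivation_onD(1)[OF D])
  note cl = polys_over_closed[OF L]
  have "\<exists>u. \<forall>p\<in>polys_over L. poly p a = 0 \<longrightarrow> deriv_at D a u p = 0"
  proof (cases "\<exists>p\<in>polys_over L. p \<noteq> 0 \<and> poly p a = 0")
    case False
    then have "\<forall>p\<in>polys_over L. poly p a = 0 \<longrightarrow> deriv_at D a 0 p = 0"
      by (metis deriv_at_def map_poly_0 mult_zero_right poly_0 add.right_neutral)
    then show ?thesis ..
  next
    case True
    define good where "good p \<longleftrightarrow> p \<in> polys_over L \<and> p \<noteq> 0 \<and> poly p a = 0" for p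
    define m where "m = arg_min degree good"
    obtain p0 where "good p0" using True by (auto simp: good_def)
    then have m: "good m" "\<And>p. good p \<Longrightarrow> degree m \<le> degree p"
      using arg_min_nat_lemma[of good p0 degree] unfolding m_def by blast+
    have mL: "m \<in> polys_over L" "m \<noteq> 0" "poly m a = 0" using m(1) by (auto simp: good_def)
    have degm: "0 < degree m"
    proof (rule ccontr)
      assume "\<not> 0 < degree m"
      then obtain c where "m = [:c:]" using degree_eq_zeroE by auto
      then show False using mL by simp
    qed
    have "pderiv m = formal_deriv m" by (rule poly_eqI) (simp add: coeff_pderiv coeff_formal_deriv)
    then have dm: "pderiv m \<in> polys_over L" using cl(6)[OF mL(1)] by simp
    have "pderiv m \<noteq> 0" using degm by (simp add: pderiv_eq_0_iff)
    moreover have "degree (pderiv m) < degree m" using degm by (simp add: degree_pderiv)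
    ultimately have dma: "poly (pderiv m) a \<noteq> 0" using m(2)[of "pderiv m"] dm unfolding good_def by linarith
    define u where "u = - poly (map_poly D m) a / poly (pderiv m) a"
    have um: "deriv_at D a u m = 0" using dma by (simp add: deriv_at_def u_def)
    have "deriv_at D a u p = 0" if p: "p \<in> polys_over L" "poly p a = 0" for p
    proof -
      obtain r b k where r: "r \<in> polys_over L" "b \<in> polys_over L" "degree r < degree m"
        "smult (lead_coeff m ^ (2 * k)) p = b * m + r"
        using even_pseudo_remainder[OF L mL(1) degm p(1)] by blast
      have "poly (smult (lead_coeff m ^ (2 * k)) p) a = poly (b * m + r) a" by (simp only: r(4))
      then have "poly r a = 0" using p(2) mL(3) by simp
      then have "r = 0" using m(2)[of r] r(1,3) unfolding good_def by (metis not_le)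
      define c where "c = lead_coeff m ^ (2 * k)"
      have c: "c \<in> L" "c \<noteq> 0" unfolding c_def
        using subring_set_closed(6)[OF L lead_coeff_in[OF mL(1)]] mL(2) by auto
      have "deriv_at D a u ([:c:] * p) = deriv_at D a u (b * m)" using r(4) \<open>r = 0\<close> by (simp add: c_def)
      then have "c * deriv_at D a u p = 0"
        using deriv_at_simps(2)[OF D cl(8)[OF c(1)] p(1), of a u] deriv_at_simps(2)[OF D r(2) mL(1), of a u] um mL(3) p(2)
        by (simp del: mult_pCons_left)
      then show ?thesis using c(2) by simp
    qed
    then show ?thesis by blast
  qed
  then obtain u where "\<And>p. p \<in> polys_over L \<Longrightarrow> poly p a = 0 \<Longrightarrow> deriv_at D a u p = 0" by blast
  from derivation_extend[OF D this] show ?thesis by blast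
qed

text \<open>Transcendence leaves \<open>D f\<close> free over \<open>C\<close>, so it is set to
  \<open>1\<close> first; the elements of \<open>S\<close> are then adjoined one by one.\<close>

theorem transcendental_derivation:
  fixes C :: "'a::field_char_0 set"
  assumes C: "subring_set C" and f: "\<And>p. p \<in> polys_over C \<Longrightarrow> poly p f = 0 \<Longrightarrow> p = 0" and "finite S"
  shows "\<exists>L D. derivation_on L D \<and> C \<subseteq> L \<and> S \<subseteq> L \<and> f \<in> L \<and> (\<forall>c\<in>C. D c = 0) \<and> D f = 1"
  using assms(3)
proof induction
  case empty
  have "derivation_on C (\<lambda>_. 0)" using C by (simp add: derivation_on_def)
  moreover have "deriv_at (\<lambda>_. 0) f 1 p = 0" if "p \<in> polys_over C" "poly p f = 0" for p
    using f[OF that] by (simp add: deriv_at_def)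
  ultimately show ?case using derivation_extend[of C "\<lambda>_. 0" f 1] by fastforce
next
  case (insert a S)
  then obtain L D where LD: "derivation_on L D" "C \<subseteq> L" "S \<subseteq> L" "f \<in> L" "\<forall>c\<in>C. D c = 0" "D f = 1" by blast
  obtain L' D' where "derivation_on L' D'" "L \<subseteq> L'" "a \<in> L'" "\<forall>x\<in>L. D' x = D x"
    using derivation_extend_exists[OF LD(1)] by blast
  then show ?case using LD by (intro exI[of _ L'] exI[of _ D']) auto
qed

section \<open>Polynomials in several variables\<close>

lemma sum_over_keys_add:
  fixes p q :: "'k \<Rightarrow>\<^sub>0 real" and F :: "'k \<Rightarrow> real \<Rightarrow> 'b::comm_monoid_add"
  assumes "\<And>t. F t 0 = 0" "\<And>t a b. F t (a + b) = F t a + F t b"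
  shows "(\<Sum>t\<in>Poly_Mapping.keys (p + q). F t (Poly_Mapping.lookup (p + q) t)) =
    (\<Sum>t\<in>Poly_Mapping.keys p. F t (Poly_Mapping.lookup p t)) + (\<Sum>t\<in>Poly_Mapping.keys q. F t (Poly_Mapping.lookup q t))"
  using assms by (rule setsum_keys_plus_distrib)

lemma poly_mapping_add_induct [case_names zero single add]:
  fixes p :: "'k \<Rightarrow>\<^sub>0 'b::comm_monoid_add"
  assumes zero: "P 0" and single: "\<And>t c. P (Poly_Mapping.single t c)"
    and add: "\<And>p q. P p \<Longrightarrow> P q \<Longrightarrow> P (p + q)"
  shows "P p"
proof -
  have "p = (\<Sum>t\<in>Poly_Mapping.keys p. Poly_Mapping.single t (Poly_Mapping.lookup p t))"
    by (rule poly_mapping_eqI) (simp add: lookup_sum lookup_single when_def in_keys_iff)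
  moreover have "P (\<Sum>t\<in>A. Poly_Mapping.single t (Poly_Mapping.lookup p t))" for A
    by (induction A rule: infinite_finite_induct) (auto intro: assms)
  ultimately show ?thesis by metis
qed

lemma const_poly_hom:
  "const_poly (a + b) = const_poly a + const_poly b" "const_poly (a * b) = const_poly a * const_poly b"
  "const_poly 0 = 0" "const_poly 1 = 1"
  by (simp_all add: const_poly_def single_add mult_single)

lemma unital_hom_const_poly: "unital_hom (const_poly :: real \<Rightarrow> 'v rpoly)"
  unfolding unital_hom_def by (simp add: const_poly_hom)

lemma rpoly_induct [case_names const var add mult]:
  fixes p :: "'v rpoly"
  assumes const: "\<And>c. P (const_poly c)" and var: "\<And>i. P (var_poly i)"
    and add: "\<And>p q. P p \<Longrightarrow> P q \<Longrightarrow> P (p + q)" and mult: "\<And>p q. P p \<Longrightarrow> P q \<Longrightarrow> P (p * q)"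
  shows "P p"
proof (induction p rule: poly_mapping_add_induct)
  case zero
  then show ?case using const[of 0] by (simp add: const_poly_hom)
next
  case (single t c)
  have "P (Poly_Mapping.single (Poly_Mapping.single i n) 1)" for i n
  proof (induction n)
    case 0
    then show ?case using const[of 1] by (simp add: const_poly_def)
  next
    case (Suc n)
    have "Poly_Mapping.single (Poly_Mapping.single i (Suc n)) (1::real) =
        var_poly i * Poly_Mapping.single (Poly_Mapping.single i n) 1"
      by (simp add: var_poly_def mult_single flip: single_add)
    then show ?case using mult[OF var Suc] by simp
  qed
  then have "P (Poly_Mapping.single t 1)"
  proof (induction t rule: poly_mapping_add_induct)
    case zero
    then show ?case using const[of 1] by (simp add: const_poly_def)
  next
    case (add s t)
    have "Poly_Mapping.single (s + t) (1::real) = Poly_Mapping.single s 1 * Poly_Mapping.single t 1"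
      by (simp add: mult_single)
    then show ?case using mult add by simp
  qed
  moreover have "Poly_Mapping.single t c = const_poly c * Poly_Mapping.single t 1"
    by (simp add: const_poly_def mult_single)
  ultimately show ?case using mult const by simp
next
  case (add p q)
  then show ?case using assms(3) by simp
qed

text \<open>Reduces multiplicativity of evaluation and of the inclusion to monomials.\<close>

lemma rpoly_mult_hom:
  fixes h :: "'v rpoly \<Rightarrow> 'b::comm_ring_1"
  assumes add: "\<And>p q. h (p + q) = h p + h q"
    and single: "\<And>s t a b. h (Poly_Mapping.single (s + t) (a * b)) = h (Poly_Mapping.single s a) * h (Poly_Mapping.single t b)"
  shows "h (p * q) = h p * h q"
proof -
  have zero: "h 0 = 0" using add[of 0 0] by simp
  show ?thesis
  proof (induction p rule: poly_mapping_add_induct)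
    case (single s a)
    show ?case by (induction q rule: poly_mapping_add_induct) (simp_all add: zero mult_single assms(2) add distrib_left)
  qed (simp_all add: zero add algebra_simps)
qed

lemma eval_poly_single:
  "eval_poly (Poly_Mapping.single t c) x = c * (\<Prod>i\<in>UNIV. (x $ i) ^ Poly_Mapping.lookup t i)"
  by (cases "c = 0") (simp_all add: eval_poly_def)

lemma eval_poly_add: "eval_poly (p + q) x = eval_poly p x + eval_poly q x"
  unfolding eval_poly_def by (rule sum_over_keys_add) (simp_all add: algebra_simps)

lemma unital_hom_eval_poly: "unital_hom (\<lambda>p. eval_poly p x)"
  unfolding unital_hom_def
proof (intro conjI allI)
  show "eval_poly 1 x = 1" using eval_poly_single[of 0 1 x] by simp
  show "eval_poly (p * q) x = eval_poly p x * eval_poly q x" for p q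
    by (rule rpoly_mult_hom[OF eval_poly_add])
      (simp add: eval_poly_single lookup_add power_add prod.distrib algebra_simps)
qed (rule eval_poly_add)

lemmas eval_poly_simps = unital_hom_simps[OF unital_hom_eval_poly]

lemma eval_const_poly [simp]: "eval_poly (const_poly c) x = c"
  by (simp add: const_poly_def eval_poly_single)

lemma eval_var_poly [simp]: "eval_poly (var_poly i) x = x $ i"
proof -
  have "(\<Prod>j\<in>UNIV. (x $ j) ^ (if i = j then Suc 0 else 0)) = (\<Prod>j\<in>UNIV. if i = j then x $ j else 1)"
    by (rule prod.cong) auto
  then show ?thesis by (simp add: var_poly_def eval_poly_single lookup_single when_def)
qed

lemma lookup_lift_exp:
  "Poly_Mapping.lookup (lift_exp t) k = (case k of Inl i \<Rightarrow> Poly_Mapping.lookup t i | Inr _ \<Rightarrow> 0)"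
  unfolding lift_exp_def
  by (cases k) (auto simp: lookup_sum lookup_single when_def in_keys_iff intro: sum.neutral)

lemma lift_exp_0 [simp]: "lift_exp 0 = 0"
  by (simp add: lift_exp_def)

lemma lift_exp_add: "lift_exp (s + t) = lift_exp s + lift_exp t"
  by (rule poly_mapping_eqI) (simp add: lookup_add lookup_lift_exp split: sum.splits)

lemma lift_poly_single: "lift_poly (Poly_Mapping.single t c) = Poly_Mapping.single (lift_exp t) c"
  by (cases "c = 0") (simp_all add: lift_poly_def)

lemma lift_poly_add: "lift_poly (p + q) = lift_poly p + lift_poly q"
  unfolding lift_poly_def by (rule sum_over_keys_add) (simp_all add: single_add)

lemma unital_hom_lift_poly: "unital_hom (lift_poly :: 'n rpoly \<Rightarrow> ('n + 'm option) rpoly)"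
  unfolding unital_hom_def
proof (intro conjI allI)
  show "lift_poly 1 = (1 :: ('n + 'm option) rpoly)" using lift_poly_single[of 0 1] by simp
  show "lift_poly (p * q) = lift_poly p * (lift_poly q :: ('n + 'm option) rpoly)" for p q :: "'n rpoly"
    by (rule rpoly_mult_hom[OF lift_poly_add]) (simp add: lift_poly_single lift_exp_add mult_single)
qed (rule lift_poly_add)

lemmas lift_poly_simps = unital_hom_simps[OF unital_hom_lift_poly]

lemma lift_const_poly [simp]: "lift_poly (const_poly c) = const_poly c"
  by (simp add: const_poly_def lift_poly_single)

lemma lift_exp_single: "lift_exp (Poly_Mapping.single i n) = Poly_Mapping.single (Inl i) n"
  by (rule poly_mapping_eqI) (auto simp: lookup_lift_exp lookup_single when_def split: sum.splits)

lemma lift_var_poly [simp]: "lift_poly (var_poly i) = var_poly (Inl i)"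
  by (simp add: var_poly_def lift_poly_single lift_exp_single)

lemma eval_lift_poly: "eval_poly (lift_poly p) z = eval_poly p (\<chi> i. z $ Inl i)"
  by (induction p rule: rpoly_induct) (simp_all add: eval_poly_simps lift_poly_simps)

lemma partial_deriv_single:
  "partial_deriv i (Poly_Mapping.single t c) =
     Poly_Mapping.single (t - Poly_Mapping.single i 1) (of_nat (Poly_Mapping.lookup t i) * c)"
  by (cases "c = 0") (simp_all add: partial_deriv_def)

lemma partial_deriv_add: "partial_deriv i (p + q) = partial_deriv i p + partial_deriv i q"
  unfolding partial_deriv_def by (rule sum_over_keys_add) (simp_all add: distrib_left single_add)

lemma partial_deriv_0: "partial_deriv i 0 = 0"
  using partial_deriv_add[of i 0 0] by simp

lemma partial_deriv_const: "partial_deriv i (const_poly c) = 0"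
  by (simp add: const_poly_def partial_deriv_single)

lemma partial_deriv_var: "partial_deriv i (var_poly j) = (if i = j then 1 else 0)"
  by (simp add: var_poly_def partial_deriv_single lookup_single when_def)

text \<open>Truncated subtraction of an exponent commutes with adding another one only if the
  variable occurs; if it does not occur, the coefficient of the term is zero.\<close>

lemma partial_deriv_mult_single:
  fixes s t :: "'v \<Rightarrow>\<^sub>0 nat"
  shows "partial_deriv i (Poly_Mapping.single s a * Poly_Mapping.single t b) =
    partial_deriv i (Poly_Mapping.single s a) * Poly_Mapping.single t b
    + Poly_Mapping.single s a * partial_deriv i (Poly_Mapping.single t b)"
proof -
  let ?e = "Poly_Mapping.single i (1::nat)"
  have shift: "s - ?e + t = s + t - ?e" if "Poly_Mapping.lookup s i \<noteq> 0" for s t :: "'v \<Rightarrow>\<^sub>0 nat"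
    using that by (intro poly_mapping_eqI) (auto simp: lookup_add lookup_minus lookup_single when_def)
  have "Poly_Mapping.single (s - ?e + t) (real (Poly_Mapping.lookup s i) * a * b) =
      Poly_Mapping.single (s + t - ?e) (real (Poly_Mapping.lookup s i) * a * b)"
    using shift[of s t] by (cases "Poly_Mapping.lookup s i = 0") auto
  moreover have "Poly_Mapping.single (s + (t - ?e)) (a * (real (Poly_Mapping.lookup t i) * b)) =
      Poly_Mapping.single (s + t - ?e) (a * (real (Poly_Mapping.lookup t i) * b))"
    using shift[of t s] by (cases "Poly_Mapping.lookup t i = 0") (auto simp: add.commute)
  ultimately show ?thesis
    by (simp add: mult_single partial_deriv_single lookup_add algebra_simps flip: single_add)
qed

lemma partial_deriv_mult:
  "partial_deriv i (p * q) = partial_deriv i p * q + p * partial_deriv i q"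
proof (induction p rule: poly_mapping_add_induct)
  case (single s a)
  show ?case
    by (induction q rule: poly_mapping_add_induct)
      (simp_all add: partial_deriv_0 partial_deriv_mult_single partial_deriv_add algebra_simps)
qed (simp_all add: partial_deriv_0 partial_deriv_add algebra_simps)

lemma partial_deriv_lift_poly:
  "partial_deriv (Inl i) (lift_poly p) = lift_poly (partial_deriv i p)"
  "partial_deriv (Inr k) (lift_poly p) = 0"
  by (induction p rule: rpoly_induct)
    (auto simp: partial_deriv_const partial_deriv_var partial_deriv_add partial_deriv_mult lift_poly_simps partial_deriv_0)

section \<open>Subrings generated by the constants and some of the variables\<close>

inductive_set polys_in :: "'v set \<Rightarrow> 'v rpoly set" for S where
  const: "const_poly c \<in> polys_in S"
| var: "i \<in> S \<Longrightarrow> var_poly i \<in> polys_in S"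
| add: "p \<in> polys_in S \<Longrightarrow> q \<in> polys_in S \<Longrightarrow> p + q \<in> polys_in S"
| mult: "p \<in> polys_in S \<Longrightarrow> q \<in> polys_in S \<Longrightarrow> p * q \<in> polys_in S"

lemma polys_in_UNIV: "p \<in> polys_in UNIV"
  by (induction p rule: rpoly_induct) (auto intro: polys_in.intros)

lemma subring_set_polys_in: "subring_set (polys_in S)"
  unfolding subring_set_def
proof (intro conjI ballI)
  show "0 \<in> polys_in S" "1 \<in> polys_in S" using polys_in.const[of 0 S] polys_in.const[of 1 S]
    by (simp_all add: const_poly_hom)
  fix p q assume *: "p \<in> polys_in S" "q \<in> polys_in S"
  show "p + q \<in> polys_in S" "p * q \<in> polys_in S" using * polys_in.intros by blast+
  have "- q = const_poly (- 1) * q" by (simp add: unital_hom_simps[OF unital_hom_const_poly])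
  then have "- q \<in> polys_in S" using * polys_in.mult[OF polys_in.const] by simp
  then show "p - q \<in> polys_in S" using polys_in.add[OF *(1)] by fastforce
qed

lemma polys_in_insert_as_poly:
  assumes "p \<in> polys_in (insert i S)"
  shows "\<exists>P \<in> polys_over (polys_in S). poly P (var_poly i) = p"
  using assms
proof induction
  note cl = polys_over_closed[OF subring_set_polys_in]
  note rc = subring_set_closed(1,2)[OF subring_set_polys_in]
  {
    case (const c)
    show ?case by (intro bexI[of _ "[:const_poly c:]"] cl polys_in.const) simp
  next
    case (var j)
    show ?case
    proof (cases "j = i")
      case True
      then show ?thesis by (intro bexI[of _ "[:0, 1:]"] cl rc) simp
    next
      case False
      then show ?thesis using var by (intro bexI[of _ "[:var_poly j:]"] cl polys_in.var) auto
    qed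
  next
    case (add p q)
    then show ?case using cl(1) by (metis poly_add)
  next
    case (mult p q)
    then show ?case using cl(3) by (metis poly_mult)
  }
qed

lemma eval_polys_in_cong:
  assumes "p \<in> polys_in S" "\<And>i. i \<in> S \<Longrightarrow> x $ i = y $ i"
  shows "eval_poly p x = eval_poly p y"
  using assms(1) by induction (auto simp: assms(2) eval_poly_simps)

lemma hom_poly:
  assumes "unital_hom h"
  shows "h (poly P a) = poly (map_poly h P) (h a)"
  by (induction P) (auto simp: map_poly_pCons unital_hom_simps[OF assms])

section \<open>Prime cones\<close>

definition ring_preorder :: "'a::comm_ring_1 set \<Rightarrow> bool" where
  "ring_preorder T \<longleftrightarrow> (\<forall>a\<in>T. \<forall>b\<in>T. a + b \<in> T \<and> a * b \<in> T) \<and> (\<forall>a. a ^ 2 \<in> T)"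

definition support :: "'a::comm_ring_1 set \<Rightarrow> 'a set" where
  "support T = {a. a \<in> T \<and> - a \<in> T}"

text \<open>A point of the real spectrum: \<open>support Q\<close> is a prime ideal, and
  \<open>Q\<close> induces a total order on the quotient by it.\<close>

definition prime_cone :: "'a::comm_ring_1 set \<Rightarrow> bool" where
  "prime_cone Q \<longleftrightarrow> ring_preorder Q \<and> - 1 \<notin> Q \<and> (\<forall>a. a \<in> Q \<or> - a \<in> Q) \<and>
     (\<forall>a b. a * b \<in> support Q \<longrightarrow> a \<in> support Q \<or> b \<in> support Q)"

lemma ring_preorderD:
  assumes "ring_preorder T"
  shows "a \<in> T \<Longrightarrow> b \<in> T \<Longrightarrow> a + b \<in> T" "a \<in> T \<Longrightarrow> b \<in> T \<Longrightarrow> a * b \<in> T" "a ^ 2 \<in> T" "0 \<in> T" "1 \<in> T"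
proof -
  show *: "a \<in> T \<Longrightarrow> b \<in> T \<Longrightarrow> a + b \<in> T" "a \<in> T \<Longrightarrow> b \<in> T \<Longrightarrow> a * b \<in> T" "a ^ 2 \<in> T" for a b
    using assms by (auto simp: ring_preorder_def)
  show "0 \<in> T" "1 \<in> T" using *(3)[of 0] *(3)[of 1] by simp_all
qed

lemma ring_preorder_adjoin:
  assumes T: "ring_preorder T"
  shows "ring_preorder {s + a * t | s t. s \<in> T \<and> t \<in> T}"
  unfolding ring_preorder_def
proof (intro conjI ballI allI)
  note cl = ring_preorderD[OF T]
  let ?U = "{s + a * t | s t. s \<in> T \<and> t \<in> T}"
  have I: "s + a * t \<in> ?U" if "s \<in> T" "t \<in> T" for s t using that by blast
  show "b ^ 2 \<in> ?U" for b using I[OF cl(3)[of b] cl(4)] by simp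
  fix u v assume "u \<in> ?U" "v \<in> ?U"
  then obtain s t s' t' where *: "u = s + a * t" "s \<in> T" "t \<in> T" and **: "v = s' + a * t'" "s' \<in> T" "t' \<in> T" by auto
  have "u + v = (s + s') + a * (t + t')" unfolding * ** by (simp add: algebra_simps)
  also have "\<dots> \<in> ?U" by (rule I) (intro cl(1) * **)+
  finally show "u + v \<in> ?U" .
  have "u * v = (s * s' + a ^ 2 * (t * t')) + a * (s * t' + t * s')"
    unfolding * ** by (simp add: algebra_simps power2_eq_square)
  also have "\<dots> \<in> ?U" by (rule I) (intro cl(1-3) * **)+
  finally show "u * v \<in> ?U" .
qed

lemma subset_Zorn_extension:
  assumes "P T" and chain: "\<And>C. C \<noteq> {} \<Longrightarrow> subset.chain {S. T \<subseteq> S \<and> P S} C \<Longrightarrow> P (\<Union>C)"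
  shows "\<exists>M. T \<subseteq> M \<and> P M \<and> (\<forall>N. M \<subseteq> N \<longrightarrow> P N \<longrightarrow> N = M)"
proof -
  define A where "A = {S. T \<subseteq> S \<and> P S}"
  have "\<exists>M\<in>A. \<forall>N\<in>A. M \<subseteq> N \<longrightarrow> N = M"
  proof (rule subset_Zorn_nonempty)
    show "A \<noteq> {}" using assms(1) by (auto simp: A_def)
    fix C assume C: "C \<noteq> {}" "subset.chain A C"
    then obtain S where "S \<in> C" "S \<in> A" by (auto simp: subset.chain_def)
    then have "T \<subseteq> \<Union>C" by (auto simp: A_def)
    then show "\<Union>C \<in> A" using chain[OF C(1)] C(2) by (auto simp: A_def)
  qed
  then obtain M where "M \<in> A" "\<forall>N\<in>A. M \<subseteq> N \<longrightarrow> N = M" by blast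
  then show ?thesis by (intro exI[of _ M]) (auto simp: A_def)
qed

lemma chain_two:
  assumes "subset.chain A C" "a \<in> \<Union>C" "b \<in> \<Union>C"
  shows "\<exists>S\<in>C. a \<in> S \<and> b \<in> S"
proof -
  obtain S1 S2 where S: "S1 \<in> C" "a \<in> S1" "S2 \<in> C" "b \<in> S2" using assms(2,3) by blast
  have "S1 \<subseteq> S2 \<or> S2 \<subseteq> S1" using assms(1) S(1,3) by (auto simp: subset.chain_def)
  then show ?thesis using S by blast
qed

text \<open>For \<open>Q\<close> maximal among the preorderings that avoid every \<open>- m\<close>,
  adjoining an \<open>a\<close> outside \<open>Q\<close> yields a relation
  \<open>s + a * t = - m\<close>. Multiplying two such relations, for \<open>a\<close> and
  \<open>- a\<close> or for two factors of a product, puts \<open>- (m * m')\<close> into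
  \<open>Q\<close>; hence \<open>M\<close> is multiplicative. The choice \<open>M = {1}\<close>
  gives plain existence, a larger \<open>M\<close> keeps its elements out of the support.\<close>

lemma exists_prime_cone:
  fixes T :: "'a::comm_ring_1 set"
  assumes T: "ring_preorder T" and M: "1 \<in> M" "M \<subseteq> T" "\<And>a b. a \<in> M \<Longrightarrow> b \<in> M \<Longrightarrow> a * b \<in> M"
    and disj: "\<And>m. m \<in> M \<Longrightarrow> - m \<notin> T"
  shows "\<exists>Q. prime_cone Q \<and> T \<subseteq> Q \<and> (\<forall>m\<in>M. - m \<notin> Q)"
proof -
  define P where "P S \<longleftrightarrow> ring_preorder S \<and> (\<forall>m\<in>M. - m \<notin> S)" for S
  have "\<exists>Q. T \<subseteq> Q \<and> P Q \<and> (\<forall>N. Q \<subseteq> N \<longrightarrow> P N \<longrightarrow> N = Q)"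
  proof (rule subset_Zorn_extension)
    show "P T" using T disj by (simp add: P_def)
    fix C assume C: "C \<noteq> {}" "subset.chain {S. T \<subseteq> S \<and> P S} C"
    then have pre: "ring_preorder S" "\<forall>m\<in>M. - m \<notin> S" if "S \<in> C" for S
      using that by (auto simp: subset.chain_def P_def)
    have "ring_preorder (\<Union>C)" unfolding ring_preorder_def
    proof (intro conjI ballI allI)
      fix a b assume "a \<in> \<Union>C" "b \<in> \<Union>C"
      then obtain S where S: "S \<in> C" "a \<in> S" "b \<in> S" using chain_two[OF C(2)] by blast
      then show "a + b \<in> \<Union>C" "a * b \<in> \<Union>C" using ring_preorderD(1,2)[OF pre(1)[OF S(1)] S(2,3)] by blast+
    next
      fix a :: 'a
      obtain S where "S \<in> C" using C(1) by blast
      then show "a ^ 2 \<in> \<Union>C" using ring_preorderD(3)[OF pre(1)] by blast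
    qed
    then show "P (\<Union>C)" using pre(2) by (auto simp: P_def)
  qed
  then obtain Q where Q: "T \<subseteq> Q" "P Q" "\<And>N. Q \<subseteq> N \<Longrightarrow> P N \<Longrightarrow> N = Q" by blast
  have pre: "ring_preorder Q" and disjQ: "\<And>m. m \<in> M \<Longrightarrow> - m \<notin> Q" using Q(2) by (auto simp: P_def)
  note cl = ring_preorderD[OF pre]
  have MQ: "m \<in> Q" if "m \<in> M" for m using that M(2) Q(1) by blast
  have max: "\<exists>m\<in>M. \<exists>s\<in>Q. \<exists>t\<in>Q. s + a * t = - m" if a: "a \<notin> Q" for a
  proof (rule ccontr)
    assume neg: "\<not> ?thesis"
    define U where "U = {s + a * t | s t. s \<in> Q \<and> t \<in> Q}"
    have "- m \<notin> U" if m: "m \<in> M" for m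
    proof
      assume "- m \<in> U"
      then obtain s t where "- m = s + a * t" "s \<in> Q" "t \<in> Q" unfolding U_def by blast
      then show False using neg m by metis
    qed
    then have "P U" unfolding P_def using ring_preorder_adjoin[OF pre] by (simp add: U_def)
    moreover have "Q \<subseteq> U"
    proof
      fix s assume "s \<in> Q"
      then have "s + a * 0 \<in> U" unfolding U_def using cl(4) by blast
      then show "s \<in> U" by simp
    qed
    ultimately have "U = Q" using Q(3) by blast
    moreover have "0 + a * 1 \<in> U" unfolding U_def using cl(4,5) by blast
    ultimately show False using a by simp
  qed
  have total: "a \<in> Q \<or> - a \<in> Q" for a
  proof (rule ccontr)
    assume "\<not> ?thesis"
    then have na: "a \<notin> Q" "- a \<notin> Q" by auto
    obtain m s t where 1: "m \<in> M" "s \<in> Q" "t \<in> Q" "s + a * t = - m" using max[OF na(1)] by blast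
    obtain m' s' t' where 2: "m' \<in> M" "s' \<in> Q" "t' \<in> Q" "s' + (- a) * t' = - m'" using max[OF na(2)] by blast
    have e: "a * t = - (m + s)" "a * t' = m' + s'" using 1(4) 2(4) by (simp_all add: algebra_simps eq_neg_iff_add_eq_0)
    have "a ^ 2 * (t * t') = (a * t) * (a * t')" by (simp add: power2_eq_square algebra_simps)
    also have "\<dots> = - (m * m') - (m * s' + s * m' + s * s')" unfolding e by (simp add: algebra_simps)
    finally have "- (m * m') = a ^ 2 * (t * t') + (m * s' + s * m' + s * s')" by simp
    moreover have "a ^ 2 * (t * t') + (m * s' + s * m' + s * s') \<in> Q"
      by (intro cl(1-3) 1 2 MQ)
    ultimately show False using disjQ[OF M(3)[OF 1(1) 2(1)]] by simp
  qed
  have m1: "- 1 \<notin> Q" using disjQ[OF M(1)] .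
  have supp_prime: "a \<in> support Q \<or> b \<in> support Q" if ab: "a * b \<in> support Q" for a b
  proof (rule ccontr)
    assume neg: "\<not> (a \<in> support Q \<or> b \<in> support Q)"
    \<comment> \<open>Outside the support, one of \<open>a\<close> and \<open>- a\<close> is missing
      from \<open>Q\<close>, and membership of the product in the support is insensitive to the
      sign.\<close>
    obtain a' where a': "a' = a \<or> a' = - a" "a' \<notin> Q" using neg unfolding support_def by blast
    obtain b' where b': "b' = b \<or> b' = - b" "b' \<notin> Q" using neg unfolding support_def by blast
    have ab': "- (a' * b') \<in> Q" using a' b' ab unfolding support_def by auto
    obtain m s t where 1: "m \<in> M" "s \<in> Q" "t \<in> Q" "s + a' * t = - m" using max[OF a'(2)] by blast
    obtain m' s' t' where 2: "m' \<in> M" "s' \<in> Q" "t' \<in> Q" "s' + b' * t' = - m'" using max[OF b'(2)] by blast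
    have e: "a' * t = - (m + s)" "b' * t' = - (m' + s')" using 1(4) 2(4) by (simp_all add: algebra_simps eq_neg_iff_add_eq_0)
    have "(a' * b') * (t * t') = (a' * t) * (b' * t')" by (simp add: algebra_simps)
    also have "\<dots> = m * m' + (m * s' + s * m' + s * s')" unfolding e by (simp add: algebra_simps)
    finally have "- (m * m') = - (a' * b') * (t * t') + (m * s' + s * m' + s * s')" by simp
    moreover have "- (a' * b') * (t * t') + (m * s' + s * m' + s * s') \<in> Q"
      by (intro cl(1,2) 1 2 MQ ab')
    ultimately show False using disjQ[OF M(3)[OF 1(1) 2(1)]] by simp
  qed
  have "prime_cone Q" unfolding prime_cone_def by (intro conjI allI impI pre m1 total supp_prime)
  then show ?thesis using Q(1) disjQ by (intro exI[of _ Q] conjI ballI)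
qed

lemma prime_coneD:
  assumes "prime_cone Q"
  shows "a \<in> Q \<Longrightarrow> b \<in> Q \<Longrightarrow> a + b \<in> Q" "a \<in> Q \<Longrightarrow> b \<in> Q \<Longrightarrow> a * b \<in> Q" "a ^ 2 \<in> Q" "0 \<in> Q" "1 \<in> Q"
    "- 1 \<notin> Q" "a \<in> Q \<or> - a \<in> Q" "a * b \<in> support Q \<Longrightarrow> a \<in> support Q \<or> b \<in> support Q"
proof -
  have pre: "ring_preorder Q" using assms by (simp add: prime_cone_def)
  note cl = ring_preorderD[OF pre]
  show "a \<in> Q \<Longrightarrow> b \<in> Q \<Longrightarrow> a + b \<in> Q" "a \<in> Q \<Longrightarrow> b \<in> Q \<Longrightarrow> a * b \<in> Q" "a ^ 2 \<in> Q" "0 \<in> Q" "1 \<in> Q"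
    by (fact cl)+
  show "- 1 \<notin> Q" "a \<in> Q \<or> - a \<in> Q" "a * b \<in> support Q \<Longrightarrow> a \<in> support Q \<or> b \<in> support Q"
    using assms by (simp_all add: prime_cone_def)
qed

lemma support_ideal:
  assumes Q: "prime_cone Q"
  shows "a \<in> support Q \<Longrightarrow> b \<in> support Q \<Longrightarrow> a + b \<in> support Q" "a \<in> support Q \<Longrightarrow> a * b \<in> support Q"
    "a \<in> support Q \<Longrightarrow> - a \<in> support Q" "0 \<in> support Q" "1 \<notin> support Q"
proof -
  note cl = prime_coneD[OF Q]
  show "a \<in> support Q \<Longrightarrow> b \<in> support Q \<Longrightarrow> a + b \<in> support Q"
    using cl(1)[of a b] cl(1)[of "- a" "- b"] by (simp add: support_def algebra_simps)
  show "a * b \<in> support Q" if a: "a \<in> support Q"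
  proof (cases "b \<in> Q")
    case True
    then show ?thesis using a cl(2)[of a b] cl(2)[of "- a" b] by (simp add: support_def)
  next
    case False
    then have "- b \<in> Q" using cl(7) by blast
    then show ?thesis using a cl(2)[of a "- b"] cl(2)[of "- a" "- b"] by (simp add: support_def)
  qed
  show "a \<in> support Q \<Longrightarrow> - a \<in> support Q" "0 \<in> support Q" "1 \<notin> support Q"
    using cl(4,6) by (auto simp: support_def)
qed

section \<open>Archimedean quadratic modules\<close>

text \<open>Covers quadratic modules and preorderings, so that both claims of the theorem share the
  gluing of level sets.\<close>

definition quadratic_cone :: "'a::comm_ring_1 set \<Rightarrow> bool" where
  "quadratic_cone M \<longleftrightarrow> 1 \<in> M \<and> (\<forall>a\<in>M. \<forall>b\<in>M. a + b \<in> M) \<and> (\<forall>a\<in>M. \<forall>b. b ^ 2 * a \<in> M)"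

lemma quadratic_coneD:
  assumes "quadratic_cone M"
  shows "1 \<in> M" "a \<in> M \<Longrightarrow> b \<in> M \<Longrightarrow> a + b \<in> M" "a \<in> M \<Longrightarrow> b ^ 2 * a \<in> M" "b ^ 2 \<in> M" "0 \<in> M"
proof -
  show *: "1 \<in> M" "a \<in> M \<Longrightarrow> b \<in> M \<Longrightarrow> a + b \<in> M" "a \<in> M \<Longrightarrow> b ^ 2 * a \<in> M" for a b
    using assms by (auto simp: quadratic_cone_def)
  show "b ^ 2 \<in> M" for b using *(3)[OF *(1), of b] by simp
  from this[of 0] show "0 \<in> M" by simp
qed

lemma const_poly_square: "0 \<le> s \<Longrightarrow> const_poly s = const_poly (sqrt s) ^ 2"
  by (simp add: power2_eq_square flip: const_poly_hom(1,2))

lemma quadratic_cone_scale: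
  assumes "quadratic_cone M" "a \<in> M" "0 \<le> s"
  shows "const_poly s * a \<in> M"
  using quadratic_coneD(3)[OF assms(1,2)] const_poly_square[OF assms(3)] by metis

lemma quadratic_cone_const: "quadratic_cone M \<Longrightarrow> 0 \<le> s \<Longrightarrow> const_poly s \<in> M"
  using quadratic_cone_scale[of M 1 s] quadratic_coneD(1)[of M] by simp

lemma const_poly_neg: "const_poly (- s) = - const_poly s" "const_poly (s - t) = const_poly s - const_poly t"
  by (simp_all add: unital_hom_simps[OF unital_hom_const_poly])

lemma const_poly_cancel: "s \<noteq> 0 \<Longrightarrow> const_poly (1 / s) * (const_poly s * a) = a"
  by (simp add: mult.assoc[symmetric] const_poly_hom flip: const_poly_hom(2))

text \<open>From \<open>2N (N\<^sup>2 - a\<^sup>2) = (N - a)\<^sup>2 (N + a) + (N + a)\<^sup>2 (N - a)\<close>.\<close>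

lemma quadratic_cone_square_bound:
  fixes M :: "'v rpoly set"
  assumes M: "quadratic_cone M" and N: "0 < N" "const_poly N - a \<in> M" "const_poly N + a \<in> M"
  shows "const_poly (N ^ 2) - a ^ 2 \<in> M"
proof -
  let ?c = "const_poly N :: 'v rpoly"
  have "(?c - a) ^ 2 * (?c + a) + (?c + a) ^ 2 * (?c - a) \<in> M"
    by (intro quadratic_coneD[OF M] N)
  also have "(?c - a) ^ 2 * (?c + a) + (?c + a) ^ 2 * (?c - a) = (?c + ?c) * (?c ^ 2 - a ^ 2)"
    by (simp add: power2_eq_square algebra_simps)
  also have "?c + ?c = const_poly (2 * N)" by (simp flip: const_poly_hom(1,2))
  finally have "const_poly (1 / (2 * N)) * (const_poly (2 * N) * (?c ^ 2 - a ^ 2)) \<in> M"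
    by (rule quadratic_cone_scale[OF M]) (use N in simp)
  then have "?c ^ 2 - a ^ 2 \<in> M" using N(1) by (subst (asm) const_poly_cancel) auto
  then show ?thesis by (simp add: power2_eq_square const_poly_hom)
qed

text \<open>The bounded elements form a ring containing the constants, so the bound on the variables
  is enough. For products, \<open>N + K\<close> bounds \<open>p + e q\<close>, hence
  \<open>(N + K)^2\<close> bounds its square, and \<open>(p + e q)^2 - (p - e q)^2 = 4 e p q\<close>
  for \<open>e = 1\<close> and \<open>e = - 1\<close> bounds the product from both sides.\<close>

lemma quadratic_cone_bounded:
  fixes M :: "'v::finite rpoly set"
  assumes M: "quadratic_cone M" and R: "const_poly R - (\<Sum>i\<in>UNIV. var_poly i ^ 2) \<in> M"
  shows "\<exists>N>0. const_poly N - p \<in> M \<and> const_poly N + p \<in> M"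
proof (induction p rule: rpoly_induct)
  note cl = quadratic_coneD[OF M]
  {
    case (const c)
    have "const_poly (\<bar>c\<bar> + 1 - c) \<in> M" "const_poly (\<bar>c\<bar> + 1 + c) \<in> M"
      by (rule quadratic_cone_const[OF M]; simp)+
    then show ?case by (intro exI[of _ "\<bar>c\<bar> + 1"]) (simp add: const_poly_hom const_poly_neg algebra_simps)
  next
    case (var i)
    have sq: "(\<Sum>j\<in>A. var_poly j ^ 2) \<in> M" for A :: "'v set"
      by (induction A rule: infinite_finite_induct) (auto intro: cl)
    have "const_poly R - (\<Sum>j\<in>UNIV. var_poly j ^ 2) + (\<Sum>j\<in>UNIV - {i}. var_poly j ^ 2) \<in> M"
      by (intro cl R sq)
    moreover have "(\<Sum>j\<in>UNIV. var_poly j ^ 2) = var_poly i ^ 2 + (\<Sum>j\<in>UNIV - {i}. var_poly j ^ 2 :: 'v rpoly)"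
      by (rule sum.remove) auto
    ultimately have Ri: "const_poly R - var_poly i ^ 2 \<in> M" by simp
    define h :: "'v rpoly" where "h = const_poly (1 / 2)"
    have h: "h + h = (1 :: 'v rpoly)" "h * h = const_poly (1 / 4)"
      unfolding h_def const_poly_hom(1,2)[symmetric] by (simp_all add: const_poly_hom(4))
    \<comment> \<open>Completing the square, \<open>R - x^2 + (x + e/2)^2 = R + 1/4 + e x\<close>,
      turns the bound on \<open>x^2\<close> into one on \<open>x\<close>.\<close>
    have pm: "const_poly (R + 1 / 4) + e * var_poly i \<in> M" if e: "e = 1 \<or> e = - 1" for e :: "'v rpoly"
    proof -
      have "const_poly R - var_poly i ^ 2 + (var_poly i + e * h) ^ 2 \<in> M" by (intro cl Ri)
      also have "(var_poly i + e * h) ^ 2 = var_poly i ^ 2 + e * var_poly i * (h + h) + (e * e) * (h * h)"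
        by (simp add: power2_eq_square algebra_simps)
      also have "const_poly R - var_poly i ^ 2 + (var_poly i ^ 2 + e * var_poly i * (h + h) + (e * e) * (h * h))
          = const_poly (R + 1 / 4) + e * var_poly i"
        using e by (auto simp: h const_poly_hom)
      finally show ?thesis .
    qed
    \<comment> \<open>The sign of \<open>R\<close> is not given; adding \<open>\<bar>R\<bar>\<close>
      makes the bound positive.\<close>
    have "const_poly (R + 1 / 4) + e * var_poly i + const_poly \<bar>R\<bar> \<in> M" if "e = 1 \<or> e = - 1" for e :: "'v rpoly"
      by (intro cl pm that quadratic_cone_const[OF M]) simp
    from this[of 1] this[of "- 1"]
    have "const_poly (R + 1 / 4 + \<bar>R\<bar>) - var_poly i \<in> M" "const_poly (R + 1 / 4 + \<bar>R\<bar>) + var_poly i \<in> M"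
      by (simp_all add: const_poly_hom algebra_simps)
    then show ?case by (intro exI[of _ "R + 1 / 4 + \<bar>R\<bar>"]) auto
  next
    case (add p q)
    then obtain N K where *: "N > 0" "const_poly N - p \<in> M" "const_poly N + p \<in> M"
      "K > 0" "const_poly K - q \<in> M" "const_poly K + q \<in> M" by blast
    have "const_poly N - p + (const_poly K - q) \<in> M" "const_poly N + p + (const_poly K + q) \<in> M"
      by (intro cl *)+
    then show ?case using * by (intro exI[of _ "N + K"]) (simp add: const_poly_hom algebra_simps)
  next
    case (mult p q)
    then obtain N K where *: "N > 0" "const_poly N - p \<in> M" "const_poly N + p \<in> M"
      "K > 0" "const_poly K - q \<in> M" "const_poly K + q \<in> M" by blast
    have pq: "const_poly ((N + K) ^ 2) - (p + e * q) ^ 2 \<in> M" if e: "e = 1 \<or> e = - 1" for e :: "'v rpoly"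
    proof (rule quadratic_cone_square_bound[OF M])
      have "const_poly N - p + (const_poly K - e * q) \<in> M" "const_poly N + p + (const_poly K + e * q) \<in> M"
        using e * by (auto intro: cl)
      then show "const_poly (N + K) - (p + e * q) \<in> M" "const_poly (N + K) + (p + e * q) \<in> M"
        by (simp_all add: const_poly_hom algebra_simps)
    qed (use * in simp)
    have c4: "const_poly 4 = (4 :: 'v rpoly)"
      using unital_hom_simps(8)[OF unital_hom_const_poly, of 4] by simp
    define C :: "'v rpoly" where "C = const_poly ((N + K) ^ 2 / 4)"
    have "const_poly 4 * C = const_poly ((N + K) ^ 2)" unfolding C_def const_poly_hom(2)[symmetric] by simp
    then have C4: "const_poly ((N + K) ^ 2) = 4 * C" by (simp add: c4)
    have Ce: "C - e * (p * q) \<in> M" if e: "e = 1 \<or> e = - 1" for e :: "'v rpoly"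
    proof -
      have "const_poly (1 / 4) * ((const_poly ((N + K) ^ 2) - (p + e * q) ^ 2) + (p - e * q) ^ 2) \<in> M"
        by (intro quadratic_cone_scale[OF M] cl pq e) simp
      also have "(const_poly ((N + K) ^ 2) - (p + e * q) ^ 2) + (p - e * q) ^ 2 = const_poly 4 * (C - e * (p * q))"
        unfolding C4 c4 by (simp add: power2_eq_square algebra_simps)
      finally show ?thesis using const_poly_cancel[of 4 "C - e * (p * q)"] by simp
    qed
    have "C - p * q \<in> M" "C + p * q \<in> M" using Ce[of 1] Ce[of "- 1"] by simp_all
    then show ?case using * unfolding C_def by (intro exI[of _ "(N + K) ^ 2 / 4"]) auto
  }
qed

text \<open>A quadratic cone is not closed under products, so the relations obtained from maximality
  cannot simply be multiplied as for preorderings. They carry sums of squares as coefficients, and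
  cross-multiplying by these places one of them in the support, which is an ideal.\<close>

lemma exists_maximal_quadratic_cone:
  fixes M :: "'v rpoly set"
  assumes M: "quadratic_cone M" "- 1 \<notin> M"
  shows "\<exists>N. M \<subseteq> N \<and> quadratic_cone N \<and> - 1 \<notin> N \<and> (\<forall>a. a \<in> N \<or> - a \<in> N)"
proof -
  define P where "P S \<longleftrightarrow> quadratic_cone S \<and> - 1 \<notin> S" for S :: "'v rpoly set"
  have "\<exists>N. M \<subseteq> N \<and> P N \<and> (\<forall>S. N \<subseteq> S \<longrightarrow> P S \<longrightarrow> S = N)"
  proof (rule subset_Zorn_extension)
    show "P M" using M by (simp add: P_def)
    fix C assume C: "C \<noteq> {}" "subset.chain {S. M \<subseteq> S \<and> P S} C"
    then have q: "quadratic_cone S" "- 1 \<notin> S" if "S \<in> C" for S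
      using that by (auto simp: subset.chain_def P_def)
    have "quadratic_cone (\<Union>C)" unfolding quadratic_cone_def
    proof (intro conjI ballI allI)
      show "1 \<in> \<Union>C" using C(1) quadratic_coneD(1)[OF q(1)] by blast
      fix a b assume "a \<in> \<Union>C" "b \<in> \<Union>C"
      then obtain S where S: "S \<in> C" "a \<in> S" "b \<in> S" using chain_two[OF C(2)] by blast
      then show "a + b \<in> \<Union>C" using quadratic_coneD(2)[OF q(1)[OF S(1)] S(2,3)] by blast
    next
      fix a b assume "a \<in> \<Union>C"
      then obtain S where S: "S \<in> C" "a \<in> S" by blast
      then show "b ^ 2 * a \<in> \<Union>C" using quadratic_coneD(3)[OF q(1)[OF S(1)] S(2)] by blast
    qed
    then show "P (\<Union>C)" using q(2) by (auto simp: P_def)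
  qed
  then obtain N where N: "M \<subseteq> N" "P N" "\<And>S. N \<subseteq> S \<Longrightarrow> P S \<Longrightarrow> S = N" by blast
  have qN: "quadratic_cone N" "- 1 \<notin> N" using N(2) by (auto simp: P_def)
  note cl = quadratic_coneD[OF qN(1)]
  have sum_sq: "(\<Sum>p\<leftarrow>ps. p ^ 2) * b \<in> N" if "b \<in> N" for ps b
    by (induction ps) (auto simp: cl distrib_right that)
  have ex: "\<exists>s ps. s \<in> N \<and> s + a * (\<Sum>p\<leftarrow>ps. p ^ 2) = - 1" if a: "a \<notin> N" for a
  proof (rule ccontr)
    assume neg: "\<not> ?thesis"
    define U where "U = {s + a * (\<Sum>p\<leftarrow>ps. p ^ 2) | s ps. s \<in> N}"
    have I: "s + a * (\<Sum>p\<leftarrow>ps. p ^ 2) \<in> U" if "s \<in> N" for s ps using that by (auto simp: U_def)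
    have "quadratic_cone U" unfolding quadratic_cone_def
    proof (intro conjI ballI allI)
      show "1 \<in> U" using I[of 1 "[]"] cl by simp
      fix u v assume "u \<in> U" "v \<in> U"
      then obtain s ps t qs where *: "u = s + a * (\<Sum>p\<leftarrow>ps. p ^ 2)" "s \<in> N" "v = t + a * (\<Sum>p\<leftarrow>qs. p ^ 2)" "t \<in> N"
        unfolding U_def by auto
      have "u + v = (s + t) + a * (\<Sum>p\<leftarrow>ps @ qs. p ^ 2)" unfolding * by (simp add: algebra_simps)
      also have "\<dots> \<in> U" by (rule I) (intro cl *)
      finally show "u + v \<in> U" .
    next
      fix u b assume "u \<in> U"
      then obtain s ps where *: "u = s + a * (\<Sum>p\<leftarrow>ps. p ^ 2)" "s \<in> N" unfolding U_def by auto
      have "b ^ 2 * (\<Sum>p\<leftarrow>ps. p ^ 2) = (\<Sum>p\<leftarrow>map ((*) b) ps. p ^ 2)"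
        by (induction ps) (simp_all add: algebra_simps power_mult_distrib)
      then have "b ^ 2 * u = b ^ 2 * s + a * (\<Sum>p\<leftarrow>map ((*) b) ps. p ^ 2)"
        unfolding * by (simp only: distrib_left mult.left_commute)
      also have "\<dots> \<in> U" by (rule I) (intro cl *)
      finally show "b ^ 2 * u \<in> U" .
    qed
    moreover have "- 1 \<notin> U"
    proof
      assume "- 1 \<in> U"
      then obtain s ps where "- 1 = s + a * (\<Sum>p\<leftarrow>ps. p ^ 2)" "s \<in> N" unfolding U_def by auto
      then show False using neg by metis
    qed
    moreover have "N \<subseteq> U"
    proof
      fix s assume "s \<in> N"
      then show "s \<in> U" using I[of s "[]"] by simp
    qed
    ultimately have "U = N" using N(3) by (simp add: P_def)
    moreover have "a \<in> U" using I[of 0 "[1]"] cl by simp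
    ultimately show False using a by simp
  qed
  define h :: "'v rpoly" where "h = const_poly (1 / 2)"
  have h: "h + h = 1" unfolding h_def const_poly_hom(1,2)[symmetric] by (simp add: const_poly_hom(4))
  \<comment> \<open>Every \<open>a\<close> is a difference of two squares, so the elements
    \<open>t\<close> with \<open>t\<close> and \<open>- t\<close> in \<open>N\<close> absorb
    multiplication.\<close>
  have supp: "a * t \<in> N" if t: "t \<in> N" "- t \<in> N" for a t
  proof -
    have "((a + 1) * h) ^ 2 * t + ((a - 1) * h) ^ 2 * (- t) \<in> N" by (intro cl t)
    also have "((a + 1) * h) ^ 2 * t + ((a - 1) * h) ^ 2 * (- t) = a * t * ((h + h) * (h + h))"
      by (simp add: power2_eq_square algebra_simps)
    finally show ?thesis by (simp add: h)
  qed
  have "a \<in> N \<or> - a \<in> N" for a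
  proof (rule ccontr)
    assume "\<not> ?thesis"
    then have na: "a \<notin> N" "- a \<notin> N" by auto
    obtain s ps where 1: "s \<in> N" "s + a * (\<Sum>p\<leftarrow>ps. p ^ 2) = - 1" using ex[OF na(1)] by blast
    obtain t qs where 2: "t \<in> N" "t + (- a) * (\<Sum>p\<leftarrow>qs. p ^ 2) = - 1" using ex[OF na(2)] by blast
    define x y where "x = (\<Sum>p\<leftarrow>ps. p ^ 2)" and "y = (\<Sum>p\<leftarrow>qs. p ^ 2)"
    note xy = x_def[symmetric] y_def[symmetric]
    have xN: "x * b \<in> N" "y * b \<in> N" if "b \<in> N" for b using sum_sq[OF that, of ps] sum_sq[OF that, of qs] by (simp_all add: x_def y_def)
    have ax: "a * x = - 1 - s" and ay: "a * y = 1 + t" using 1(2) 2(2) by (simp_all add: xy algebra_simps)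
    have yx: "y * (a * x) = x * (a * y)" by (simp add: algebra_simps)
    \<comment> \<open>Equating \<open>y * (a * x)\<close> with \<open>x * (a * y)\<close> puts
      \<open>- x\<close> in \<open>N\<close>. So \<open>x\<close> lies in the support,
      \<open>a * x\<close> is in \<open>N\<close>, and then so is
      \<open>s + a * x = - 1\<close>.\<close>
    have "x + (y + (y * s + x * t)) = x * (1 + t) - y * (- 1 - s)" by (simp add: algebra_simps)
    also have "\<dots> = 0" using yx unfolding ax ay by simp
    finally have "- x = y + (y * s + x * t)" by (rule minus_unique)
    moreover have "y * 1 + (y * s + x * t) \<in> N" by (intro cl xN 1 2)
    ultimately have "- x \<in> N" by simp
    moreover have "x \<in> N" using xN(1)[OF cl(1)] by simp
    ultimately have "a * x \<in> N" by (intro supp)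
    then have "s + a * x \<in> N" by (intro cl 1)
    then show False using 1(2) qN(2) by (simp add: xy)
  qed
  then show ?thesis using N(1) qN by blast
qed

text \<open>The ordering of the constants cuts out a real number for every polynomial, because the cone is
  total and Archimedean; these numbers form a ring homomorphism.\<close>

theorem archimedean_cone_point:
  fixes M :: "'v::finite rpoly set"
  assumes M0: "quadratic_cone M0" "- 1 \<notin> M0" and R: "const_poly R - (\<Sum>i\<in>UNIV. var_poly i ^ 2) \<in> M0"
  shows "\<exists>x :: real ^ 'v. \<forall>p\<in>M0. 0 \<le> eval_poly p x"
proof -
  obtain M where M: "M0 \<subseteq> M" "quadratic_cone M" "- 1 \<notin> M" "\<And>a. a \<in> M \<or> - a \<in> M"
    using exists_maximal_quadratic_cone[OF M0] by blast
  note cl = quadratic_coneD[OF M(2)]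
  have bounded: "\<exists>N>0. const_poly N - p \<in> M \<and> const_poly N + p \<in> M" for p
    by (rule quadratic_cone_bounded[OF M(2)]) (use R M(1) in blast)
  have const: "const_poly s \<in> M \<longleftrightarrow> 0 \<le> s" for s
  proof
    show "0 \<le> s \<Longrightarrow> const_poly s \<in> M" by (rule quadratic_cone_const[OF M(2)])
    assume s: "const_poly s \<in> M"
    show "0 \<le> s"
    proof (rule ccontr)
      assume "\<not> 0 \<le> s"
      then have "const_poly (- 1 / s) * const_poly s \<in> M"
        by (intro quadratic_cone_scale[OF M(2)] s) (simp add: divide_nonpos_neg)
      then have "const_poly (- 1) \<in> M" using \<open>\<not> 0 \<le> s\<close> by (simp flip: const_poly_hom(2))
      then show False using M(3) by (simp add: const_poly_neg const_poly_hom)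
    qed
  qed
  define low where "low a = {r. a - const_poly r \<in> M}" for a
  define \<phi> where "\<phi> a = Sup (low a)" for a
  have cut: "r \<le> s" if "a - const_poly r \<in> M" "const_poly s - a \<in> M" for a r s
  proof -
    have "(a - const_poly r) + (const_poly s - a) \<in> M" by (intro cl that)
    then have "const_poly (s - r) \<in> M" by (simp add: const_poly_neg)
    then show ?thesis by (simp add: const)
  qed
  have bdd: "bdd_above (low a)" for a
  proof -
    obtain N where "const_poly N - a \<in> M" using bounded by blast
    then show ?thesis using cut unfolding low_def bdd_above_def by blast
  qed
  have nonempty: "low a \<noteq> {}" for a
  proof -
    obtain N where "const_poly N + a \<in> M" using bounded by blast
    then have "a - const_poly (- N) \<in> M" by (simp add: const_poly_neg add.commute)
    then show ?thesis unfolding low_def by blast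
  qed
  have lowI: "r \<le> \<phi> a" if "a - const_poly r \<in> M" for a r
    unfolding \<phi>_def by (rule cSup_upper[OF _ bdd]) (simp add: low_def that)
  have highI: "\<phi> a \<le> r" if "const_poly r - a \<in> M" for a r
    unfolding \<phi>_def by (rule cSup_least[OF nonempty]) (use cut that in \<open>auto simp: low_def\<close>)
  have lowD: "a - const_poly r \<in> M" if "r < \<phi> a" for a r
  proof (rule ccontr)
    assume "a - const_poly r \<notin> M"
    then have "const_poly r - a \<in> M" using M(4)[of "a - const_poly r"] by simp
    then show False using highI that by fastforce
  qed
  have highD: "const_poly r - a \<in> M" if "\<phi> a < r" for a r
  proof (rule ccontr)
    assume "const_poly r - a \<notin> M"
    then have "a - const_poly r \<in> M" using M(4)[of "const_poly r - a"] by simp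
    then show False using lowI that by fastforce
  qed
  have \<phi>_const: "\<phi> (const_poly s) = s" for s
    by (rule antisym; (rule highI | rule lowI)) (simp_all add: cl)
  have \<phi>_add: "\<phi> (a + b) = \<phi> a + \<phi> b" for a b
  proof (rule antisym; rule field_le_epsilon)
    fix e :: real assume e: "0 < e"
    have "(const_poly (\<phi> a + e / 2) - a) + (const_poly (\<phi> b + e / 2) - b) \<in> M"
      by (intro cl highD) (use e in auto)
    then have "const_poly (\<phi> a + \<phi> b + e) - (a + b) \<in> M"
      by (simp add: algebra_simps flip: const_poly_hom(1))
    then show "\<phi> (a + b) \<le> \<phi> a + \<phi> b + e" by (rule highI)
    have "(a - const_poly (\<phi> a - e / 2)) + (b - const_poly (\<phi> b - e / 2)) \<in> M"
      by (intro cl lowD) (use e in auto)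
    also have "(a - const_poly (\<phi> a - e / 2)) + (b - const_poly (\<phi> b - e / 2))
        = (a + b) - (const_poly (\<phi> a - e / 2) + const_poly (\<phi> b - e / 2))" by simp
    also have "const_poly (\<phi> a - e / 2) + const_poly (\<phi> b - e / 2) = const_poly (\<phi> a + \<phi> b - e)"
      unfolding const_poly_hom(1)[symmetric] by (simp add: algebra_simps)
    finally have "\<phi> a + \<phi> b - e \<le> \<phi> (a + b)" by (rule lowI)
    then show "\<phi> a + \<phi> b \<le> \<phi> (a + b) + e" by simp
  qed
  have \<phi>_0: "\<phi> 0 = 0" using \<phi>_const[of 0] by (simp add: const_poly_hom)
  have \<phi>_minus: "\<phi> (- a) = - \<phi> a" for a using \<phi>_add[of a "- a"] \<phi>_0 by simp
  have \<phi>_diff: "\<phi> (a - b) = \<phi> a - \<phi> b" for a b using \<phi>_add[of a "- b"] \<phi>_minus by simp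
  have \<phi>_nonneg: "0 \<le> \<phi> a" if "a \<in> M" for a using lowI[of a 0] that by (simp add: const_poly_hom)
  have \<phi>_scale_pos: "s * \<phi> a \<le> \<phi> (const_poly s * a)" if s: "0 < s" for s a
  proof (rule field_le_epsilon)
    fix e :: real assume e: "0 < e"
    have "a - const_poly (\<phi> a - e / s) \<in> M" by (rule lowD) (use e s in simp)
    then have "const_poly s * (a - const_poly (\<phi> a - e / s)) \<in> M"
      by (rule quadratic_cone_scale[OF M(2)]) (use s in simp)
    moreover have "const_poly s * (a - const_poly (\<phi> a - e / s)) = const_poly s * a - const_poly (s * \<phi> a - e)"
      using s by (simp add: right_diff_distrib flip: const_poly_hom(2))
    ultimately have "s * \<phi> a - e \<le> \<phi> (const_poly s * a)" using lowI by simp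
    then show "s * \<phi> a \<le> \<phi> (const_poly s * a) + e" by simp
  qed
  have \<phi>_scale_pos': "\<phi> (const_poly s * a) = s * \<phi> a" if s: "0 < s" for s a
    using \<phi>_scale_pos[OF s, of a] \<phi>_scale_pos[OF s, of "- a"] by (simp add: \<phi>_minus)
  have \<phi>_scale: "\<phi> (const_poly s * a) = s * \<phi> a" for s a
  proof (cases s "0 :: real" rule: linorder_cases)
    case less
    then show ?thesis using \<phi>_scale_pos'[of "- s" a] by (simp add: const_poly_neg \<phi>_minus)
  qed (simp_all add: \<phi>_scale_pos' const_poly_hom \<phi>_0)
  have \<phi>_square_0: "\<phi> (a ^ 2) = 0" if a: "\<phi> a = 0" for a
  proof (rule antisym)
    have le: "\<phi> (a ^ 2) \<le> e ^ 2" if e: "0 < e" for e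
    proof (rule highI)
      show "const_poly (e ^ 2) - a ^ 2 \<in> M"
      proof (rule quadratic_cone_square_bound[OF M(2) e])
        show "const_poly e - a \<in> M" by (rule highD) (use a e in simp)
        have "const_poly e - (- a) \<in> M" by (rule highD) (use a e \<phi>_minus in simp)
        then show "const_poly e + a \<in> M" by simp
      qed
    qed
    show "\<phi> (a ^ 2) \<le> 0"
    proof (rule field_le_epsilon)
      fix e :: real assume "0 < e"
      then show "\<phi> (a ^ 2) \<le> 0 + e" using le[of "sqrt e"] by simp
    qed
    show "0 \<le> \<phi> (a ^ 2)" by (intro \<phi>_nonneg cl)
  qed
  \<comment> \<open>\<open>M\<close> is not assumed closed under products, so a product is reached
    through squares: \<open>0 \<le> \<phi> ((a + d b)^2)\<close> with
    \<open>\<phi> (a^2) = 0\<close> gives \<open>0 \<le> 2 \<phi> (a b) + d \<phi> (b^2)\<close> for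
    \<open>d > 0\<close>. The choice \<open>d = 2 e / B\<close> bounds the last term by
    \<open>2 e\<close>.\<close>
  have \<phi>_mult_0_nonneg: "0 \<le> \<phi> (a * b)" if a: "\<phi> a = 0" for a b
  proof -
    have "- (\<phi> (a * b)) \<le> 0 + e" if e: "0 < e" for e
    proof -
      define B where "B = \<bar>\<phi> (b ^ 2)\<bar> + 1"
      have B: "0 < B" "\<phi> (b ^ 2) \<le> B" by (auto simp: B_def)
      define d where "d = 2 * e / B"
      have "0 \<le> \<phi> ((a + const_poly d * b) ^ 2)" by (intro \<phi>_nonneg cl)
      also have "(a + const_poly d * b) ^ 2 = a ^ 2 + const_poly (2 * d) * (a * b) + const_poly (d * d) * b ^ 2"
        unfolding mult_2 const_poly_hom(1,2) by (simp add: power2_eq_square algebra_simps)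
      also have "\<phi> \<dots> = 2 * d * \<phi> (a * b) + d * d * \<phi> (b ^ 2)"
        by (simp add: \<phi>_add \<phi>_scale \<phi>_square_0[OF a])
      finally have "0 \<le> d * (2 * \<phi> (a * b) + d * \<phi> (b ^ 2))" by (simp add: algebra_simps)
      moreover have d: "0 < d" using e B by (simp add: d_def)
      ultimately have "0 \<le> 2 * \<phi> (a * b) + d * \<phi> (b ^ 2)" by (simp add: zero_le_mult_iff)
      moreover have "d * \<phi> (b ^ 2) \<le> d * B" using B d by (intro mult_left_mono) auto
      moreover have "d * B = 2 * e" using B by (simp add: d_def)
      ultimately show ?thesis by simp
    qed
    then have "- \<phi> (a * b) \<le> 0" by (rule field_le_epsilon)
    then show ?thesis by simp
  qed
  have \<phi>_mult: "\<phi> (a * b) = \<phi> a * \<phi> b" for a b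
  proof -
    define a' where "a' = a - const_poly (\<phi> a)"
    have a': "\<phi> a' = 0" by (simp add: a'_def \<phi>_diff \<phi>_const)
    have "\<phi> (a' * b) = 0" using \<phi>_mult_0_nonneg[OF a', of b] \<phi>_mult_0_nonneg[OF a', of "- b"] by (simp add: \<phi>_minus)
    moreover have "a * b = a' * b + const_poly (\<phi> a) * b" by (simp add: a'_def algebra_simps)
    ultimately show ?thesis by (simp add: \<phi>_add \<phi>_scale)
  qed
  have "\<phi> p = eval_poly p (\<chi> i. \<phi> (var_poly i))" for p
    by (induction p rule: rpoly_induct) (simp_all add: \<phi>_const \<phi>_add \<phi>_mult eval_poly_simps)
  then show ?thesis using \<phi>_nonneg M(1) by (metis subsetD)
qed

section \<open>Prime cones of polynomials have real points\<close>

definition cone_sign :: "'a::comm_ring_1 set \<Rightarrow> 'a \<Rightarrow> int" where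
  "cone_sign Q p = (if p \<notin> Q then - 1 else if - p \<in> Q then 0 else 1)"

definition realizable :: "'v::finite rpoly set \<Rightarrow> bool" where
  "realizable Q \<longleftrightarrow> (\<forall>\<Gamma>. finite \<Gamma> \<longrightarrow> (\<exists>x. \<forall>p\<in>\<Gamma>. sg (eval_poly p x) = cone_sign Q p))"

text \<open>The third premise says that the class of \<open>f\<close> is transcendental over the
  reals. Multipliers and constraints come as a list of pairs, because a definition cannot quantify
  over index types.\<close>

definition no_transcendental_critical_value :: "'v::finite rpoly set \<Rightarrow> bool" where
  "no_transcendental_critical_value Q \<longleftrightarrow>
     (\<forall>f c0 cs. (\<forall>i. c0 * partial_deriv i f - (\<Sum>(c, g)\<leftarrow>cs. c * partial_deriv i g) \<in> support Q) \<longrightarrow>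
       (\<forall>(c, g)\<in>set cs. c * g \<in> support Q) \<longrightarrow>
       (\<forall>p. p \<noteq> 0 \<longrightarrow> poly (map_poly const_poly p) f \<notin> support Q) \<longrightarrow> c0 \<in> support Q)"

text \<open>A type cannot depend on a locally fixed cone. Instead the quotient is formed by one global
  cone, which is a counterexample to the properties of interest if there is any.\<close>

definition witness_cone :: "'v::finite rpoly set" where
  "witness_cone = (SOME Q. prime_cone Q \<and>
     ((\<exists>Q' :: 'v rpoly set. prime_cone Q' \<and> \<not> (realizable Q' \<and> no_transcendental_critical_value Q')) \<longrightarrow>
       \<not> (realizable Q \<and> no_transcendental_critical_value Q)))"

lemma witness_cone:
  "prime_cone (witness_cone :: 'v::finite rpoly set)"
  "realizable (witness_cone :: 'v rpoly set) \<Longrightarrow> no_transcendental_critical_value (witness_cone :: 'v rpoly set) \<Longrightarrow>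
    prime_cone (Q :: 'v rpoly set) \<Longrightarrow> realizable Q \<and> no_transcendental_critical_value Q"
proof -
  let ?good = "\<lambda>Q :: 'v rpoly set. realizable Q \<and> no_transcendental_critical_value Q"
  \<comment> \<open>The origin supplies a prime cone for the choice to fall back on when there is no
    counterexample.\<close>
  have "prime_cone {p :: 'v rpoly. 0 \<le> eval_poly p 0}"
    unfolding prime_cone_def ring_preorder_def support_def by (auto simp: eval_poly_simps)
  then have "\<exists>Q. prime_cone Q \<and> ((\<exists>Q'. prime_cone Q' \<and> \<not> ?good Q') \<longrightarrow> \<not> ?good Q)" by metis
  from someI_ex[OF this] have "prime_cone (witness_cone :: 'v rpoly set) \<and>
    ((\<exists>Q'. prime_cone Q' \<and> \<not> ?good Q') \<longrightarrow> \<not> ?good witness_cone)"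
    unfolding witness_cone_def .
  then show "prime_cone (witness_cone :: 'v rpoly set)"
    "realizable (witness_cone :: 'v rpoly set) \<Longrightarrow> no_transcendental_critical_value (witness_cone :: 'v rpoly set) \<Longrightarrow>
      prime_cone Q \<Longrightarrow> ?good Q" by blast+
qed

lemmas witness = prime_coneD[OF witness_cone(1)]
lemmas witness_support = support_ideal[OF witness_cone(1)]

lemma witness_support_diff: "a \<in> support witness_cone \<Longrightarrow> b \<in> support witness_cone \<Longrightarrow> a - b \<in> support witness_cone"
  using witness_support(1)[of a "- b"] witness_support(3)[of b] by simp

quotient_type (overloaded) 'v cone_quotient = "'v::finite rpoly" / "\<lambda>a b. a - b \<in> support witness_cone"
  morphisms cone_rep cone_class
proof (rule equivpI)
  show "reflp (\<lambda>a b. a - b \<in> support (witness_cone :: 'v rpoly set))"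
    by (simp add: reflp_def witness_support)
  show "symp (\<lambda>a b. a - b \<in> support (witness_cone :: 'v rpoly set))"
    using witness_support(3) by (force simp: symp_def)
  show "transp (\<lambda>a b. a - b \<in> support (witness_cone :: 'v rpoly set))"
    using witness_support(1) by (force simp: transp_def)
qed

instantiation cone_quotient :: (finite) linordered_idom
begin

lift_definition zero_cone_quotient :: "'a cone_quotient" is 0 .
lift_definition one_cone_quotient :: "'a cone_quotient" is 1 .
lift_definition plus_cone_quotient :: "'a cone_quotient \<Rightarrow> 'a cone_quotient \<Rightarrow> 'a cone_quotient" is "(+)"
  using witness_support(1) by (force simp: add_diff_add)
lift_definition uminus_cone_quotient :: "'a cone_quotient \<Rightarrow> 'a cone_quotient" is uminus
  using witness_support(3) by force
lift_definition minus_cone_quotient :: "'a cone_quotient \<Rightarrow> 'a cone_quotient \<Rightarrow> 'a cone_quotient" is "(-)"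
proof -
  fix a b c d :: "'a rpoly"
  assume "a - b \<in> support witness_cone" "c - d \<in> support witness_cone"
  from witness_support_diff[OF this] show "a - c - (b - d) \<in> support witness_cone" by (simp add: algebra_simps)
qed
lift_definition times_cone_quotient :: "'a cone_quotient \<Rightarrow> 'a cone_quotient \<Rightarrow> 'a cone_quotient" is "(*)"
proof -
  fix a b c d :: "'a rpoly"
  assume "a - b \<in> support witness_cone" "c - d \<in> support witness_cone"
  then have "(a - b) * c + (c - d) * b \<in> support witness_cone" by (intro witness_support)
  then show "a * c - b * d \<in> support witness_cone" by (simp add: algebra_simps)
qed
lift_definition less_eq_cone_quotient :: "'a cone_quotient \<Rightarrow> 'a cone_quotient \<Rightarrow> bool"
  is "\<lambda>a b. b - a \<in> witness_cone"
proof -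
  have *: "d - b \<in> witness_cone" if "a - b \<in> support witness_cone" "c - d \<in> support witness_cone" "c - a \<in> witness_cone"
    for a b c d :: "'a rpoly"
  proof -
    have "(c - a) + (a - b) + - (c - d) \<in> witness_cone"
      using that by (intro witness) (auto simp: support_def)
    then show ?thesis by (simp add: algebra_simps)
  qed
  fix a b c d :: "'a rpoly"
  assume "a - b \<in> support witness_cone" "c - d \<in> support witness_cone"
  then show "(c - a \<in> witness_cone) = (d - b \<in> witness_cone)"
    using *[of a b c d] *[of b a d c] witness_support(3)[of "a - b"] witness_support(3)[of "c - d"] by auto
qed
definition less_cone_quotient :: "'a cone_quotient \<Rightarrow> 'a cone_quotient \<Rightarrow> bool"
  where "less_cone_quotient x y \<longleftrightarrow> x \<le> y \<and> x \<noteq> y"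
definition abs_cone_quotient :: "'a cone_quotient \<Rightarrow> 'a cone_quotient"
  where "abs_cone_quotient x = (if x < 0 then - x else x)"
definition sgn_cone_quotient :: "'a cone_quotient \<Rightarrow> 'a cone_quotient"
  where "sgn_cone_quotient x = (if x = 0 then 0 else if 0 < x then 1 else - 1)"

instance
proof
  fix a b c :: "'a cone_quotient"
  note s = witness_support(4)
  show "a * b * c = a * (b * c)" by transfer (simp add: s mult.assoc)
  show "a * b = b * a" by transfer (simp add: s mult.commute)
  show "1 * a = a" by transfer (simp add: s)
  show "a + b + c = a + (b + c)" by transfer (simp add: s add.assoc)
  show "a + b = b + a" by transfer (simp add: s add.commute)
  show "0 + a = a" by transfer (simp add: s)
  show "- a + a = 0" by transfer (simp add: s)
  show "a - b = a + - b" by transfer (simp add: s)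
  show "(a + b) * c = a * c + b * c" by transfer (simp add: s distrib_right)
  show "(0 :: 'a cone_quotient) \<noteq> 1"
    using witness_support(3)[of "- 1 :: 'a rpoly"] witness_support(5)[where 'v = 'a]
    by (auto simp: zero_cone_quotient_def one_cone_quotient_def cone_quotient.abs_eq_iff)
  show "a + b - a = b" by transfer (simp add: s)
  show "a - b - c = a - (b + c)" by transfer (simp add: s algebra_simps)
  show "0 * a = 0" "a * 0 = 0" by (transfer, simp add: s)+
  have surj: "\<exists>p. x = cone_class p" for x :: "'a cone_quotient"
    by (induction x rule: cone_quotient.abs_induct) blast
  note le = less_eq_cone_quotient.abs_eq
  show refl: "a \<le> a" by transfer (simp add: witness)
  show antisym: "a = b" if "a \<le> b" "b \<le> a" for a b :: "'a cone_quotient"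
  proof -
    obtain p q where "a = cone_class p" "b = cone_class q" using surj by metis
    then show ?thesis using that by (simp add: le cone_quotient.abs_eq_iff support_def)
  qed
  show "a < b \<longleftrightarrow> a \<le> b \<and> \<not> b \<le> a"
    using antisym refl unfolding less_cone_quotient_def by blast
  show "a \<le> c" if "a \<le> b" "b \<le> c"
  proof -
    obtain p q r where pqr: "a = cone_class p" "b = cone_class q" "c = cone_class r" using surj by metis
    then have "(q - p) + (r - q) \<in> witness_cone" using that by (intro witness) (simp_all add: le)
    then show ?thesis by (simp add: pqr le)
  qed
  show "a \<le> b \<or> b \<le> a"
  proof -
    obtain p q where "a = cone_class p" "b = cone_class q" using surj by metis
    then show ?thesis using witness(7)[of "q - p"] by (simp add: le)
  qed
  show "c + a \<le> c + b" if "a \<le> b" using that by transfer simp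
  have nz: "x * y = 0 \<longleftrightarrow> x = 0 \<or> y = 0" for x y :: "'a cone_quotient"
  proof
    obtain p q where pq: "x = cone_class p" "y = cone_class q" using surj by metis
    have zero: "cone_class r = 0 \<longleftrightarrow> r \<in> support witness_cone" for r :: "'a rpoly"
      by (simp add: zero_cone_quotient_def cone_quotient.abs_eq_iff)
    show "x * y = 0 \<Longrightarrow> x = 0 \<or> y = 0"
      unfolding pq times_cone_quotient.abs_eq zero by (rule witness(8))
    show "x = 0 \<or> y = 0 \<Longrightarrow> x * y = 0"
      unfolding pq times_cone_quotient.abs_eq zero
      using witness_support(2)[of p q] witness_support(2)[of q p] by (auto simp: mult.commute)
  qed
  have mult_diff: "c * b - c * a = c * (b - a)" by transfer (simp add: s algebra_simps)
  have eq_iff: "x = y \<longleftrightarrow> y - x = 0" for x y :: "'a cone_quotient"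
  proof -
    obtain p q where pq: "x = cone_class p" "y = cone_class q" using surj by metis
    show ?thesis unfolding pq minus_cone_quotient.abs_eq zero_cone_quotient_def cone_quotient.abs_eq_iff
      using witness_support(3)[of "p - q"] witness_support(3)[of "q - p"] by auto
  qed
  show "c * a < c * b" if "a < b" "0 < c"
  proof -
    obtain p q r where pqr: "a = cone_class p" "b = cone_class q" "c = cone_class r" using surj by metis
    have "r * (q - p) \<in> witness_cone"
      by (rule witness(2)) (use that in \<open>simp_all add: less_cone_quotient_def pqr le zero_cone_quotient_def\<close>)
    then have "c * a \<le> c * b" by (simp add: pqr le times_cone_quotient.abs_eq right_diff_distrib)
    moreover have "c * a \<noteq> c * b" using that unfolding less_cone_quotient_def eq_iff[of "c * a"] mult_diff nz
      by (auto simp: eq_iff[of a b])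
    ultimately show ?thesis unfolding less_cone_quotient_def by blast
  qed
  show "\<bar>a\<bar> = (if a < 0 then - a else a)" by (rule abs_cone_quotient_def)
  show "sgn a = (if a = 0 then 0 else if 0 < a then 1 else - 1)" by (rule sgn_cone_quotient_def)
qed

end

lemma unital_hom_cone_class: "unital_hom cone_class"
  unfolding unital_hom_def
  by (simp add: one_cone_quotient_def plus_cone_quotient.abs_eq times_cone_quotient.abs_eq)

lemma cone_class_eq_0_iff: "cone_class p = 0 \<longleftrightarrow> p \<in> support witness_cone"
  by (simp add: zero_cone_quotient_def cone_quotient.abs_eq_iff)

lemma cone_class_nonneg_iff: "0 \<le> cone_class p \<longleftrightarrow> p \<in> witness_cone"
  by (simp add: zero_cone_quotient_def less_eq_cone_quotient.abs_eq)

lemma sg_cone_class: "sg (cone_class p) = cone_sign witness_cone p"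
  using cone_class_eq_0_iff[of p] cone_class_nonneg_iff[of p]
  by (auto simp: sg_def cone_sign_def support_def not_less less_le)

section \<open>The ordered residue field and its signs\<close>

definition cone_fract :: "'v::finite rpoly \<Rightarrow> 'v cone_quotient fract" where
  "cone_fract p = Fract (cone_class p) 1"

lemma unital_hom_cone_fract: "unital_hom cone_fract"
  unfolding unital_hom_def cone_fract_def by (simp add: unital_hom_simps[OF unital_hom_cone_class] One_fract_def)

lemma cone_fract_eq_0_iff: "cone_fract p = 0 \<longleftrightarrow> p \<in> support witness_cone"
  unfolding cone_fract_def cone_class_eq_0_iff[symmetric] Zero_fract_def by (simp add: eq_fract)

lemma sg_cone_fract: "sg (cone_fract p) = cone_sign witness_cone p"
  unfolding sg_cone_class[symmetric] cone_fract_def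
  by (simp add: sg_def zero_less_Fract_iff Fract_less_zero_iff)

text \<open>Nonnegative constants are squares, so every prime cone induces the usual order on the
  reals. This starts the induction over the variables.\<close>

lemma cone_sign_const:
  assumes Q: "prime_cone Q"
  shows "cone_sign Q (const_poly c) = sg c"
proof -
  note cl = prime_coneD[OF Q]
  have nonneg: "const_poly c \<in> Q" if "0 \<le> c" for c
    using cl(3) const_poly_square[OF that] by metis
  have neg: "const_poly c \<notin> Q" if "c < 0" for c
  proof
    assume c: "const_poly c \<in> Q"
    have "const_poly (- 1 / c) * const_poly c \<in> Q"
      by (rule cl(2)[OF nonneg c]) (use that in \<open>simp add: divide_nonpos_neg\<close>)
    also have "const_poly (- 1 / c) * const_poly c = - 1"
      unfolding const_poly_hom(2)[symmetric] using that by (simp add: const_poly_neg const_poly_hom)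
    finally show False using cl(6) by simp
  qed
  show ?thesis
  proof (cases c "0 :: real" rule: linorder_cases)
    case less
    then show ?thesis using neg[of c] by (simp add: cone_sign_def sg_def)
  next
    case equal
    then show ?thesis using cl(4) by (simp add: cone_sign_def const_poly_hom)
  next
    case greater
    then show ?thesis using nonneg[of c] neg[of "- c"] by (simp add: cone_sign_def sg_def const_poly_neg)
  qed
qed

text \<open>Adds one coordinate at a time. \<open>G S\<close> is generated by the sets of real
  points that match one sign condition in the variables \<open>S\<close>; by induction any finitely
  many of these sets have a common point, so the filter is proper. Then
  \<open>eventually_sign_transfer\<close> holds at some point and supplies the next coordinate
  there.\<close>

lemma realizable_witness_cone: "realizable (witness_cone :: 'v::finite rpoly set)"
proof -
  define \<phi> where "\<phi> = (\<lambda>p :: 'v rpoly. to_rc (cone_fract p))"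
  have \<phi>: "unital_hom \<phi>"
    unfolding unital_hom_def \<phi>_def
    by (simp add: unital_hom_simps[OF unital_hom_to_rc] unital_hom_simps[OF unital_hom_cone_fract])
  have sg\<phi>: "sg (\<phi> p) = cone_sign witness_cone p" for p
    by (simp add: \<phi>_def sg_to_rc sg_cone_fract)
  define matches where "matches c = {z :: real ^ 'v. sg (eval_poly c z) = sg (\<phi> c)}" for c
  define G where "G S = (INF c\<in>polys_in S. principal (matches c))" for S
  have Gne: "G S \<noteq> bot" if pt: "\<And>\<Gamma>. finite \<Gamma> \<Longrightarrow> \<Gamma> \<subseteq> polys_in S \<Longrightarrow> \<exists>z. \<forall>c\<in>\<Gamma>. z \<in> matches c" for S
    unfolding G_def
  proof (rule INF_filter_not_bot)
    fix \<Gamma> :: "'v rpoly set" assume \<Gamma>: "\<Gamma> \<subseteq> polys_in S" "finite \<Gamma>"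
    show "(INF c\<in>\<Gamma>. principal (matches c)) \<noteq> bot"
      using pt[OF \<Gamma>(2,1)] by (auto simp: INF_principal_finite[OF \<Gamma>(2)] principal_eq_bot_iff)
  qed
  have points: "\<exists>z. \<forall>c\<in>\<Gamma>. z \<in> matches c" if "finite S" "finite \<Gamma>" "\<Gamma> \<subseteq> polys_in S" for S \<Gamma>
    using that
  proof (induction S arbitrary: \<Gamma>)
    case empty
    have "z \<in> matches c" if "c \<in> polys_in {}" for c and z :: "real ^ 'v"
      using that
    proof induction
      case (const c)
      then show ?case by (simp add: matches_def sg\<phi> cone_sign_const[OF witness_cone(1)])
    next
      case (add p q)
      have "\<exists>a. p = const_poly a" if "p \<in> polys_in {}" for p :: "'v rpoly"
        using that by induction (auto simp flip: const_poly_hom(1,2))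
      then obtain a b where "p = const_poly a" "q = const_poly b" using add by metis
      then have "p + q = const_poly (a + b)" by (simp add: const_poly_hom)
      then show ?case by (simp add: matches_def sg\<phi> cone_sign_const[OF witness_cone(1)])
    next
      case (mult p q)
      have "\<exists>a. p = const_poly a" if "p \<in> polys_in {}" for p :: "'v rpoly"
        using that by induction (auto simp flip: const_poly_hom(1,2))
      then obtain a b where "p = const_poly a" "q = const_poly b" using mult by metis
      then have "p * q = const_poly (a * b)" by (simp add: const_poly_hom)
      then show ?case by (simp add: matches_def sg\<phi> cone_sign_const[OF witness_cone(1)])
    qed simp
    then show ?case using empty by blast
  next
    case (insert i S)
    interpret sign_family \<phi> "\<lambda>z p. eval_poly p z" "G S" "polys_in S"
    proof
      show "\<forall>\<^sub>F z in G S. sg (eval_poly c z) = sg (\<phi> c)" if "c \<in> polys_in S" for c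
      proof -
        have "G S \<le> principal (matches c)" unfolding G_def by (rule INF_lower[OF that])
        then show ?thesis unfolding le_principal by (simp add: matches_def)
      qed
    qed (rule \<phi> unital_hom_eval_poly subring_set_polys_in)+
    have "\<forall>c\<in>\<Gamma>. \<exists>P. P \<in> polys_over (polys_in S) \<and> poly P (var_poly i) = c"
    proof
      fix c assume "c \<in> \<Gamma>"
      then have "c \<in> polys_in (insert i S)" using insert.prems(2) by (rule subsetD[rotated])
      from polys_in_insert_as_poly[OF this] show "\<exists>P. P \<in> polys_over (polys_in S) \<and> poly P (var_poly i) = c"
        by (simp add: Bex_def)
    qed
    from bchoice[OF this] obtain P where P: "\<And>c. c \<in> \<Gamma> \<Longrightarrow> P c \<in> polys_over (polys_in S)"
      "\<And>c. c \<in> \<Gamma> \<Longrightarrow> poly (P c) (var_poly i) = c" by blast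
    have ev: "\<forall>\<^sub>F z in G S. \<exists>y. \<forall>p\<in>P ` \<Gamma>. sg (poly (map_poly (\<lambda>p. eval_poly p z) p) y) = sg (poly (map_poly \<phi> p) (\<phi> (var_poly i)))"
      by (rule eventually_sign_transfer) (use insert.prems(1) P(1) in auto)
    have "G S \<noteq> bot" by (rule Gne) (rule insert.IH)
    from eventually_happens'[OF this ev] obtain z where "\<exists>y. \<forall>p\<in>P ` \<Gamma>. sg (poly (map_poly (\<lambda>p. eval_poly p z) p) y) = sg (poly (map_poly \<phi> p) (\<phi> (var_poly i)))"
      by (rule exE)
    then obtain y where y: "\<forall>p\<in>P ` \<Gamma>. sg (poly (map_poly (\<lambda>p. eval_poly p z) p) y) = sg (poly (map_poly \<phi> p) (\<phi> (var_poly i)))"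
      by (rule exE)
    have zy: "sg (poly (map_poly (\<lambda>p. eval_poly p z) (P c)) y) = sg (poly (map_poly \<phi> (P c)) (\<phi> (var_poly i)))"
      if "c \<in> \<Gamma>" for c by (rule bspec[OF y imageI[OF that]])
    \<comment> \<open>Only coordinate \<open>i\<close> changes, and the coefficients of
      \<open>P c\<close> do not involve it.\<close>
    define x where "x = (\<chi> j. if j = i then y else z $ j)"
    have "x \<in> matches c" if c: "c \<in> \<Gamma>" for c
    proof -
      have "map_poly (\<lambda>p. eval_poly p x) (P c) = map_poly (\<lambda>p. eval_poly p z) (P c)"
      proof (rule poly_eqI)
        fix n
        have "coeff (P c) n \<in> polys_in S" using P(1)[OF c] by (simp add: polys_over_def)
        then have "eval_poly (coeff (P c) n) x = eval_poly (coeff (P c) n) z"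
          by (rule eval_polys_in_cong) (use insert.hyps(2) in \<open>auto simp: x_def\<close>)
        then show "coeff (map_poly (\<lambda>p. eval_poly p x) (P c)) n = coeff (map_poly (\<lambda>p. eval_poly p z) (P c)) n"
          by (simp add: coeff_map_poly eval_poly_simps)
      qed
      moreover have "eval_poly c x = poly (map_poly (\<lambda>p. eval_poly p x) (P c)) (x $ i)"
        using hom_poly[OF unital_hom_eval_poly, of "P c" "var_poly i" x] P(2)[OF c] by simp
      moreover have "\<phi> c = poly (map_poly \<phi> (P c)) (\<phi> (var_poly i))"
        using hom_poly[OF \<phi>, of "P c" "var_poly i"] P(2)[OF c] by simp
      ultimately show ?thesis using zy[OF c] by (simp add: matches_def x_def)
    qed
    then show ?case by blast
  qed
  show ?thesis unfolding realizable_def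
  proof (intro allI impI)
    fix \<Gamma> :: "'v rpoly set" assume "finite \<Gamma>"
    then have "\<exists>z. \<forall>c\<in>\<Gamma>. z \<in> matches c" using points[of UNIV \<Gamma>] polys_in_UNIV by auto
    then show "\<exists>x. \<forall>p\<in>\<Gamma>. sg (eval_poly p x) = cone_sign witness_cone p"
      by (simp add: matches_def sg\<phi>)
  qed
qed

section \<open>Derivations of the residue field over the reals\<close>

lemma derivation_chain_rule:
  fixes h :: "'v::finite rpoly \<Rightarrow> 'a::comm_ring_1"
  assumes h: "unital_hom h" and D: "derivation_on L D" and L: "range h \<subseteq> L" and const: "\<And>c. D (h (const_poly c)) = 0"
  shows "D (h p) = (\<Sum>i\<in>UNIV. h (partial_deriv i p) * D (h (var_poly i)))"
proof -
  have mem: "h q \<in> L" for q using L by blast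
  note d = derivation_onD[OF D] unital_hom_simps[OF h]
  show ?thesis
  proof (induction p rule: rpoly_induct)
    case (const c)
    then show ?case by (simp add: assms(4) partial_deriv_const d)
  next
    case (var j)
    have "(\<Sum>i\<in>UNIV. h (partial_deriv i (var_poly j)) * D (h (var_poly i)))
        = (\<Sum>i\<in>UNIV. if i = j then D (h (var_poly i)) else 0)"
      by (rule sum.cong) (auto simp: partial_deriv_var d)
    then show ?case by simp
  next
    case (add p q)
    then show ?case by (simp add: d mem partial_deriv_add distrib_right sum.distrib)
  next
    case (mult p q)
    then show ?case
      by (simp add: d mem partial_deriv_mult distrib_right sum.distrib sum_distrib_left sum_distrib_right algebra_simps)
  qed
qed

lemma no_transcendental_critical_value_witness_cone:
  "no_transcendental_critical_value (witness_cone :: 'v::finite rpoly set)"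
  unfolding no_transcendental_critical_value_def
proof (intro allI impI)
  fix f c0 :: "'v rpoly" and cs :: "('v rpoly \<times> 'v rpoly) list"
  assume crit: "\<forall>i. c0 * partial_deriv i f - (\<Sum>(c, g)\<leftarrow>cs. c * partial_deriv i g) \<in> support witness_cone"
    and compl: "\<forall>(c, g)\<in>set cs. c * g \<in> support witness_cone"
    and trans: "\<forall>p. p \<noteq> 0 \<longrightarrow> poly (map_poly const_poly p) f \<notin> support witness_cone"
  define h where "h = (cone_fract :: 'v rpoly \<Rightarrow> 'v cone_quotient fract)"
  have h: "unital_hom h" unfolding h_def by (rule unital_hom_cone_fract)
  have h0: "h p = 0 \<longleftrightarrow> p \<in> support witness_cone" for p unfolding h_def by (rule cone_fract_eq_0_iff)
  note hs = unital_hom_simps[OF h]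
  define k where "k c = h (const_poly c)" for c
  have k: "unital_hom k" unfolding unital_hom_def k_def by (simp add: hs const_poly_hom)
  note ks = unital_hom_simps[OF k]
  have "k c \<noteq> 0" if "c \<noteq> 0" for c
    using ks(3)[of c "1 / c"] ks(1) that by auto
  then have k0: "k c = 0 \<longleftrightarrow> c = 0" for c using ks(4) by auto
  have injk: "inj k"
  proof (rule injI)
    fix a b assume "k a = k b"
    then have "k (a - b) = 0" by (simp add: ks)
    then show "a = b" by (simp add: k0)
  qed
  have C: "subring_set (range k)" unfolding subring_set_def
  proof (intro conjI ballI)
    show "0 \<in> range k" using ks(4) rangeI[of k 0] by simp
    show "1 \<in> range k" using ks(1) rangeI[of k 1] by simp
    fix a b assume "a \<in> range k" "b \<in> range k"
    then obtain x y where "a = k x" "b = k y" by blast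
    then have "a + b = k (x + y)" "a - b = k (x - y)" "a * b = k (x * y)" by (simp_all add: ks)
    then show "a + b \<in> range k" "a - b \<in> range k" "a * b \<in> range k" by (metis rangeI)+
  qed
  have LDex: "\<exists>L D. derivation_on L D \<and> range k \<subseteq> L \<and> range (\<lambda>i. h (var_poly i)) \<subseteq> L \<and> h f \<in> L
      \<and> (\<forall>c\<in>range k. D c = 0) \<and> D (h f) = 1"
  proof (rule transcendental_derivation[OF C])
    fix p assume p: "p \<in> polys_over (range k)" "poly p (h f) = 0"
    \<comment> \<open>Transcendence is assumed for real coefficients, so those of \<open>p\<close>
      are pulled back along the embedding \<open>k\<close> of the reals.\<close>
    define r where "r = map_poly (inv_into UNIV k) p"
    have "inv_into UNIV k 0 = 0" using inv_into_f_f[OF injk, of 0] ks(4) by simp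
    then have pr: "p = map_poly k r"
      using p(1) unfolding r_def polys_over_def
      by (intro poly_eqI) (simp add: coeff_map_poly ks f_inv_into_f)
    have "map_poly k r = map_poly h (map_poly const_poly r)"
      by (rule poly_eqI) (simp add: coeff_map_poly ks hs const_poly_hom k_def)
    then have "h (poly (map_poly const_poly r) f) = 0" using p(2) pr hom_poly[OF h] by simp
    then have "r = 0" using trans h0 by blast
    then show "p = 0" using pr by simp
  qed simp
  from LDex obtain L D where LD: "derivation_on L D" "range k \<subseteq> L" "range (\<lambda>i. h (var_poly i)) \<subseteq> L"
    "\<forall>c\<in>range k. D c = 0" "D (h f) = 1" by blast
  note L = subring_set_closed[OF derivation_onD(1)[OF LD(1)]]
  have "h p \<in> L" for p
  proof (induction p rule: rpoly_induct)
    case (const c)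
    then show ?case using LD(2) by (auto simp: k_def)
  next
    case (var i)
    then show ?case using LD(3) by auto
  qed (simp_all add: hs L)
  then have chain: "D (h p) = (\<Sum>i\<in>UNIV. h (partial_deriv i p) * D (h (var_poly i)))" for p
    by (intro derivation_chain_rule[OF h LD(1)]) (use LD(4) in \<open>auto simp: k_def\<close>)
  have vanish: "h c * D (h g) = 0" if "(c, g) \<in> set cs" for c g
  proof -
    have "c * g \<in> support witness_cone" using compl that by auto
    then have "h c * h g = 0" using h0 hs(3) by metis
    then show ?thesis using derivation_onD(4)[OF LD(1)] by auto
  qed
  have "h c0 * h (partial_deriv i f) = (\<Sum>(c, g)\<leftarrow>cs. h c * h (partial_deriv i g))" for i
  proof -
    have "h (c0 * partial_deriv i f - (\<Sum>(c, g)\<leftarrow>cs. c * partial_deriv i g)) = 0" using crit h0 by blast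
    then show ?thesis by (simp add: hs comp_def case_prod_unfold)
  qed
  then have "h c0 * D (h f) = (\<Sum>i\<in>UNIV. (\<Sum>(c, g)\<leftarrow>cs. h c * h (partial_deriv i g)) * D (h (var_poly i)))"
    unfolding chain[of f] sum_distrib_left by (simp add: mult.assoc[symmetric])
  also have "\<dots> = (\<Sum>(c, g)\<leftarrow>cs. h c * D (h g))"
  proof (induction cs)
    case (Cons a cs)
    obtain c g where a: "a = (c, g)" by (cases a)
    have "h c * D (h g) = (\<Sum>i\<in>UNIV. h c * h (partial_deriv i g) * D (h (var_poly i)))"
      unfolding chain[of g] sum_distrib_left by (simp add: mult.assoc)
    then show ?case using Cons by (simp add: a distrib_right sum.distrib)
  qed simp
  also have "\<dots> = 0"
  proof -
    have "map (\<lambda>(c, g). h c * D (h g)) cs = map (\<lambda>_. 0) cs" by (rule map_cong) (use vanish in auto)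
    then show ?thesis by (simp only: sum_list_0)
  qed
  finally show "c0 \<in> support witness_cone" using LD(5) h0 by simp
qed

theorem prime_cone_real_point:
  fixes Q :: "'v::finite rpoly set"
  assumes "prime_cone Q" "finite \<Gamma>"
  shows "\<exists>x. \<forall>p\<in>\<Gamma>. sg (eval_poly p x) = cone_sign Q p"
  using witness_cone(2)[OF realizable_witness_cone no_transcendental_critical_value_witness_cone assms(1)] assms(2)
  unfolding realizable_def by blast

theorem prime_cone_critical_value:
  fixes Q :: "'v::finite rpoly set"
  assumes "prime_cone Q"
    and "\<And>i. c0 * partial_deriv i f - (\<Sum>(c, g)\<leftarrow>cs. c * partial_deriv i g) \<in> support Q"
    and "\<And>c g. (c, g) \<in> set cs \<Longrightarrow> c * g \<in> support Q"
    and "\<And>p. p \<noteq> 0 \<Longrightarrow> poly (map_poly const_poly p) f \<notin> support Q"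
  shows "c0 \<in> support Q"
  using witness_cone(2)[OF realizable_witness_cone no_transcendental_critical_value_witness_cone assms(1)] assms(2-4)
  unfolding no_transcendental_critical_value_def by blast

section \<open>Sums of squares, quadratic modules and preorderings\<close>

lemma sos_sum: "(\<Sum>p\<leftarrow>ps. p ^ 2) \<in> sos"
  unfolding sos_def by blast

lemma sos_0: "0 \<in> sos"
  using sos_sum[of "[]"] by simp

lemma sos_add:
  assumes "s \<in> sos" "t \<in> sos"
  shows "s + t \<in> sos"
proof -
  obtain ps qs where "s = (\<Sum>p\<leftarrow>ps. p ^ 2)" "t = (\<Sum>p\<leftarrow>qs. p ^ 2)" using assms unfolding sos_def by blast
  then have "s + t = (\<Sum>p\<leftarrow>ps @ qs. p ^ 2)" by simp
  then show ?thesis using sos_sum by metis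
qed

lemma sos_square: "q ^ 2 \<in> sos"
  using sos_sum[of "[q]"] by simp

lemma sos_mult_square:
  assumes "s \<in> sos"
  shows "q ^ 2 * s \<in> sos"
proof -
  obtain ps where s: "s = (\<Sum>p\<leftarrow>ps. p ^ 2)" using assms unfolding sos_def by blast
  have "q ^ 2 * (\<Sum>p\<leftarrow>ps. p ^ 2) \<in> sos"
    by (induction ps) (simp_all add: sos_0 distrib_left sos_add sos_square flip: power_mult_distrib)
  then show ?thesis by (simp add: s)
qed

lemma sos_mult:
  assumes "s \<in> sos" "t \<in> sos"
  shows "s * t \<in> sos"
proof -
  obtain ps where s: "s = (\<Sum>p\<leftarrow>ps. p ^ 2)" using assms unfolding sos_def by blast
  have "(\<Sum>p\<leftarrow>ps. p ^ 2) * t \<in> sos"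
    by (induction ps) (simp_all add: sos_0 distrib_right sos_add sos_mult_square assms(2))
  then show ?thesis by (simp add: s)
qed

lemma quadratic_module_I:
  assumes "s0 \<in> sos" "\<And>j. s j \<in> sos"
  shows "s0 + (\<Sum>j\<in>UNIV. g j * s j) \<in> quadratic_module g"
  using assms unfolding quadratic_module_def by blast

lemma quadratic_cone_quadratic_module:
  fixes g :: "'m::finite \<Rightarrow> 'v rpoly"
  shows "quadratic_cone (quadratic_module g)"
  unfolding quadratic_cone_def
proof (intro conjI ballI allI)
  show "1 \<in> quadratic_module g"
    using quadratic_module_I[of 1 "\<lambda>_. 0" g] sos_square[of 1] sos_0 by simp
  fix a assume "a \<in> quadratic_module g"
  then obtain s0 s where a: "a = s0 + (\<Sum>j\<in>UNIV. g j * s j)" "s0 \<in> sos" "\<And>j. s j \<in> sos"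
    unfolding quadratic_module_def by blast
  show "b ^ 2 * a \<in> quadratic_module g" for b
  proof -
    have "b ^ 2 * a = b ^ 2 * s0 + (\<Sum>j\<in>UNIV. g j * (b ^ 2 * s j))"
      unfolding a(1) by (simp add: distrib_left sum_distrib_left mult.left_commute)
    also have "\<dots> \<in> quadratic_module g" by (intro quadratic_module_I sos_mult_square a)
    finally show ?thesis .
  qed
  fix b assume "b \<in> quadratic_module g"
  then obtain t0 t where b: "b = t0 + (\<Sum>j\<in>UNIV. g j * t j)" "t0 \<in> sos" "\<And>j. t j \<in> sos"
    unfolding quadratic_module_def by blast
  have "a + b = (s0 + t0) + (\<Sum>j\<in>UNIV. g j * (s j + t j))"
    unfolding a(1) b(1) by (simp add: distrib_left sum.distrib algebra_simps)
  also have "\<dots> \<in> quadratic_module g" by (intro quadratic_module_I sos_add a b)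
  finally show "a + b \<in> quadratic_module g" .
qed

lemma generator_in_quadratic_module: "g j \<in> quadratic_module g"
proof -
  have "g j = 0 + (\<Sum>i\<in>UNIV. g i * (if i = j then 1 else 0))" by (simp add: if_distrib cong: if_cong)
  also have "\<dots> \<in> quadratic_module g"
    by (intro quadratic_module_I) (use sos_0 sos_square[of 1] in auto)
  finally show ?thesis .
qed

lemma preordering_cone_I:
  assumes "\<And>A. s A \<in> sos"
  shows "(\<Sum>A\<in>UNIV. (\<Prod>j\<in>A. g j) * s A) \<in> preordering_cone g"
  using assms unfolding preordering_cone_def by blast

lemma preordering_cone_term:
  assumes "s \<in> sos"
  shows "(\<Prod>j\<in>A. g j) * s \<in> preordering_cone g"
proof -
  have "(\<Prod>j\<in>A. g j) * s = (\<Sum>B\<in>UNIV. (\<Prod>j\<in>B. g j) * (if B = A then s else 0))"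
    by (simp add: if_distrib cong: if_cong)
  also have "\<dots> \<in> preordering_cone g" by (intro preordering_cone_I) (use sos_0 assms in auto)
  finally show ?thesis .
qed

lemma preordering_cone_add:
  assumes "a \<in> preordering_cone g" "b \<in> preordering_cone g"
  shows "a + b \<in> preordering_cone g"
proof -
  obtain s where a: "a = (\<Sum>A\<in>UNIV. (\<Prod>j\<in>A. g j) * s A)" "\<And>A. s A \<in> sos"
    using assms(1) unfolding preordering_cone_def by blast
  obtain t where b: "b = (\<Sum>A\<in>UNIV. (\<Prod>j\<in>A. g j) * t A)" "\<And>A. t A \<in> sos"
    using assms(2) unfolding preordering_cone_def by blast
  have "a + b = (\<Sum>A\<in>UNIV. (\<Prod>j\<in>A. g j) * (s A + t A))"
    unfolding a(1) b(1) by (simp add: distrib_left sum.distrib)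
  also have "\<dots> \<in> preordering_cone g" by (intro preordering_cone_I sos_add a b)
  finally show ?thesis .
qed

lemma preordering_cone_sum:
  assumes "\<And>x. x \<in> A \<Longrightarrow> h x \<in> preordering_cone g"
  shows "sum h A \<in> preordering_cone g"
  using assms
proof (induction A rule: infinite_finite_induct)
  case (insert x A)
  then show ?case by (simp add: preordering_cone_add)
qed (use preordering_cone_term[OF sos_0, where g = g] in auto)

lemma preordering_cone_square: "b ^ 2 \<in> preordering_cone g"
  using preordering_cone_term[OF sos_square[of b], of g "{}"] by simp

text \<open>\<open>g\<^sup>\<alpha> g\<^sup>\<beta>\<close> is \<open>g\<^sup>\<gamma>\<close> times a square, where \<open>\<gamma>\<close> is the symmetric difference.\<close>

lemma preordering_cone_mult:
  fixes g :: "'m::finite \<Rightarrow> 'v rpoly"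
  assumes "a \<in> preordering_cone g" "b \<in> preordering_cone g"
  shows "a * b \<in> preordering_cone g"
proof -
  obtain s where a: "a = (\<Sum>A\<in>UNIV. (\<Prod>j\<in>A. g j) * s A)" "\<And>A. s A \<in> sos"
    using assms(1) unfolding preordering_cone_def by blast
  obtain t where b: "b = (\<Sum>A\<in>UNIV. (\<Prod>j\<in>A. g j) * t A)" "\<And>A. t A \<in> sos"
    using assms(2) unfolding preordering_cone_def by blast
  have "(\<Prod>j\<in>A. g j) * s A * ((\<Prod>j\<in>B. g j) * t B) \<in> preordering_cone g" for A B
  proof -
    have split: "(\<Prod>j\<in>A. g j) = (\<Prod>j\<in>A \<inter> B. g j) * (\<Prod>j\<in>A - B. g j)"
      "(\<Prod>j\<in>B. g j) = (\<Prod>j\<in>A \<inter> B. g j) * (\<Prod>j\<in>B - A. g j)"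
      using prod.Int_Diff[of A g B] prod.Int_Diff[of B g A] by (simp_all add: Int_commute)
    have "(\<Prod>j\<in>(A - B) \<union> (B - A). g j) = (\<Prod>j\<in>A - B. g j) * (\<Prod>j\<in>B - A. g j)"
      by (rule prod.union_disjoint) auto
    then have "(\<Prod>j\<in>A. g j) * s A * ((\<Prod>j\<in>B. g j) * t B) =
        (\<Prod>j\<in>(A - B) \<union> (B - A). g j) * ((\<Prod>j\<in>A \<inter> B. g j) ^ 2 * (s A * t B))"
      unfolding split by (simp add: power2_eq_square algebra_simps)
    also have "\<dots> \<in> preordering_cone g"
      by (intro preordering_cone_term sos_mult_square sos_mult a b)
    finally show ?thesis .
  qed
  then show ?thesis unfolding a(1) b(1) sum_product by (intro preordering_cone_sum)
qed

lemma ring_preorder_preordering_cone: "ring_preorder (preordering_cone g)"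
  unfolding ring_preorder_def
  by (simp add: preordering_cone_add preordering_cone_mult preordering_cone_square)

lemma quadratic_cone_preordering_cone: "quadratic_cone (preordering_cone g)"
  unfolding quadratic_cone_def
  using preordering_cone_square[of 1 g]
  by (simp add: preordering_cone_add preordering_cone_mult preordering_cone_square)

lemma generator_in_preordering_cone: "g j \<in> preordering_cone g"
  using preordering_cone_term[OF sos_square[of 1], of g "{j}"] by simp

section \<open>Passage from the variables \<open>x\<close> to \<open>(x, \<lambda>)\<close>\<close>

lemma lift_poly_sos:
  assumes "s \<in> sos"
  shows "lift_poly s \<in> sos"
proof -
  obtain ps where "s = (\<Sum>p\<leftarrow>ps. p ^ 2)" using assms unfolding sos_def by blast
  then have "lift_poly s = (\<Sum>q\<leftarrow>map lift_poly ps. q ^ 2)" by (simp add: lift_poly_simps comp_def)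
  then show ?thesis using sos_sum by metis
qed

lemma lift_poly_quadratic_module:
  assumes "p \<in> quadratic_module g"
  shows "lift_poly p \<in> quadratic_module (\<lambda>j. lift_poly (g j))"
proof -
  obtain s0 s where p: "p = s0 + (\<Sum>j\<in>UNIV. g j * s j)" "s0 \<in> sos" "\<And>j. s j \<in> sos"
    using assms unfolding quadratic_module_def by blast
  have "lift_poly p = lift_poly s0 + (\<Sum>j\<in>UNIV. lift_poly (g j) * lift_poly (s j))"
    unfolding p(1) by (simp add: lift_poly_simps)
  also have "\<dots> \<in> quadratic_module (\<lambda>j. lift_poly (g j))"
    by (intro quadratic_module_I lift_poly_sos p)
  finally show ?thesis .
qed

section \<open>Certificates on a set where the polynomial takes finitely many values\<close>

text \<open>On each level set the value is certified separately; squares of Lagrange polynomials in \<open>F\<close> glue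
  these certificates together.\<close>

lemma certificate_from_levels:
  fixes F :: "'v::finite rpoly"
  assumes K: "quadratic_cone K" and fin: "finite ((\<lambda>z. eval_poly F z) ` V)"
    and neg: "\<And>t. t < 0 \<Longrightarrow> \<exists>p\<in>K. \<forall>z\<in>V. eval_poly F z = t \<longrightarrow> eval_poly p z = - 1"
  shows "\<exists>q\<in>K. \<forall>z\<in>V. eval_poly (F - q) z = 0"
proof -
  note cl = quadratic_coneD[OF K]
  define Y where "Y = (\<lambda>z. eval_poly F z) ` V"
  have "\<exists>q\<in>K. \<forall>z\<in>V. eval_poly F z = t \<longrightarrow> eval_poly q z = t" for t
  proof (cases "0 \<le> t")
    case True
    then show ?thesis using quadratic_cone_const[OF K] by (intro bexI[of _ "const_poly t"]) auto
  next
    case False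
    then obtain p where p: "p \<in> K" "\<forall>z\<in>V. eval_poly F z = t \<longrightarrow> eval_poly p z = - 1" using neg[of t] by auto
    show ?thesis
    proof (intro bexI[of _ "const_poly (((t + 1) / 2) ^ 2) + const_poly (((t - 1) / 2) ^ 2) * p"] ballI impI)
      fix z assume "z \<in> V" "eval_poly F z = t"
      then have "eval_poly p z = - 1" using p(2) by blast
      then show "eval_poly (const_poly (((t + 1) / 2) ^ 2) + const_poly (((t - 1) / 2) ^ 2) * p) z = t"
        by (simp add: eval_poly_simps power2_eq_square field_simps)
    qed (intro cl quadratic_cone_const[OF K] quadratic_cone_scale[OF K] p, simp_all)
  qed
  then obtain r where r: "\<And>t. r t \<in> K" "\<And>t z. z \<in> V \<Longrightarrow> eval_poly F z = t \<Longrightarrow> eval_poly (r t) z = t" by metis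
  define l where "l t = (\<Prod>s\<in>Y - {t}. const_poly (1 / (t - s)) * (F - const_poly s))" for t
  define q where "q = (\<Sum>t\<in>Y. l t ^ 2 * r t)"
  have evl: "eval_poly (l t) z = (\<Prod>s\<in>Y - {t}. 1 / (t - s) * (eval_poly F z - s))" for t z
    by (simp add: l_def eval_poly_simps)
  have sum: "sum h A \<in> K" if h: "\<And>t. h t \<in> K" for h :: "real \<Rightarrow> 'v rpoly" and A
  proof (induction A rule: infinite_finite_induct)
    case (insert t A)
    then show ?case using cl(2)[OF h[of t] insert.IH] by simp
  qed (simp_all add: cl(5))
  have "q \<in> K" unfolding q_def by (intro sum cl(3) r(1))
  moreover have "eval_poly (F - q) z = 0" if z: "z \<in> V" for z
  proof -
    define t where "t = eval_poly F z"
    have tY: "t \<in> Y" using z by (simp add: Y_def t_def)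
    have "eval_poly (l t) z = (\<Prod>s\<in>Y - {t}. 1)" unfolding evl t_def[symmetric] by (rule prod.cong) auto
    then have l1: "eval_poly (l t) z = 1" by simp
    have l0: "eval_poly (l s) z = 0" if "s \<in> Y" "s \<noteq> t" for s
      unfolding evl t_def[symmetric] by (rule prod_zero) (use that tY fin in \<open>auto simp: Y_def\<close>)
    have "eval_poly q z = (\<Sum>s\<in>Y. eval_poly (l s) z ^ 2 * eval_poly (r s) z)"
      by (simp add: q_def eval_poly_simps)
    also have "\<dots> = (\<Sum>s\<in>Y. if s = t then t else 0)"
    proof (rule sum.cong)
      fix s assume "s \<in> Y"
      then show "eval_poly (l s) z ^ 2 * eval_poly (r s) z = (if s = t then t else 0)"
        using l0[of s] l1 r(2)[OF z, of t] by (auto simp: t_def)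
    qed simp
    also have "\<dots> = t" using fin tY by (simp add: Y_def)
    finally show ?thesis by (simp add: eval_poly_simps t_def)
  qed
  ultimately show ?thesis by blast
qed

text \<open>A prime cone that contains \<open>K\<close> and the vanishing ideal of \<open>W\<close> is realized, for the finitely
  many polynomials involved, by a real point.\<close>

lemma preorder_certificate:
  fixes K :: "'v::finite rpoly set"
  assumes K: "ring_preorder K" and "finite H" "finite \<Gamma>" "\<Gamma> \<subseteq> K"
    and H: "\<And>h z. h \<in> H \<Longrightarrow> z \<in> W \<Longrightarrow> eval_poly h z = 0"
    and noncert: "\<not> (\<exists>p\<in>K. \<forall>z\<in>W. eval_poly p z = - 1)"
  shows "\<exists>z. (\<forall>h\<in>H. eval_poly h z = 0) \<and> (\<forall>g\<in>\<Gamma>. 0 \<le> eval_poly g z)"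
proof -
  \<comment> \<open>\<open>T\<close> is \<open>K\<close> plus the vanishing ideal of
    \<open>W\<close>. Then \<open>- 1\<close> lies in \<open>T\<close> exactly if some member of
    \<open>K\<close> takes the value \<open>- 1\<close> on all of \<open>W\<close>.\<close>
  define T where "T = {a. \<exists>p\<in>K. \<forall>z\<in>W. eval_poly a z = eval_poly p z}"
  note cl = ring_preorderD[OF K]
  have "ring_preorder T" unfolding ring_preorder_def
  proof (intro conjI ballI allI)
    fix a b assume "a \<in> T" "b \<in> T"
    then obtain p q where pq: "p \<in> K" "\<forall>z\<in>W. eval_poly a z = eval_poly p z"
      "q \<in> K" "\<forall>z\<in>W. eval_poly b z = eval_poly q z" by (auto simp: T_def)
    show "a + b \<in> T" unfolding T_def using pq cl(1)[OF pq(1,3)] by (auto simp: eval_poly_simps intro!: bexI[of _ "p + q"])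
    show "a * b \<in> T" unfolding T_def using pq cl(2)[OF pq(1,3)] by (auto simp: eval_poly_simps intro!: bexI[of _ "p * q"])
  next
    show "a ^ 2 \<in> T" for a unfolding T_def using cl(3)[of a] by blast
  qed
  moreover have "- 1 \<notin> T"
    using noncert unfolding T_def by (simp add: eval_poly_simps eq_commute[of "- 1"])
  ultimately obtain Q where Q: "prime_cone Q" "T \<subseteq> Q"
    using exists_prime_cone[of T "{1}"] ring_preorderD(5)[of T] by auto
  have KT: "K \<subseteq> T" unfolding T_def by blast
  obtain z where z: "\<forall>p\<in>H \<union> \<Gamma>. sg (eval_poly p z) = cone_sign Q p"
    using prime_cone_real_point[OF Q(1), of "H \<union> \<Gamma>"] assms(2,3) by auto
  have "eval_poly h z = 0" if h: "h \<in> H" for h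
  proof -
    have "h \<in> T" "- h \<in> T" unfolding T_def using H[OF h] cl(4) by (auto simp: eval_poly_simps intro!: bexI[of _ 0])
    then have "cone_sign Q h = 0" using Q(2) by (auto simp: cone_sign_def)
    moreover have "sg (eval_poly h z) = cone_sign Q h" using z h by blast
    ultimately show ?thesis by simp
  qed
  moreover have "0 \<le> eval_poly g z" if g: "g \<in> \<Gamma>" for g
  proof -
    have "g \<in> Q" using g assms(4) KT Q(2) by blast
    then have "cone_sign Q g \<noteq> - 1" by (simp add: cone_sign_def)
    moreover have "sg (eval_poly g z) = cone_sign Q g" using z g by blast
    ultimately show ?thesis by (auto simp: sg_def split: if_splits)
  qed
  ultimately show ?thesis by blast
qed

text \<open>The point from \<open>archimedean_cone_point\<close> handles all of \<open>K\<close> and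
  the vanishing ideal of \<open>W\<close> at once, so \<open>H\<close> and \<open>\<Gamma>\<close>
  are arbitrary sets. The Archimedean bound is required only as a function on \<open>W\<close>,
  because on the Fritz John variety the bound for the multipliers comes from an equation and not
  from \<open>K\<close>.\<close>

lemma archimedean_certificate:
  fixes K :: "'v::finite rpoly set"
  assumes K: "quadratic_cone K" "\<Gamma> \<subseteq> K"
    and H: "\<And>h z. h \<in> H \<Longrightarrow> z \<in> W \<Longrightarrow> eval_poly h z = 0"
    and R: "p0 \<in> K" "\<And>z. z \<in> W \<Longrightarrow> R - (\<Sum>i\<in>UNIV. (z $ i) ^ 2) = eval_poly p0 z"
    and noncert: "\<not> (\<exists>p\<in>K. \<forall>z\<in>W. eval_poly p z = - 1)"
  shows "\<exists>z. (\<forall>h\<in>H. eval_poly h z = 0) \<and> (\<forall>g\<in>\<Gamma>. 0 \<le> eval_poly g z)"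
proof -
  define T where "T = {a. \<exists>p\<in>K. \<forall>z\<in>W. eval_poly a z = eval_poly p z}"
  note cl = quadratic_coneD[OF K(1)]
  have "quadratic_cone T" unfolding quadratic_cone_def
  proof (intro conjI ballI allI)
    show "1 \<in> T" unfolding T_def using cl(1) by blast
    fix a assume "a \<in> T"
    then obtain p where p: "p \<in> K" "\<forall>z\<in>W. eval_poly a z = eval_poly p z" by (auto simp: T_def)
    show "b ^ 2 * a \<in> T" for b unfolding T_def using p cl(3)[OF p(1), of b]
      by (auto simp: eval_poly_simps intro!: bexI[of _ "b ^ 2 * p"])
    fix b assume "b \<in> T"
    then obtain q where q: "q \<in> K" "\<forall>z\<in>W. eval_poly b z = eval_poly q z" by (auto simp: T_def)
    show "a + b \<in> T" unfolding T_def using p q cl(2)[OF p(1) q(1)]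
      by (auto simp: eval_poly_simps intro!: bexI[of _ "p + q"])
  qed
  moreover have "- 1 \<notin> T"
    using noncert unfolding T_def by (simp add: eval_poly_simps eq_commute[of "- 1"])
  moreover have "const_poly R - (\<Sum>i\<in>UNIV. var_poly i ^ 2) \<in> T"
    unfolding T_def using R by (auto simp: eval_poly_simps)
  ultimately obtain z where z: "\<And>p. p \<in> T \<Longrightarrow> 0 \<le> eval_poly p z"
    using archimedean_cone_point[of T R] by blast
  have "eval_poly h z = 0" if h: "h \<in> H" for h
  proof -
    have "h \<in> T" "- h \<in> T" unfolding T_def using H[OF h] cl(5) by (auto simp: eval_poly_simps intro!: bexI[of _ 0])
    then show ?thesis using z[of h] z[of "- h"] by (simp add: eval_poly_simps)
  qed
  moreover have "0 \<le> eval_poly g z" if "g \<in> \<Gamma>" for g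
    using that K(2) by (intro z) (auto simp: T_def)
  ultimately show ?thesis by blast
qed

section \<open>Finitely many values on the Fritz John variety\<close>

lemma h_FJ_zeros:
  fixes f :: "'n::finite rpoly" and g :: "'m::finite \<Rightarrow> 'n rpoly"
  assumes "z \<in> real_zeros (h_FJ f g)"
  defines "x \<equiv> \<chi> i. z $ Inl i"
  shows "z $ Inr None * eval_poly (partial_deriv i f) x = (\<Sum>j\<in>UNIV. z $ Inr (Some j) * eval_poly (partial_deriv i (g j)) x)"
    "z $ Inr (Some j) * eval_poly (g j) x = 0"
    "(\<Sum>k\<in>UNIV. (z $ Inr k) ^ 2) = 1"
proof -
  have 0: "eval_poly (h_FJ f g k) z = 0" for k using assms(1) by (simp add: real_zeros_def)
  show "z $ Inr None * eval_poly (partial_deriv i f) x = (\<Sum>j\<in>UNIV. z $ Inr (Some j) * eval_poly (partial_deriv i (g j)) x)"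
    using 0[of "Inl i"] by (simp add: eval_poly_simps eval_lift_poly lam_def x_def)
  show "z $ Inr (Some j) * eval_poly (g j) x = 0"
    using 0[of "Inr (Inl j)"] by (simp add: eval_poly_simps eval_lift_poly lam_def x_def)
  show "(\<Sum>k\<in>UNIV. (z $ Inr k) ^ 2) = 1"
    using 0[of "Inr (Inr ())"] by (simp add: eval_poly_simps lam_def)
qed

text \<open>The multipliers have norm one, so if the first vanishes, the others form a nonzero
  vector in the kernel of \<open>phi_matrix g x\<close>.\<close>

lemma critical_point_of_zero_multiplier:
  fixes f :: "'n::finite rpoly" and g :: "'m::finite \<Rightarrow> 'n rpoly"
  assumes z: "z \<in> real_zeros (h_FJ f g)" and "z $ Inr None = 0"
  shows "(\<chi> i. z $ Inl i) \<in> critical_set g"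
proof -
  define x where "x = (\<chi> i. z $ Inl i)"
  define v where "v = (\<chi> j. z $ Inr (Some j))"
  note hz = h_FJ_zeros[OF z, folded x_def]
  have "v \<noteq> 0"
  proof
    assume "v = 0"
    then have "z $ Inr (Some j) = 0" for j by (simp add: v_def vec_eq_iff)
    then have "(z $ Inr k) ^ 2 = 0" for k using assms(2) by (cases k) auto
    then show False using hz(3) by simp
  qed
  moreover have "phi_matrix g x *v v = 0"
  proof (rule vec_eq_iff[THEN iffD2], rule allI)
    fix r :: "'n + 'm"
    show "(phi_matrix g x *v v) $ r = 0 $ r"
    proof (cases r)
      case (Inl i)
      then show ?thesis using hz(1)[of i] assms(2)
        by (simp add: matrix_vector_mult_def phi_matrix_def v_def mult.commute)
    next
      case (Inr k)
      have "(phi_matrix g x *v v) $ r = (\<Sum>j\<in>UNIV. if k = j then z $ Inr (Some k) * eval_poly (g k) x else 0)"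
        unfolding matrix_vector_mult_def phi_matrix_def v_def Inr by (simp add: mult_delta_left)
      then show ?thesis using hz(2)[of k] by simp
    qed
  qed
  ultimately have "\<not> inj ((*v) (phi_matrix g x))"
    by (metis injD matrix_vector_mult_0_right)
  then have "rank (phi_matrix g x) \<noteq> CARD('m)" using full_rank_injective by blast
  moreover have "rank (phi_matrix g x) \<le> CARD('m)" using rank_bound[of "phi_matrix g x"] by simp
  ultimately show ?thesis by (simp add: critical_set_def x_def)
qed

text \<open>The avoided set mixes \<open>pF p\<close> with powers of \<open>l0\<close>: the cone
  must keep \<open>f\<close> transcendental and also keep \<open>l0\<close> out of its support, or
  \<open>prime_cone_critical_value\<close> gives no contradiction. A product vanishing on the
  variety leaves the roots of \<open>p\<close> and, where the first multiplier is zero, the values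
  on the critical set.\<close>

lemma finite_values_on_zeros:
  fixes f :: "'n::finite rpoly" and g :: "'m::finite \<Rightarrow> 'n rpoly"
  assumes "finite (eval_poly f ` critical_set g)"
  shows "finite ((\<lambda>z. eval_poly (lift_poly f) z) ` real_zeros (h_FJ f g))"
proof -
  define V where "V = real_zeros (h_FJ f g)"
  define F where "F = (lift_poly f :: ('n + 'm option) rpoly)"
  define l0 where "l0 = (lam None :: ('n + 'm option) rpoly)"
  define pF where "pF p = poly (map_poly const_poly p) F" for p
  have ev_pF: "eval_poly (pF p) z = poly p (eval_poly F z)" for p z
  proof -
    have "map_poly (\<lambda>q. eval_poly q z) (map_poly const_poly p) = p"
      by (rule poly_eqI) (simp add: coeff_map_poly eval_poly_simps const_poly_hom)
    then show ?thesis unfolding pF_def using hom_poly[OF unital_hom_eval_poly, of "map_poly const_poly p" F z] by simp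
  qed
  \<comment> \<open>Squares belong to \<open>T\<close>, and if \<open>- m p k\<close> is outside
    \<open>Q\<close>, then \<open>pF p * l0 ^ k\<close> is outside the support.\<close>
  define m where "m p k = (pF p * l0 ^ k) ^ 2" for p k
  define T where "T = {a. \<forall>z\<in>V. 0 \<le> eval_poly a z}"
  have "\<exists>p k. p \<noteq> 0 \<and> - m p k \<in> T"
  proof (rule ccontr)
    assume neg: "\<not> ?thesis"
    have "\<exists>Q. prime_cone Q \<and> T \<subseteq> Q \<and> (\<forall>a\<in>{m p k | p k. p \<noteq> 0}. - a \<notin> Q)"
    proof (rule exists_prime_cone)
      show "ring_preorder T" unfolding ring_preorder_def T_def by (auto simp: eval_poly_simps)
      have m1: "m 1 0 = 1" by (simp add: m_def pF_def const_poly_hom)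
      show "1 \<in> {m p k | p k. p \<noteq> 0}" using m1[symmetric] by fastforce
      show "{m p k | p k. p \<noteq> 0} \<subseteq> T" by (auto simp: T_def m_def eval_poly_simps)
      show "- a \<notin> T" if "a \<in> {m p k | p k. p \<noteq> 0}" for a using that neg by blast
      have pF_mult: "pF (p * q) = pF p * pF q" for p q
        by (simp add: pF_def map_poly_hom[OF unital_hom_const_poly])
      have m_mult: "m p k * m q l = m (p * q) (k + l)" for p q k l
        by (simp add: m_def pF_mult power_add power2_eq_square mult_ac)
      show "a * b \<in> {m p k | p k. p \<noteq> 0}"
        if a: "a \<in> {m p k | p k. p \<noteq> 0}" and b: "b \<in> {m p k | p k. p \<noteq> 0}" for a b
      proof -
        obtain p k where "a = m p k" "p \<noteq> 0" using a by blast
        moreover obtain q l where "b = m q l" "q \<noteq> 0" using b by blast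
        ultimately have "a * b = m (p * q) (k + l)" "p * q \<noteq> 0" by (simp_all add: m_mult)
        then show ?thesis by blast
      qed
    qed
    then obtain Q where Q: "prime_cone Q" "T \<subseteq> Q" and avoid: "\<forall>a\<in>{m p k | p k. p \<noteq> 0}. - a \<notin> Q"
      by (elim exE conjE)
    have Q3: "- m p k \<notin> Q" if "p \<noteq> 0" for p k
      by (rule bspec[OF avoid]) (use that in auto)
    have supp: "a \<in> support Q" if "\<And>z. z \<in> V \<Longrightarrow> eval_poly a z = 0" for a
      using that Q(2) unfolding support_def T_def by (auto simp: eval_poly_simps)
    have h_FJ_supp: "h_FJ f g k \<in> support Q" for k
      by (rule supp) (simp only: V_def real_zeros_def mem_Collect_eq)
    have not_supp: "pF p * l0 ^ k \<notin> support Q" if p: "p \<noteq> 0" for p k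
    proof
      assume "pF p * l0 ^ k \<in> support Q"
      then have "m p k \<in> support Q" unfolding m_def power2_eq_square by (rule support_ideal(2)[OF Q(1)])
      then show False using Q3[OF p] by (auto simp: support_def)
    qed
    obtain js :: "'m list" where js: "set js = UNIV" "distinct js" using finite_distinct_list[OF finite] by blast
    define cs where "cs = map (\<lambda>j. (lam (Some j) :: ('n + 'm option) rpoly, lift_poly (g j) :: ('n + 'm option) rpoly)) js"
    have "l0 \<in> support Q"
    proof (rule prime_cone_critical_value[OF Q(1), of l0 F cs])
      fix i :: "'n + 'm option"
      have sum: "(\<Sum>(c, g)\<leftarrow>cs. c * partial_deriv i g) = (\<Sum>j\<in>UNIV. lam (Some j) * partial_deriv i (lift_poly (g j)))"
        unfolding cs_def using js by (simp add: comp_def sum_list_distinct_conv_sum_set)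
      show "l0 * partial_deriv i F - (\<Sum>(c, g)\<leftarrow>cs. c * partial_deriv i g) \<in> support Q"
      proof (cases i)
        case (Inl i')
        show ?thesis unfolding sum using h_FJ_supp[of "Inl i'"] by (simp add: Inl partial_deriv_lift_poly l0_def F_def)
      next
        \<comment> \<open>\<open>F\<close> and the constraints do not involve the multipliers, so in
          these directions both sides vanish; the Fritz John equations cover only the directions of
          \<open>x\<close>.\<close>
        case (Inr k)
        then show ?thesis unfolding sum
          using support_ideal(4)[OF Q(1)] by (simp add: partial_deriv_lift_poly F_def)
      qed
    next
      fix c d assume "(c, d) \<in> set cs"
      then obtain j where "c * d = h_FJ f g (Inr (Inl j))" unfolding cs_def by auto
      then show "c * d \<in> support Q" using h_FJ_supp by metis
    next
      fix p :: "real poly" assume "p \<noteq> 0"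
      then show "poly (map_poly const_poly p) F \<notin> support Q" using not_supp[of p 0] by (simp add: pF_def)
    qed
    then show False using not_supp[of 1 1] by (simp add: pF_def const_poly_hom)
  qed
  then obtain p k where p: "p \<noteq> 0" "- m p k \<in> T" by blast
  have "(\<lambda>z. eval_poly F z) ` V \<subseteq> {t. poly p t = 0} \<union> eval_poly f ` critical_set g"
  proof
    fix t assume "t \<in> (\<lambda>z. eval_poly F z) ` V"
    then obtain z where z: "z \<in> V" "t = eval_poly F z" by blast
    have "(poly p t * (z $ Inr None) ^ k) ^ 2 \<le> 0"
      using p(2) z unfolding T_def m_def by (auto simp: eval_poly_simps ev_pF l0_def lam_def)
    then have "poly p t = 0 \<or> z $ Inr None = 0" by auto
    then show "t \<in> {t. poly p t = 0} \<union> eval_poly f ` critical_set g"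
    proof
      assume "z $ Inr None = 0"
      then have "(\<chi> i. z $ Inl i) \<in> critical_set g"
        using critical_point_of_zero_multiplier z(1) by (auto simp: V_def)
      then show ?thesis using z(2) by (auto simp: F_def eval_lift_poly)
    qed simp
  qed
  moreover have "finite ({t. poly p t = 0} \<union> eval_poly f ` critical_set g)"
    using poly_roots_finite[OF p(1)] assms by simp
  ultimately show ?thesis unfolding V_def F_def by (rule finite_subset)
qed

theorem theorem1:
  fixes f :: "'n::finite rpoly" and g :: "'m::finite \<Rightarrow> 'n rpoly"
  assumes "\<forall>x \<in> feasible_set g. eval_poly f x \<ge> 0"
    and "finite (eval_poly f ` critical_set g)"
  shows "(\<exists>q \<in> preordering_cone (\<lambda>j. lift_poly (g j) :: ('n + 'm option) rpoly).
            \<forall>z \<in> real_zeros (h_FJ f g). eval_poly (lift_poly f - q) z = 0) \<and>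
         (archimedean_cond g \<longrightarrow>
          (\<exists>q \<in> quadratic_module (\<lambda>j. lift_poly (g j) :: ('n + 'm option) rpoly).
            \<forall>z \<in> real_zeros (h_FJ f g). eval_poly (lift_poly f - q) z = 0))"
proof -
  define V where "V = real_zeros (h_FJ f g)"
  define F where "F = (lift_poly f :: ('n + 'm option) rpoly)"
  define G where "G = (\<lambda>j. lift_poly (g j) :: ('n + 'm option) rpoly)"
  have fin: "finite ((\<lambda>z. eval_poly F z) ` V)"
    unfolding V_def F_def by (rule finite_values_on_zeros[OF assms(2)])
  define W where "W t = {z \<in> V. eval_poly F z = t}" for t
  define H where "H t = insert (F - const_poly t) (range (h_FJ f g))" for t
  have H: "eval_poly h z = 0" if "h \<in> H t" "z \<in> W t" for h z t
    using that by (auto simp: H_def W_def V_def real_zeros_def eval_poly_simps)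
  \<comment> \<open>Such a point would project to a feasible \<open>x\<close> at which
    \<open>f\<close> takes the negative value \<open>t\<close>.\<close>
  have no_point: "\<not> (\<exists>z. (\<forall>h\<in>H t. eval_poly h z = 0) \<and> (\<forall>p\<in>range G. 0 \<le> eval_poly p z))" if t: "t < 0" for t
  proof
    assume "\<exists>z. (\<forall>h\<in>H t. eval_poly h z = 0) \<and> (\<forall>p\<in>range G. 0 \<le> eval_poly p z)"
    then obtain z where z: "\<forall>h\<in>H t. eval_poly h z = 0" "\<forall>p\<in>range G. 0 \<le> eval_poly p z" by blast
    have "(\<chi> i. z $ Inl i) \<in> feasible_set g" using z(2) by (auto simp: feasible_set_def G_def eval_lift_poly)
    moreover have "eval_poly F z = t" using z(1) by (simp add: H_def eval_poly_simps)
    ultimately show False using assms(1) t by (auto simp: F_def eval_lift_poly)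
  qed
  have "\<exists>q\<in>preordering_cone G. \<forall>z\<in>V. eval_poly (F - q) z = 0"
  proof (rule certificate_from_levels[OF quadratic_cone_preordering_cone fin])
    fix t :: real assume t: "t < 0"
    have "\<exists>p\<in>preordering_cone G. \<forall>z\<in>W t. eval_poly p z = - 1"
    proof (rule ccontr)
      assume noncert: "\<not> ?thesis"
      have "\<exists>z. (\<forall>h\<in>H t. eval_poly h z = 0) \<and> (\<forall>p\<in>range G. 0 \<le> eval_poly p z)"
      proof (rule preorder_certificate[OF ring_preorder_preordering_cone _ _ _ _ noncert])
        show "range G \<subseteq> preordering_cone G" using generator_in_preordering_cone by blast
        show "finite (H t)" by (simp add: H_def)
      qed (use H in auto)
      then show False using no_point[OF t] by blast
    qed
    then show "\<exists>p\<in>preordering_cone G. \<forall>z\<in>V. eval_poly F z = t \<longrightarrow> eval_poly p z = - 1"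
      by (auto simp: W_def)
  qed
  moreover have "\<exists>q\<in>quadratic_module G. \<forall>z\<in>V. eval_poly (F - q) z = 0" if arch: "archimedean_cond g"
  proof (rule certificate_from_levels[OF quadratic_cone_quadratic_module fin])
    fix t :: real assume t: "t < 0"
    obtain R where R: "const_poly R - (\<Sum>i\<in>UNIV. var_poly i ^ 2) \<in> quadratic_module g"
      using arch unfolding archimedean_cond_def by blast
    define p0 where "p0 = (lift_poly (const_poly R - (\<Sum>i\<in>UNIV. var_poly i ^ 2)) :: ('n + 'm option) rpoly)"
    have p0: "p0 \<in> quadratic_module G" unfolding p0_def G_def by (rule lift_poly_quadratic_module[OF R])
    \<comment> \<open>On the variety the squares of the multipliers add exactly one to the sum over
      \<open>x\<close>, which turns \<open>R\<close> into \<open>R + 1\<close>.\<close>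
    have p0_eval: "(R + 1) - (\<Sum>i\<in>UNIV. (z $ i) ^ 2) = eval_poly p0 z" if "z \<in> W t" for z
    proof -
      have "(\<Sum>k\<in>UNIV. (z $ Inr k) ^ 2) = 1"
        using that h_FJ_zeros(3) by (auto simp: W_def V_def)
      moreover have "(\<Sum>i\<in>UNIV. (z $ i) ^ 2) = (\<Sum>i\<in>UNIV. (z $ Inl i) ^ 2) + (\<Sum>k\<in>UNIV. (z $ Inr k) ^ 2)"
        unfolding UNIV_Plus_UNIV[symmetric] by (subst sum.Plus) auto
      ultimately show ?thesis by (simp add: p0_def eval_lift_poly eval_poly_simps)
    qed
    have "\<exists>p\<in>quadratic_module G. \<forall>z\<in>W t. eval_poly p z = - 1"
    proof (rule ccontr)
      assume noncert: "\<not> ?thesis"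
      have "\<exists>z. (\<forall>h\<in>H t. eval_poly h z = 0) \<and> (\<forall>p\<in>range G. 0 \<le> eval_poly p z)"
      proof (rule archimedean_certificate[OF quadratic_cone_quadratic_module _ _ p0 p0_eval noncert])
        show "range G \<subseteq> quadratic_module G" using generator_in_quadratic_module by blast
      qed (use H in auto)
      then show False using no_point[OF t] by blast
    qed
    then show "\<exists>p\<in>quadratic_module G. \<forall>z\<in>V. eval_poly F z = t \<longrightarrow> eval_poly p z = - 1"
      by (auto simp: W_def)
  qed
  ultimately show ?thesis unfolding V_def F_def G_def by blast
qed

end
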